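(* Let $X$ be a continuous adapted $\mathbb{R}^d$-valued process satisfying $$dX_t=\sum_{j=1}^n\sigma_j(t,X)\,dW^j_t+b(t,X)\,dt,$$ where $W=(W^1,\dots,W^n)$ is a standard Brownian motion and $\sigma_j,b:C(\mathbb{R}_+;\mathbb{R}^d)\to C(\mathbb{R}_+;\mathbb{R}^d)$, $j=1,\dots,n$. Let $b$ and $\sigma_j$, $j=1,\dots,n$, be bounded. Suppose that there exist $\varepsilon,C>0$ such that $$|\sigma_j(t,w)-\sigma_j(s,w)|\le C\Big(\ln\Big(\frac1{\Delta_{s,t}(w)}\Big)\Big)^{-(2+\varepsilon)},\qquad j=1,\dots,n,$$ for all $0\le s\le t$ and $w\in C(\mathbb{R}_+;\mathbb{R}^d)$ with $\Delta_{s,t}(w)<1$, and that there exist $\lambda^*\ge\lambda_*>0$ such that $$\lambda^*\ge\sigma\sigma^*(t,w)\ge\lambda_*\qquad\forall t\ge0,\ w\in C(\mathbb{R}_+;\mathbb{R}^d).$$ Then for every $T>0$ the law of $X_T$ is absolutely continuous with respect to the Lebesgue measure and its density belongs to $L^{\mathbf{e}_{\log}}$.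
   Context: Notation: $\sigma_j(t,\varphi)=\sigma_j(\varphi)(t)$, $b(t,\varphi)=b(\varphi)(t)$ for $\varphi\in C(\mathbb{R}_+;\mathbb{R}^d)$; $\Delta_{s,t}(w)=\sup_{s\le u\le t}|w_u-w_s|$; $\sigma$ is the matrix with columns $\sigma_1,\dots,\sigma_n$ and $\sigma^*$ its transpose; the inequalities for $\sigma\sigma^*$ are in the sense of symmetric matrices ($\lambda^*I\ge\sigma\sigma^*\ge\lambda_*I$). The stochastic integrals are Itô integrals (so the integrands $\sigma_j(t,X)$, $b(t,X)$ are adapted to the filtration). No uniqueness for the equation is assumed: $X$ is any adapted process satisfying it. When $\Delta_{s,t}(w)=0$ the right-hand side of the regularity condition is read as $0$. $\mathbf{e}_{\log}(t)=(1+|t|)\ln(1+|t|)$, $\|f\|_{\mathbf{e}_{\log}}=\inf\{c>0:\int\mathbf{e}_{\log}(f(x)/c)dx\le1\}$ and $L^{\mathbf{e}_{\log}}=\{f:\|f\|_{\mathbf{e}_{\log}}<\infty\}$. *)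

theory Defs
  imports "HOL-Probability.Probability"
begin

section \<open>Path space\<close>

text \<open>
  Paths are functions on the real line that are \<^term>\<open>undefined\<close> at negative times, so that two
  elements of \<open>cpaths\<close> are equal iff they agree on the half-line.
\<close>

definition cpaths :: "(real \<Rightarrow> 'e::topological_space) set" where
  "cpaths = {w \<in> extensional {0..}. continuous_on {0..} w}"

definition osc :: "real \<Rightarrow> real \<Rightarrow> (real \<Rightarrow> 'e::real_normed_vector) \<Rightarrow> real" where
  "osc s t w = (SUP u\<in>{s..t}. norm (w u - w s))"

definition log_modulus :: "real \<Rightarrow> real \<Rightarrow> real" where
  "log_modulus \<epsilon> \<delta> = (if \<delta> = 0 then 0 else ln (1 / \<delta>) powr (- (2 + \<epsilon>)))"

section \<open>Coefficient matrix\<close>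

definition coeff_matrix ::
    "('n \<Rightarrow> (real \<Rightarrow> real^'d) \<Rightarrow> (real \<Rightarrow> real^'d)) \<Rightarrow> real \<Rightarrow> (real \<Rightarrow> real^'d) \<Rightarrow> real^'n^'d" where
  "coeff_matrix \<sigma> t w = (\<chi> i j. \<sigma> j w t $ i)"

definition pos_semidef :: "real^'d^'d \<Rightarrow> bool" where
  "pos_semidef A \<longleftrightarrow> transpose A = A \<and> (\<forall>x. 0 \<le> x \<bullet> (A *v x))"

definition sym_le :: "real^'d^'d \<Rightarrow> real^'d^'d \<Rightarrow> bool" where
  "sym_le A B \<longleftrightarrow> pos_semidef (B - A)"

section \<open>Filtrations and Brownian motion\<close>

text \<open>
  The library locale \<^locale>\<open>filtration\<close> is indexed by a whole linear order, here the reals; composing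
  with \<open>max 0\<close> makes it a condition on the \<sigma>-algebras at nonnegative times only. No usual conditions
  (completeness, right-continuity) are imposed.
\<close>

definition filtration_nonneg :: "'a measure \<Rightarrow> (real \<Rightarrow> 'a measure) \<Rightarrow> bool" where
  "filtration_nonneg M F \<longleftrightarrow>
     filtration (space M) (\<lambda>t. F (max 0 t)) \<and> (\<forall>t\<ge>0. subalgebra M (F t))"

definition adapted :: "(real \<Rightarrow> 'a measure) \<Rightarrow> ('a \<Rightarrow> real \<Rightarrow> 'e::topological_space) \<Rightarrow> bool" where
  "adapted F X \<longleftrightarrow> (\<forall>t\<ge>0. (\<lambda>\<omega>. X \<omega> t) \<in> borel_measurable (F t))"

definition prog_measurable ::
    "(real \<Rightarrow> 'a measure) \<Rightarrow> ('a \<Rightarrow> real \<Rightarrow> 'e::topological_space) \<Rightarrow> bool" where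
  "prog_measurable F H \<longleftrightarrow>
     (\<forall>t\<ge>0. (\<lambda>(s, \<omega>). H \<omega> s) \<in> borel_measurable (restrict_space borel {0..t} \<Otimes>\<^sub>M F t))"

text \<open>
  Standard Brownian motion relative to the filtration: increments over \<open>[s, t]\<close> are independent of
  the past and have law \<open>N(0, (t - s) I)\<close>.
\<close>

definition brownian_motion ::
    "'a measure \<Rightarrow> (real \<Rightarrow> 'a measure) \<Rightarrow> ('a \<Rightarrow> real \<Rightarrow> real^'n) \<Rightarrow> bool" where
  "brownian_motion M F W \<longleftrightarrow>
     adapted F W \<and>
     (AE \<omega> in M. W \<omega> 0 = 0 \<and> continuous_on {0..} (W \<omega>)) \<and>
     (\<forall>s t. 0 \<le> s \<and> s < t \<longrightarrow>
        prob_space.indep_set M (sets (F s))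
          {(\<lambda>\<omega>. W \<omega> t - W \<omega> s) -` A \<inter> space M | A. A \<in> sets borel} \<and>
        distributed M lborel (\<lambda>\<omega>. W \<omega> t - W \<omega> s)
          (\<lambda>x. \<Prod>j\<in>UNIV. ennreal (normal_density 0 (sqrt (t - s)) (x $ j))))"

section \<open>It\^o integral\<close>

text \<open>
  A simple integrand \<open>\<Sum>\<^sub>i \<xi>\<^sub>i 1\<^bsub>(\<tau> i, \<tau> (i+1)]\<^esub>\<close> is given by a number \<open>N\<close> of intervals, a
  partition \<open>\<tau>\<close>, and bounded weights \<open>\<xi> i\<close> measurable at the left endpoint of their interval.
\<close>

definition simple_integrand ::
    "'a measure \<Rightarrow> (real \<Rightarrow> 'a measure) \<Rightarrow> nat \<Rightarrow> (nat \<Rightarrow> real) \<Rightarrow> (nat \<Rightarrow> 'a \<Rightarrow> 'e::real_normed_vector) \<Rightarrow> bool"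
  where
  "simple_integrand M F N \<tau> \<xi> \<longleftrightarrow>
     0 \<le> \<tau> 0 \<and> (\<forall>i<N. \<tau> i \<le> \<tau> (Suc i)) \<and>
     (\<forall>i<N. \<xi> i \<in> borel_measurable (F (\<tau> i)) \<and> bounded (\<xi> i ` space M))"

definition simple_process ::
    "nat \<Rightarrow> (nat \<Rightarrow> real) \<Rightarrow> (nat \<Rightarrow> 'a \<Rightarrow> 'e::real_normed_vector) \<Rightarrow> 'a \<Rightarrow> real \<Rightarrow> 'e" where
  "simple_process N \<tau> \<xi> \<omega> s = (\<Sum>i<N. indicator {\<tau> i<..\<tau> (Suc i)} s *\<^sub>R \<xi> i \<omega>)"

definition simple_integral ::
    "nat \<Rightarrow> (nat \<Rightarrow> real) \<Rightarrow> (nat \<Rightarrow> 'a \<Rightarrow> 'e::real_normed_vector) \<Rightarrow> ('a \<Rightarrow> real \<Rightarrow> real) \<Rightarrow> 'a \<Rightarrow> real \<Rightarrow> 'e"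
  where
  "simple_integral N \<tau> \<xi> B \<omega> t =
     (\<Sum>i<N. (B \<omega> (min t (\<tau> (Suc i))) - B \<omega> (min t (\<tau> i))) *\<^sub>R \<xi> i \<omega>)"

text \<open>
  \<open>is_ito_integral M F B H J\<close>: the process \<open>J\<close> is a continuous version of \<open>t \<mapsto> \<integral>\<^sub>0\<^sup>t H dB\<close>. The
  integral at time \<open>t\<close> is the \<open>L\<^sup>2\<close> limit of the integrals of simple integrands converging to \<open>H\<close> in
  \<open>L\<^sup>2([0, t] \<times> \<Omega>)\<close>; by the It\^o isometry the limit does not depend on the approximating sequence.
  Expectations are nonnegative integrals, hence never \<open>0\<close> by non-integrability.
\<close>

definition is_ito_integral ::
    "'a measure \<Rightarrow> (real \<Rightarrow> 'a measure) \<Rightarrow> ('a \<Rightarrow> real \<Rightarrow> real) \<Rightarrow>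
      ('a \<Rightarrow> real \<Rightarrow> 'e::euclidean_space) \<Rightarrow> ('a \<Rightarrow> real \<Rightarrow> 'e) \<Rightarrow> bool" where
  "is_ito_integral M F B H J \<longleftrightarrow>
     prog_measurable F H \<and>
     (\<forall>t\<ge>0. (\<integral>\<^sup>+\<omega>. (\<integral>\<^sup>+s\<in>{0..t}. ennreal ((norm (H \<omega> s))\<^sup>2) \<partial>lborel) \<partial>M) < \<infinity>) \<and>
     (AE \<omega> in M. continuous_on {0..} (J \<omega>)) \<and>
     (\<forall>t\<ge>0. (\<lambda>\<omega>. J \<omega> t) \<in> borel_measurable M \<and>
       (\<exists>N \<tau> \<xi>. (\<forall>k. simple_integrand M F (N k) (\<tau> k) (\<xi> k)) \<and>
          (\<lambda>k. \<integral>\<^sup>+\<omega>. (\<integral>\<^sup>+s\<in>{0..t}.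
             ennreal ((norm (simple_process (N k) (\<tau> k) (\<xi> k) \<omega> s - H \<omega> s))\<^sup>2) \<partial>lborel) \<partial>M)
            \<longlonglongrightarrow> 0 \<and>
          (\<lambda>k. \<integral>\<^sup>+\<omega>. ennreal ((norm (simple_integral (N k) (\<tau> k) (\<xi> k) B \<omega> t - J \<omega> t))\<^sup>2) \<partial>M)
            \<longlonglongrightarrow> 0))"

text \<open>
  The integral form of \<open>dX\<^sub>t = \<Sum>\<^sub>j \<sigma>\<^sub>j(t, X) dW\<^sup>j\<^sub>t + b(t, X) dt\<close>, up to indistinguishability.
\<close>

definition satisfies_sde ::
    "'a measure \<Rightarrow> (real \<Rightarrow> 'a measure) \<Rightarrow> ('a \<Rightarrow> real \<Rightarrow> real^'n) \<Rightarrow>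
      ('n \<Rightarrow> (real \<Rightarrow> real^'d) \<Rightarrow> (real \<Rightarrow> real^'d)) \<Rightarrow> ((real \<Rightarrow> real^'d) \<Rightarrow> (real \<Rightarrow> real^'d)) \<Rightarrow>
      ('a \<Rightarrow> real \<Rightarrow> real^'d) \<Rightarrow> bool" where
  "satisfies_sde M F W \<sigma> b X \<longleftrightarrow>
     (\<exists>J. (\<forall>j. is_ito_integral M F (\<lambda>\<omega> t. W \<omega> t $ j) (\<lambda>\<omega>. \<sigma> j (X \<omega>)) (J j)) \<and>
       (AE \<omega> in M. \<forall>t\<ge>0.
          X \<omega> t = X \<omega> 0 + (\<Sum>j\<in>UNIV. J j \<omega> t) + integral {0..t} (b (X \<omega>))))"

section \<open>The Orlicz space\<close>

definition e_log :: "real \<Rightarrow> real" where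
  "e_log t = (1 + \<bar>t\<bar>) * ln (1 + \<bar>t\<bar>)"

text \<open>The infimum is taken in the extended half-line, so it is \<open>\<infinity>\<close> if no \<open>c\<close> is admissible.\<close>

definition e_log_norm :: "('e::euclidean_space \<Rightarrow> real) \<Rightarrow> ennreal" where
  "e_log_norm f = Inf {ennreal c | c. 0 < c \<and> (\<integral>\<^sup>+x. ennreal (e_log (f x / c)) \<partial>lborel) \<le> 1}"

definition L_e_log :: "('e::euclidean_space \<Rightarrow> real) set" where
  "L_e_log = {f \<in> borel_measurable borel. e_log_norm f < \<infinity>}"

end

theory Submission
  imports Defs
begin

text \<open>
  On the last interval \<open>[T - \<delta>, T]\<close> freeze the coefficients: the law of the frozen variable is,
  conditionally on the past, Gaussian with covariance at least \<open>lam_low \<delta>\<close>, and by the logarithmic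
  modulus of continuity it is \<open>L\<^sup>1\<close>-close to \<open>X T\<close> up to a multiple of
  \<open>\<surd>\<delta> * ln (1 / \<delta>) powr - (2 + \<epsilon>)\<close>.
  Smooth a test function at a scale \<open>h\<close> logarithmically smaller than \<open>\<surd>\<delta>\<close> with a kernel of high order. For
  \<open>\<delta> = 4^-m\<close>, passing from \<open>m\<close> to \<open>m + 1\<close> changes the smoothed expectation of \<open>f (X T)\<close> by
  \<open>O(m^-(2 + \<epsilon>/2))\<close> uniformly in \<open>\<bar>f\<bar> \<le> 1\<close>, while at level \<open>m\<close> the smoothed law has a density at
  most exponential in \<open>m\<close>. Hence \<open>P (X T \<in> A) \<le> c (Q^m \<bar>A\<bar> + m^-(1 + \<epsilon>/4))\<close> for all \<open>m\<close>. This gives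
  absolute continuity, and, applied to the level sets \<open>{p > Q^(2 m)}\<close> of the density, whose
  probabilities become summable in \<open>m\<close>, it gives \<open>\<integral> p ln (1 + p) < \<infinity>\<close>.
\<close>

section \<open>Gaussian measures\<close>

definition gauss_density :: "'e::euclidean_space \<Rightarrow> real" where
  "gauss_density x = (\<Prod>b\<in>Basis. normal_density 0 1 (x \<bullet> b))"

definition std_gauss :: "'e::euclidean_space measure" where
  "std_gauss = density lborel (\<lambda>x. ennreal (gauss_density x))"

lemma gauss_density_exp:
  "gauss_density (x::'e::euclidean_space) =
     (1 / sqrt (2 * pi)) ^ DIM('e) * exp (- (norm x)\<^sup>2 / 2)"
proof -
  have "(norm x)\<^sup>2 = (\<Sum>b\<in>Basis. (x \<bullet> b)\<^sup>2)"
    by (subst power2_norm_eq_inner, subst euclidean_inner) (simp add: power2_eq_square)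
  then have "(\<Prod>b\<in>Basis. exp (- (x \<bullet> b)\<^sup>2 / 2)) = exp (- (norm x)\<^sup>2 / 2)"
    by (simp add: exp_sum [symmetric] sum_negf sum_divide_distrib [symmetric])
  then show ?thesis
    unfolding gauss_density_def std_normal_density_def by (simp only: prod.distrib prod_constant)
qed

lemma gauss_density_pos: "0 < gauss_density x"
  unfolding gauss_density_def by (intro prod_pos normal_density_pos) auto

lemma gauss_density_le_1: "gauss_density (x::'e::euclidean_space) \<le> 1"
proof -
  have "1 \<le> sqrt (2 * pi)" using pi_gt3 by simp
  then have "1 / sqrt (2 * pi) \<le> 1" by simp
  then have "(1 / sqrt (2 * pi)) ^ DIM('e) \<le> 1" by (intro power_le_one) auto
  then show ?thesis unfolding gauss_density_exp
    by (intro mult_le_one) auto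
qed

lemma gauss_density_measurable [measurable]: "gauss_density \<in> borel_measurable borel"
  unfolding gauss_density_def [abs_def] by measurable

lemma nn_integral_gauss_density: "(\<integral>\<^sup>+x. ennreal (gauss_density x) \<partial>lborel) = 1"
proof -
  have "(\<integral>\<^sup>+x. ennreal (gauss_density (x::'a)) \<partial>lborel)
      = (\<integral>\<^sup>+x. (\<Prod>b\<in>Basis. ennreal (normal_density 0 1 (x \<bullet> b))) \<partial>(lborel :: 'a measure))"
    unfolding gauss_density_def by (simp add: prod_ennreal)
  also have "\<dots> = (\<Prod>b\<in>(Basis::'a set). \<integral>\<^sup>+x. ennreal (normal_density 0 1 x) \<partial>lborel)"
    by (rule nn_integral_lborel_prod) auto
  also have "(\<integral>\<^sup>+x. ennreal (normal_density 0 1 x) \<partial>lborel) = 1"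
    by (subst nn_integral_eq_integral) auto
  finally show ?thesis by simp
qed

lemma sets_std_gauss [simp, measurable_cong]: "sets std_gauss = sets borel"
  and space_std_gauss [simp]: "space std_gauss = UNIV"
  by (simp_all add: std_gauss_def)

lemma prob_space_std_gauss: "prob_space std_gauss"
  unfolding std_gauss_def by standard (simp add: emeasure_density nn_integral_gauss_density)

lemma integrable_gauss_density: "integrable lborel gauss_density"
  and integral_gauss_density: "integral\<^sup>L lborel gauss_density = 1"
proof -
  have "has_bochner_integral lborel gauss_density 1"
    by (rule has_bochner_integral_nn_integral)
       (auto simp: nn_integral_gauss_density intro: less_imp_le gauss_density_pos)
  then show "integrable lborel gauss_density" "integral\<^sup>L lborel gauss_density = 1"
    by (auto simp: has_bochner_integral_iff)
qed

lemma integral_std_gauss: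
  fixes f :: "'e::euclidean_space \<Rightarrow> real"
  assumes "f \<in> borel_measurable borel"
  shows "integral\<^sup>L std_gauss f = (\<integral>x. gauss_density x * f x \<partial>lborel)"
  unfolding std_gauss_def using assms
  by (subst integral_density) (auto intro!: AE_I2 less_imp_le gauss_density_pos)

section \<open>Translations and the total variation distance of shifted Gaussians\<close>

lemma integrable_lborel_translate:
  fixes f :: "'e::euclidean_space \<Rightarrow> real"
  assumes "integrable lborel f" shows "integrable lborel (\<lambda>x. f (c + x))"
proof -
  have "integrable (distr lborel borel ((+) c)) f" using assms by (simp add: lborel_distr_plus)
  then show ?thesis by (subst (asm) integrable_distr_eq) (use assms in auto)
qed

lemma integral_lborel_translate:
  fixes f :: "'e::euclidean_space \<Rightarrow> real"
  assumes "f \<in> borel_measurable borel" shows "(\<integral>x. f (c + x) \<partial>lborel) = (\<integral>x. f x \<partial>lborel)"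
proof -
  have "(\<integral>x. f x \<partial>lborel) = (\<integral>x. f x \<partial>(distr lborel borel ((+) c)))" by (simp add: lborel_distr_plus)
  also have "\<dots> = (\<integral>x. f (c + x) \<partial>lborel)" by (subst integral_distr) (use assms in auto)
  finally show ?thesis by simp
qed

text \<open>Nonnegativity of the variance of |f|. Integrability of f comes from |t| \<le> 1 +
  t^2.\<close>

lemma (in prob_space) expectation_abs_le_sqrt:
  fixes f :: "'a \<Rightarrow> real"
  assumes [measurable]: "f \<in> borel_measurable M" and i2: "integrable M (\<lambda>x. (f x)\<^sup>2)"
  shows "integrable M f" "expectation (\<lambda>x. \<bar>f x\<bar>) \<le> sqrt (expectation (\<lambda>x. (f x)\<^sup>2))"
proof -
  have b: "\<bar>t\<bar> \<le> 1 + t\<^sup>2" for t :: real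
    using zero_le_power2 [of "\<bar>t\<bar> - 1"] by (simp add: power2_diff)
  show i1: "integrable M f"
    by (rule Bochner_Integration.integrable_bound [of M "\<lambda>x. 1 + (f x)\<^sup>2"])
       (use i2 b in \<open>auto intro!: AE_I2\<close>)
  have "0 \<le> variance (\<lambda>x. \<bar>f x\<bar>)" by (rule variance_positive)
  also have "\<dots> = expectation (\<lambda>x. \<bar>f x\<bar>\<^sup>2) - (expectation (\<lambda>x. \<bar>f x\<bar>))\<^sup>2"
    by (rule variance_eq) (use i1 i2 in auto)
  finally show "expectation (\<lambda>x. \<bar>f x\<bar>) \<le> sqrt (expectation (\<lambda>x. (f x)\<^sup>2))"
    by (intro real_le_rsqrt) simp
qed

text \<open>The points \<open>x\<close> and \<open>x + 2 u\<close> have midpoint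
  \<open>x + u\<close> and half-difference \<open>u\<close>, so this is the parallelogram identity
  in the exponent. Divided by \<open>gauss_density x\<close> it shows that the second moment of the
  likelihood ratio is \<open>exp (|u|^2)\<close>, as the remaining factor is a translated Gaussian
  density.\<close>

lemma gauss_density_shift_square:
  "(gauss_density (x + u))\<^sup>2 = gauss_density x * gauss_density (2 *\<^sub>R u + x) * exp ((norm u)\<^sup>2)"
proof -
  have "(- (norm (x + u))\<^sup>2 / 2) * 2 = - (norm x)\<^sup>2 / 2 + - (norm (2 *\<^sub>R u + x))\<^sup>2 / 2 + (norm u)\<^sup>2"
    by (simp add: power2_norm_eq_inner inner_add_left inner_add_right inner_commute field_simps)
  then have "(exp (- (norm (x + u))\<^sup>2 / 2))\<^sup>2
      = exp (- (norm x)\<^sup>2 / 2) * exp (- (norm (2 *\<^sub>R u + x))\<^sup>2 / 2) * exp ((norm u)\<^sup>2)"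
    by (simp add: exp_add [symmetric] exp_double [symmetric] mult.commute)
  then show ?thesis unfolding gauss_density_exp
    by (simp add: power_mult_distrib power2_eq_square algebra_simps)
qed

text \<open>The \<open>\<chi>\<^sup>2\<close>-distance between the shifted and the standard Gaussian is
  \<open>exp (|u|\<^sup>2) - 1\<close>, and dominates the squared total variation distance.\<close>

lemma gauss_density_shift_L1:
  fixes u :: "'e::euclidean_space"
  shows "integrable lborel (\<lambda>x. \<bar>gauss_density (u + x) - gauss_density x\<bar>)"
    and "(\<integral>x. \<bar>gauss_density (u + x) - gauss_density x\<bar> \<partial>lborel) \<le> 2 * norm u"
proof -
  \<comment> \<open>\<open>r\<close> is the likelihood ratio of the shifted to the standard
    Gaussian, minus 1. Its mean absolute value under \<open>std_gauss\<close> is the L1 distance of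
    the densities, its mean square the \<chi>^2-distance.\<close>
  define r where "r = (\<lambda>x. gauss_density (u + x) / gauss_density x - 1)"
  have [measurable]: "r \<in> borel_measurable borel" unfolding r_def by measurable
  interpret prob_space "std_gauss :: 'e measure" by (rule prob_space_std_gauss)
  have iu: "integrable lborel (\<lambda>x. gauss_density (c + x :: 'e))" for c
    by (rule integrable_lborel_translate [OF integrable_gauss_density])
  have eu: "(\<integral>x. gauss_density (c + x :: 'e) \<partial>lborel) = 1" for c
    using integral_lborel_translate [of gauss_density c] by (simp add: integral_gauss_density)
  show int: "integrable lborel (\<lambda>x. \<bar>gauss_density (u + x) - gauss_density x\<bar>)"
    by (intro integrable_abs Bochner_Integration.integrable_diff iu integrable_gauss_density)
  have r2: "gauss_density x * (r x)\<^sup>2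
      = exp ((norm u)\<^sup>2) * gauss_density (2 *\<^sub>R u + x) - 2 * gauss_density (u + x) + gauss_density x" for x
  proof -
    have p: "gauss_density x > 0" by (rule gauss_density_pos)
    have "gauss_density x * (r x)\<^sup>2
        = (gauss_density (x + u))\<^sup>2 / gauss_density x - 2 * gauss_density (u + x) + gauss_density x"
      using p unfolding r_def by (simp add: power2_eq_square field_simps)
    then show ?thesis using p by (simp add: gauss_density_shift_square)
  qed
  have ir2: "integrable lborel (\<lambda>x. gauss_density x * (r x)\<^sup>2)"
    unfolding r2 by (intro Bochner_Integration.integrable_add Bochner_Integration.integrable_diff
        integrable_mult_right iu integrable_gauss_density)
  have "(\<integral>x. gauss_density x * (r x)\<^sup>2 \<partial>lborel) = exp ((norm u)\<^sup>2) - 1"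
    unfolding r2 by (simp add: iu eu integrable_gauss_density integral_gauss_density)
  then have e2: "expectation (\<lambda>x. (r x)\<^sup>2) = exp ((norm u)\<^sup>2) - 1"
    by (simp add: integral_std_gauss)
  have "integrable std_gauss (\<lambda>x. (r x)\<^sup>2)"
    unfolding std_gauss_def using ir2
    by (subst integrable_density) (auto intro!: AE_I2 less_imp_le gauss_density_pos)
  then have "expectation (\<lambda>x. \<bar>r x\<bar>) \<le> sqrt (exp ((norm u)\<^sup>2) - 1)"
    unfolding e2 [symmetric] by (intro expectation_abs_le_sqrt(2)) auto
  also have "expectation (\<lambda>x. \<bar>r x\<bar>) = (\<integral>x. \<bar>gauss_density (u + x) - gauss_density x\<bar> \<partial>lborel)"
  proof -
    have "gauss_density x * \<bar>r x\<bar> = \<bar>gauss_density (u + x) - gauss_density x\<bar>" for x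
    proof -
      have "gauss_density x * \<bar>r x\<bar> = \<bar>gauss_density x * r x\<bar>"
        using gauss_density_pos [of x] by (simp add: abs_mult)
      also have "gauss_density x * r x = gauss_density (u + x) - gauss_density x"
        using gauss_density_pos [of x] by (simp add: r_def field_simps)
      finally show ?thesis .
    qed
    then show ?thesis by (subst integral_std_gauss) auto
  qed
  finally have le: "(\<integral>x. \<bar>gauss_density (u + x) - gauss_density x\<bar> \<partial>lborel) \<le> sqrt (exp ((norm u)\<^sup>2) - 1)" .
  show "(\<integral>x. \<bar>gauss_density (u + x) - gauss_density x\<bar> \<partial>lborel) \<le> 2 * norm u"
  \<comment> \<open>For \<open>norm u \<le> 1\<close> the exponential bound gives
    \<open>exp (|u|^2) - 1 \<le> 2 |u|^2\<close>, whose root is below \<open>2 |u|\<close>. For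
    larger \<open>u\<close> the total mass 2 of the two densities suffices.\<close>
  proof (cases "norm u \<le> 1")
    case True
    then have "(norm u)\<^sup>2 \<le> 1" by (simp add: power_le_one)
    then have 1: "exp ((norm u)\<^sup>2) \<le> 1 + (norm u)\<^sup>2 + ((norm u)\<^sup>2)\<^sup>2" by (intro exp_bound) auto
    have 2: "((norm u)\<^sup>2)\<^sup>2 \<le> (norm u)\<^sup>2"
      using mult_left_mono [OF \<open>(norm u)\<^sup>2 \<le> 1\<close>, of "(norm u)\<^sup>2"] by (simp add: power2_eq_square)
    have "exp ((norm u)\<^sup>2) - 1 \<le> (2 * norm u)\<^sup>2"
    proof -
      have "(2 * norm u)\<^sup>2 = 4 * (norm u)\<^sup>2" by (simp add: power_mult_distrib)
      then show ?thesis using 1 2 zero_le_power2 [of "norm u"] by linarith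
    qed
    then have "sqrt (exp ((norm u)\<^sup>2) - 1) \<le> 2 * norm u" by (intro real_le_lsqrt) auto
    with le show ?thesis by simp
  next
    case False
    have "(\<integral>x. \<bar>gauss_density (u + x) - gauss_density x\<bar> \<partial>lborel)
        \<le> (\<integral>x. gauss_density (u + x) + gauss_density x \<partial>lborel)"
      using int by (intro integral_mono Bochner_Integration.integrable_add iu integrable_gauss_density)
        (auto simp: abs_le_iff intro: less_imp_le gauss_density_pos add_pos_pos
          order.trans [OF _ less_imp_le [OF add_strict_right_mono [OF gauss_density_pos]]])
    also have "\<dots> = 2" by (simp add: iu eu integrable_gauss_density integral_gauss_density)
    finally show ?thesis using False by simp
  qed
qed

lemma integrable_bounded_prob:
  fixes f :: "'b \<Rightarrow> real"
  assumes "prob_space N" "f \<in> borel_measurable N" "\<And>x. \<bar>f x\<bar> \<le> B"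
  shows "integrable N f"
proof -
  interpret prob_space N by fact
  show ?thesis using assms by (intro integrable_const_bound [of f B]) auto
qed

text \<open>Holds for arbitrary functions: one that is not integrable has integral 0, and
  \<open>0 \<le> B\<close> follows from the bound at a single point. Averages and expectations can
  thus be bounded without a measurability proof.\<close>

lemma abs_integral_le_prob:
  fixes f :: "'b \<Rightarrow> real"
  assumes "prob_space N" "\<And>x. \<bar>f x\<bar> \<le> B"
  shows "\<bar>integral\<^sup>L N f\<bar> \<le> B"
proof -
  interpret prob_space N by fact
  have B: "0 \<le> B" using assms(2) [of undefined] by linarith
  show ?thesis
  proof (cases "integrable N f")
    case True
    have "\<bar>integral\<^sup>L N f\<bar> \<le> (\<integral>x. \<bar>f x\<bar> \<partial>N)" by (rule integral_abs_bound)
    also have "\<dots> \<le> (\<integral>x. B \<partial>N)" using True assms by (intro integral_mono) auto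
    finally show ?thesis by (simp add: prob_space)
  qed (use B in \<open>simp add: not_integrable_integral_eq\<close>)
qed

text \<open>Translation of Lebesgue measure moves the shift from \<open>g\<close> onto the density,
  where the total variation bound applies; \<open>g\<close> itself may be arbitrarily rough. Both
  Lipschitz estimates for Gaussian averages, isotropic and with matrix covariance, rest on
  this.\<close>

lemma std_gauss_shift:
  fixes g :: "'e::euclidean_space \<Rightarrow> real"
  assumes [measurable]: "g \<in> borel_measurable borel" and B: "\<And>x. \<bar>g x\<bar> \<le> B"
  shows "\<bar>(\<integral>z. g (z + u) \<partial>std_gauss) - (\<integral>z. g z \<partial>std_gauss)\<bar> \<le> 2 * B * norm u"
proof -
  have B0: "0 \<le> B" using B [of undefined] by linarith
  have ig: "integrable lborel (\<lambda>x. gauss_density (c + x) * g x)" for c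
    by (rule Bochner_Integration.integrable_bound [of lborel "\<lambda>x. B * gauss_density (c + x)"])
       (use B in \<open>auto intro!: AE_I2 integrable_lborel_translate integrable_gauss_density mult_right_mono
         simp: abs_mult mult.commute [of "gauss_density _"] abs_of_pos [OF gauss_density_pos] B0
           less_imp_le [OF gauss_density_pos]\<close>)
  have "(\<integral>z. g (z + u) \<partial>std_gauss) = (\<integral>x. gauss_density x * g (x + u) \<partial>lborel)"
    by (subst integral_std_gauss) auto
  also have "\<dots> = (\<integral>x. gauss_density (- u + x) * g x \<partial>lborel)"
    using integral_lborel_translate [of "\<lambda>x. gauss_density x * g (x + u)" "- u"] by simp
  finally have "(\<integral>z. g (z + u) \<partial>std_gauss) - (\<integral>z. g z \<partial>std_gauss)
      = (\<integral>x. (gauss_density (- u + x) - gauss_density x) * g x \<partial>lborel)"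
    using ig [of "- u"] ig [of 0] by (simp add: integral_std_gauss left_diff_distrib)
  also have "\<bar>\<dots>\<bar> \<le> (\<integral>x. B * \<bar>gauss_density (- u + x) - gauss_density x\<bar> \<partial>lborel)"
  proof (rule order.trans [OF integral_abs_bound integral_mono])
    show "integrable lborel (\<lambda>x. \<bar>(gauss_density (- u + x) - gauss_density x) * g x\<bar>)"
      using ig [of "- u"] ig [of 0] by (simp add: left_diff_distrib)
    show "integrable lborel (\<lambda>x. B * \<bar>gauss_density (- u + x) - gauss_density x\<bar>)"
      by (intro integrable_mult_right gauss_density_shift_L1)
    show "\<bar>(gauss_density (- u + x) - gauss_density x) * g x\<bar>
        \<le> B * \<bar>gauss_density (- u + x) - gauss_density x\<bar>" for x
      using B [of x] by (simp add: abs_mult mult.commute mult_right_mono)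
  qed
  also have "\<dots> \<le> B * (2 * norm u)"
    using mult_left_mono [OF gauss_density_shift_L1(2) [of "- u"] B0] by simp
  finally show ?thesis by (simp add: ac_simps)
qed

section \<open>One-dimensional marginals and moments\<close>

lemma nn_integral_std_gauss_coord:
  fixes b :: "'e::euclidean_space" and g :: "real \<Rightarrow> ennreal"
  assumes b: "b \<in> Basis" and [measurable]: "g \<in> borel_measurable borel"
  shows "(\<integral>\<^sup>+z. g (z \<bullet> b) \<partial>std_gauss) = (\<integral>\<^sup>+x. ennreal (normal_density 0 1 x) * g x \<partial>lborel)"
proof -
  \<comment> \<open>The factor \<open>g\<close> is attached to the coordinate \<open>b\<close>
    alone, so the integrand becomes a full product over the basis and the integrals over the other
    coordinates are 1.\<close>
  define h where "h = (\<lambda>c x. ennreal (normal_density 0 1 x) * (if c = b then g x else 1))"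
  have [measurable]: "h c \<in> borel_measurable borel" for c
    unfolding h_def by (cases "c = b") auto
  have "(\<integral>\<^sup>+z. g (z \<bullet> b) \<partial>std_gauss) = (\<integral>\<^sup>+z. ennreal (gauss_density z) * g (z \<bullet> b) \<partial>lborel)"
    unfolding std_gauss_def by (subst nn_integral_density) auto
  also have "\<dots> = (\<integral>\<^sup>+z. (\<Prod>c\<in>Basis. h c (z \<bullet> c)) \<partial>lborel)"
  proof (intro nn_integral_cong)
    fix z :: 'e
    have "ennreal (gauss_density z) = (\<Prod>c\<in>Basis. ennreal (normal_density 0 1 (z \<bullet> c)))"
      unfolding gauss_density_def by (simp add: prod_ennreal)
    then show "ennreal (gauss_density z) * g (z \<bullet> b) = (\<Prod>c\<in>Basis. h c (z \<bullet> c))"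
      using b by (simp add: h_def prod.distrib prod.delta)
  qed
  also have "\<dots> = (\<Prod>c\<in>Basis. \<integral>\<^sup>+x. h c x \<partial>lborel)"
    by (rule nn_integral_lborel_prod) auto
  also have "\<dots> = (\<integral>\<^sup>+x. ennreal (normal_density 0 1 x) * g x \<partial>lborel)"
  proof -
    have "(\<integral>\<^sup>+x. ennreal (normal_density 0 1 x) \<partial>lborel) = 1"
      by (subst nn_integral_eq_integral) auto
    then show ?thesis using b by (simp add: h_def prod.remove [of Basis b])
  qed
  finally show ?thesis .
qed

lemma distr_std_gauss_coord:
  assumes "(b::'e::euclidean_space) \<in> Basis"
  shows "distr std_gauss borel (\<lambda>z. z \<bullet> b) = density lborel (\<lambda>x. ennreal (normal_density 0 1 x))"
proof (rule measure_eqI)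
  fix A assume "A \<in> sets (distr std_gauss borel (\<lambda>z::'e. z \<bullet> b))"
  then have A [measurable]: "A \<in> sets borel" by simp
  have "emeasure (distr std_gauss borel (\<lambda>z. z \<bullet> b)) A = (\<integral>\<^sup>+x. indicator A x \<partial>(distr std_gauss borel (\<lambda>z. z \<bullet> b)))"
    by simp
  also have "\<dots> = (\<integral>\<^sup>+z. indicator A (z \<bullet> b) \<partial>std_gauss)"
    by (subst nn_integral_distr) auto
  also have "\<dots> = emeasure (density lborel (\<lambda>x. ennreal (normal_density 0 1 x))) A"
    by (subst nn_integral_std_gauss_coord [OF assms]) (auto simp: emeasure_density)
  finally show "emeasure (distr std_gauss borel (\<lambda>z. z \<bullet> b)) A
      = emeasure (density lborel (\<lambda>x. ennreal (normal_density 0 1 x))) A" .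
qed simp

lemma std_gauss_coord_moments:
  fixes b :: "'e::euclidean_space"
  assumes b: "b \<in> Basis"
  shows "integrable std_gauss (\<lambda>z. z \<bullet> b)" "(\<integral>z. z \<bullet> b \<partial>std_gauss) = 0"
    and "integrable std_gauss (\<lambda>z. (z \<bullet> b)\<^sup>2)" "(\<integral>z. (z \<bullet> b)\<^sup>2 \<partial>std_gauss) = 1"
proof -
  have *: "integrable std_gauss (\<lambda>z. f (z \<bullet> b)) \<longleftrightarrow> integrable lborel (\<lambda>x. std_normal_density x * f x)"
    "(\<integral>z. f (z \<bullet> b) \<partial>std_gauss) = (\<integral>x. std_normal_density x * f x \<partial>lborel)"
    if [measurable]: "f \<in> borel_measurable borel" for f :: "real \<Rightarrow> real"
  proof -
    have "integrable std_gauss (\<lambda>z. f (z \<bullet> b)) \<longleftrightarrow> integrable (distr std_gauss borel (\<lambda>z. z \<bullet> b)) f"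
      by (subst integrable_distr_eq) auto
    then show "integrable std_gauss (\<lambda>z. f (z \<bullet> b)) \<longleftrightarrow> integrable lborel (\<lambda>x. std_normal_density x * f x)"
      unfolding distr_std_gauss_coord [OF b] by (simp add: integrable_density)
    have "(\<integral>z. f (z \<bullet> b) \<partial>std_gauss) = integral\<^sup>L (distr std_gauss borel (\<lambda>z. z \<bullet> b)) f"
      by (subst integral_distr) auto
    then show "(\<integral>z. f (z \<bullet> b) \<partial>std_gauss) = (\<integral>x. std_normal_density x * f x \<partial>lborel)"
      unfolding distr_std_gauss_coord [OF b] by (simp add: integral_density)
  qed
  show "integrable std_gauss (\<lambda>z. z \<bullet> b)"
    using integrable_std_normal_moment [of 1] * [of "\<lambda>x. x"] by simp
  show "(\<integral>z. z \<bullet> b \<partial>std_gauss) = 0"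
    using integral_std_normal_moment_odd [of 0] * [of "\<lambda>x. x"] by simp
  show "integrable std_gauss (\<lambda>z. (z \<bullet> b)\<^sup>2)"
    using integrable_std_normal_moment [of 2] * [of "\<lambda>x. x\<^sup>2"] by simp
  show "(\<integral>z. (z \<bullet> b)\<^sup>2 \<partial>std_gauss) = 1"
    using integral_std_normal_moment_even [of 1] * [of "\<lambda>x. x\<^sup>2"] by simp
qed

lemma integrable_norm_std_gauss: "integrable (std_gauss :: 'e::euclidean_space measure) norm"
proof (rule Bochner_Integration.integrable_bound [of _ "\<lambda>z. \<Sum>b\<in>Basis. \<bar>z \<bullet> b\<bar>"])
  show "integrable std_gauss (\<lambda>z. \<Sum>b\<in>Basis. \<bar>(z::'e) \<bullet> b\<bar>)"
    by (intro Bochner_Integration.integrable_sum integrable_abs std_gauss_coord_moments)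
  show "AE z in std_gauss. norm (norm z) \<le> norm (\<Sum>b\<in>Basis. \<bar>(z::'e) \<bullet> b\<bar>)"
    using norm_le_l1 by (auto intro!: AE_I2)
qed simp

section \<open>Averaging operators\<close>

definition bmf :: "('e::euclidean_space \<Rightarrow> real) \<Rightarrow> bool" where
  "bmf f \<longleftrightarrow> f \<in> borel_measurable borel \<and> (\<exists>B. \<forall>x. \<bar>f x\<bar> \<le> B)"

definition prob_borel :: "'e::euclidean_space measure \<Rightarrow> bool" where
  "prob_borel \<kappa> \<longleftrightarrow> prob_space \<kappa> \<and> sets \<kappa> = sets borel"

text \<open>Convolution of \<open>f\<close> with the reflection of \<kappa>, written as an operator
  so that its iterates and those of \<open>davg\<close> can be rearranged as commuting
  operators.\<close>

definition avg :: "'e::euclidean_space measure \<Rightarrow> ('e \<Rightarrow> real) \<Rightarrow> 'e \<Rightarrow> real" where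
  "avg \<kappa> f x = (\<integral>z. f (x + z) \<partial>\<kappa>)"

definition davg :: "'e::euclidean_space measure \<Rightarrow> ('e \<Rightarrow> real) \<Rightarrow> 'e \<Rightarrow> real" where
  "davg \<kappa> f x = f x - avg \<kappa> f x"

lemma bmfI: "f \<in> borel_measurable borel \<Longrightarrow> (\<And>x. \<bar>f x\<bar> \<le> B) \<Longrightarrow> bmf f"
  unfolding bmf_def by blast

lemma bmfD [dest]: "bmf f \<Longrightarrow> f \<in> borel_measurable borel"
  unfolding bmf_def by blast

lemma bmf_diff: "bmf f \<Longrightarrow> bmf g \<Longrightarrow> bmf (\<lambda>x. f x - g x)"
  unfolding bmf_def
proof (elim conjE exE, intro conjI)
  fix B C assume "\<forall>x. \<bar>f x\<bar> \<le> B" "\<forall>x. \<bar>g x\<bar> \<le> C"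
  then have "\<forall>x. \<bar>f x - g x\<bar> \<le> B + C"
    by (metis abs_triangle_ineq4 add_mono order.trans)
  then show "\<exists>B. \<forall>x. \<bar>f x - g x\<bar> \<le> B" ..
qed auto

lemma integrable_translate_bmf:
  assumes "prob_borel \<kappa>" "bmf f" shows "integrable \<kappa> (\<lambda>z. f (x + z))"
proof -
  obtain B where "\<And>x. \<bar>f x\<bar> \<le> B" and [measurable]: "f \<in> borel_measurable borel"
    using assms unfolding bmf_def by auto
  moreover have [measurable_cong]: "sets \<kappa> = sets borel" using assms by (simp add: prob_borel_def)
  ultimately show ?thesis using assms unfolding prob_borel_def
    by (intro integrable_bounded_prob) auto
qed

lemma avg_measurable:
  assumes "prob_borel \<kappa>" and [measurable]: "f \<in> borel_measurable borel"
  shows "avg \<kappa> f \<in> borel_measurable borel"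
proof -
  have [measurable_cong]: "sets \<kappa> = sets borel" using assms by (simp add: prob_borel_def)
  interpret prob_space \<kappa> using assms by (simp add: prob_borel_def)
  show ?thesis unfolding avg_def [abs_def] by measurable
qed

lemma avg_bound: "prob_borel \<kappa> \<Longrightarrow> (\<And>x. \<bar>f x\<bar> \<le> B) \<Longrightarrow> \<bar>avg \<kappa> f x\<bar> \<le> B"
  unfolding avg_def prob_borel_def by (intro abs_integral_le_prob) auto

lemma bmf_avg: "prob_borel \<kappa> \<Longrightarrow> bmf f \<Longrightarrow> bmf (avg \<kappa> f)"
  unfolding bmf_def by (blast intro: avg_measurable avg_bound)

lemma bmf_davg: "prob_borel \<kappa> \<Longrightarrow> bmf f \<Longrightarrow> bmf (davg \<kappa> f)"
  unfolding davg_def [abs_def] by (intro bmf_diff bmf_avg)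

lemma bmf_funpow_davg: "prob_borel \<kappa> \<Longrightarrow> bmf f \<Longrightarrow> bmf ((davg \<kappa> ^^ k) f)"
  by (induction k) (auto intro: bmf_davg)

lemma bmf_funpow_avg: "prob_borel \<kappa> \<Longrightarrow> bmf f \<Longrightarrow> bmf ((avg \<kappa> ^^ k) f)"
  by (induction k) (auto intro: bmf_avg)

lemma avg_diff:
  assumes "prob_borel \<kappa>" "bmf f" "bmf g"
  shows "avg \<kappa> (\<lambda>x. f x - g x) x = avg \<kappa> f x - avg \<kappa> g x"
  unfolding avg_def using assms by (simp add: integrable_translate_bmf)

text \<open>Fubini, because the two displacements enter only through their sum. The rearrangements
  of averages and differences below all reduce to this.\<close>

lemma avg_commute:
  assumes k: "prob_borel \<kappa>" "prob_borel \<kappa>'" and f: "bmf f"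
  shows "avg \<kappa> (avg \<kappa>' f) = avg \<kappa>' (avg \<kappa> f)"
proof
  fix x
  have [measurable_cong]: "sets \<kappa> = sets borel" "sets \<kappa>' = sets borel"
    and [measurable]: "f \<in> borel_measurable borel"
    using k f by (auto simp: prob_borel_def)
  interpret a: prob_space \<kappa> using k by (simp add: prob_borel_def)
  interpret b: prob_space \<kappa>' using k by (simp add: prob_borel_def)
  interpret pair_prob_space \<kappa> \<kappa>' ..
  obtain B where B: "\<And>x. \<bar>f x\<bar> \<le> B" using f by (auto simp: bmf_def)
  have "integrable (\<kappa> \<Otimes>\<^sub>M \<kappa>') (\<lambda>(z, z'). f (x + z + z'))"
    by (rule integrable_const_bound [of _ B]) (use B in auto)
  then have "(\<integral>z'. \<integral>z. f (x + z + z') \<partial>\<kappa> \<partial>\<kappa>') = (\<integral>z. \<integral>z'. f (x + z + z') \<partial>\<kappa>' \<partial>\<kappa>)"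
    by (rule Fubini_integral)
  then show "avg \<kappa> (avg \<kappa>' f) x = avg \<kappa>' (avg \<kappa> f) x"
    unfolding avg_def by (simp add: ac_simps)
qed

lemma avg_davg_commute:
  assumes k: "prob_borel \<kappa>" "prob_borel \<kappa>'" and f: "bmf f"
  shows "avg \<kappa> (davg \<kappa>' f) = davg \<kappa>' (avg \<kappa> f)"
proof
  fix x
  have "avg \<kappa> (davg \<kappa>' f) x = avg \<kappa> f x - avg \<kappa> (avg \<kappa>' f) x"
    unfolding davg_def using k f by (intro avg_diff bmf_avg)
  then show "avg \<kappa> (davg \<kappa>' f) x = davg \<kappa>' (avg \<kappa> f) x"
    by (simp add: davg_def avg_commute [OF k f])
qed

lemma avg_funpow_davg_commute:
  assumes k: "prob_borel \<kappa>" "prob_borel \<kappa>'" and f: "bmf f"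
  shows "avg \<kappa> ((davg \<kappa>' ^^ j) f) = (davg \<kappa>' ^^ j) (avg \<kappa> f)"
  by (induction j) (simp_all add: avg_davg_commute bmf_funpow_davg k f)

lemma funpow_avg_davg_commute:
  assumes k: "prob_borel \<kappa>" "prob_borel \<kappa>'" and f: "bmf f"
  shows "(avg \<kappa> ^^ j) (davg \<kappa>' f) = davg \<kappa>' ((avg \<kappa> ^^ j) f)"
  by (induction j) (simp_all add: avg_davg_commute bmf_funpow_avg k f)

text \<open>By commutation the \<open>j\<close> averages and \<open>j\<close> differences are
  grouped into \<open>j\<close> pairs, and each pair costs a factor \<open>q\<close>. A difference
  is small only on a function smoothed beforehand, so one average has to be available for every
  difference.\<close>

lemma funpow_avg_davg_bound:
  assumes k: "prob_borel \<kappa>" "prob_borel \<kappa>'" and f: "bmf f"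
    and q: "\<And>g B x. bmf g \<Longrightarrow> (\<And>x. \<bar>g x\<bar> \<le> B) \<Longrightarrow> \<bar>avg \<kappa> (davg \<kappa>' g) x\<bar> \<le> q * B"
    and B: "\<And>x. \<bar>f x\<bar> \<le> B"
  shows "\<bar>(avg \<kappa> ^^ j) ((davg \<kappa>' ^^ j) f) x\<bar> \<le> q ^ j * B"
proof (induction j arbitrary: x)
  case (Suc j)
  have "(avg \<kappa> ^^ Suc j) ((davg \<kappa>' ^^ Suc j) f)
      = avg \<kappa> (davg \<kappa>' ((avg \<kappa> ^^ j) ((davg \<kappa>' ^^ j) f)))"
    by (simp add: funpow_avg_davg_commute k bmf_funpow_davg f)
  moreover have "\<bar>avg \<kappa> (davg \<kappa>' ((avg \<kappa> ^^ j) ((davg \<kappa>' ^^ j) f))) x\<bar> \<le> q * (q ^ j * B)"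
    by (intro q bmf_funpow_avg bmf_funpow_davg k f Suc)
  ultimately show ?case by (simp add: ac_simps)
qed (simp add: B)

lemma davg_bound: "prob_borel \<kappa> \<Longrightarrow> (\<And>x. \<bar>f x\<bar> \<le> B) \<Longrightarrow> \<bar>davg \<kappa> f x\<bar> \<le> 2 * B"
  using avg_bound [of \<kappa> f B x] by (smt (verit) davg_def)

lemma funpow_davg_bound:
  assumes k: "prob_borel \<kappa>" and B: "\<And>x. \<bar>f x\<bar> \<le> B"
  shows "\<bar>(davg \<kappa> ^^ j) f x\<bar> \<le> 2 ^ j * B"
proof (induction j arbitrary: x)
  case (Suc j)
  then show ?case using davg_bound [OF k Suc] by (simp add: ac_simps)
qed (simp add: B)

lemma funpow_davg_telescope:
  assumes k: "prob_borel \<kappa>" and f: "bmf f"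
  shows "f x - (davg \<kappa> ^^ j) f x = (\<Sum>i<j. avg \<kappa> ((davg \<kappa> ^^ i) f) x)"
  by (induction j) (auto simp: davg_def)

section \<open>Gaussian smoothing at a given scale\<close>

definition scaled_gauss :: "real \<Rightarrow> 'e::euclidean_space measure" where
  "scaled_gauss h = distr std_gauss borel (\<lambda>z. h *\<^sub>R z)"

lemma prob_borel_distr:
  "prob_space N \<Longrightarrow> g \<in> borel_measurable N \<Longrightarrow> prob_borel (distr N borel g)"
  unfolding prob_borel_def by (auto intro: prob_space.prob_space_distr)

lemma prob_borel_scaled_gauss: "prob_borel (scaled_gauss h)"
  unfolding scaled_gauss_def by (intro prob_borel_distr prob_space_std_gauss) auto

lemma avg_scaled_gauss:
  assumes [measurable]: "f \<in> borel_measurable borel"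
  shows "avg (scaled_gauss h) f x = (\<integral>z. f (x + h *\<^sub>R z) \<partial>std_gauss)"
  unfolding avg_def scaled_gauss_def by (subst integral_distr) auto

text \<open>Moving the base point by \<open>x - y\<close> is a shift of the normalized noise by
  \<open>(x - y) / h\<close>; this rescaling is the factor \<open>1 / h\<close> in the Lipschitz
  constant.\<close>

lemma avg_scaled_gauss_lipschitz:
  assumes f: "bmf f" and B: "\<And>x. \<bar>f x\<bar> \<le> B" and h: "0 < h"
  shows "\<bar>avg (scaled_gauss h) f x - avg (scaled_gauss h) f y\<bar> \<le> 2 * B / h * norm (x - y)"
proof -
  have [measurable]: "f \<in> borel_measurable borel" using f by auto
  have "y + h *\<^sub>R (z + (1 / h) *\<^sub>R (x - y)) = x + h *\<^sub>R z" for z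
    using h by (simp add: algebra_simps)
  then have "\<bar>avg (scaled_gauss h) f x - avg (scaled_gauss h) f y\<bar>
      \<le> 2 * B * norm ((1 / h) *\<^sub>R (x - y))"
    using std_gauss_shift [of "\<lambda>z. f (y + h *\<^sub>R z)" B "(1 / h) *\<^sub>R (x - y)"] B
    by (simp add: avg_scaled_gauss)
  then show ?thesis using h by simp
qed

text \<open>The value depends on the space alone, which is passed as a type argument.\<close>

definition gauss_mean_norm :: "'e::euclidean_space itself \<Rightarrow> real" where
  "gauss_mean_norm _ = integral\<^sup>L (std_gauss :: 'e measure) norm"

lemma gauss_mean_norm_nonneg: "0 \<le> gauss_mean_norm TYPE('e::euclidean_space)"
  unfolding gauss_mean_norm_def by (intro integral_nonneg_AE) auto

text \<open>The averaged argument lies at mean distance \<open>h * gauss_mean_norm\<close> from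
  \<open>x\<close>. Combined with a Lipschitz bound for an average, this prices one
  average-difference pair.\<close>

lemma davg_scaled_gauss_lipschitz_bound:
  fixes f :: "'e::euclidean_space \<Rightarrow> real"
  assumes f: "bmf f" and L: "\<And>x y. \<bar>f x - f y\<bar> \<le> L * norm (x - y)" and h: "0 < h"
  shows "\<bar>davg (scaled_gauss h) f x\<bar> \<le> L * h * gauss_mean_norm TYPE('e)"
proof -
  have [measurable]: "f \<in> borel_measurable borel" using f by auto
  interpret prob_space "std_gauss :: 'e measure" by (rule prob_space_std_gauss)
  have i: "integrable std_gauss (\<lambda>z. f (x + h *\<^sub>R z))"
    using f unfolding bmf_def by (auto intro!: integrable_bounded_prob prob_space_std_gauss)
  have "davg (scaled_gauss h) f x = (\<integral>z. f x - f (x + h *\<^sub>R z) \<partial>std_gauss)"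
    using i prob_space by (simp add: davg_def avg_scaled_gauss)
  also have "\<bar>\<dots>\<bar> \<le> (\<integral>z. L * h * norm z \<partial>(std_gauss :: 'e measure))"
  proof (rule order.trans [OF integral_abs_bound integral_mono])
    show "\<bar>f x - f (x + h *\<^sub>R z)\<bar> \<le> L * h * norm z" for z
      using L [of x "x + h *\<^sub>R z"] h by simp
  qed (use i in \<open>auto intro!: integrable_norm_std_gauss\<close>)
  finally show ?thesis by (simp add: gauss_mean_norm_def)
qed

text \<open>The Gaussian density at scale \<open>h\<close> is at most \<open>1 / h^d\<close>,
  because \<open>gauss_density\<close> is at most 1. This turns small Lebesgue mass into a small
  smoothed value.\<close>

lemma avg_scaled_gauss_density_bound:
  fixes f :: "'e::euclidean_space \<Rightarrow> real"
  assumes f: "bmf f" "\<And>x. 0 \<le> f x" and v: "(\<integral>\<^sup>+x. ennreal (f x) \<partial>lborel) \<le> ennreal v"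
    and h: "0 < h" and v0: "0 \<le> v"
  shows "\<bar>avg (scaled_gauss h) f x\<bar> \<le> v / h ^ DIM('e)"
proof -
  have [measurable]: "f \<in> borel_measurable borel" using f by auto
  have "ennreal (avg (scaled_gauss h) f x) = (\<integral>\<^sup>+z. ennreal (f (x + h *\<^sub>R z)) \<partial>std_gauss)"
    using f unfolding avg_scaled_gauss [OF bmfD [OF f(1)]] bmf_def
    by (intro nn_integral_eq_integral [symmetric])
       (auto intro!: integrable_bounded_prob prob_space_std_gauss)
  also have "\<dots> = (\<integral>\<^sup>+z. ennreal (gauss_density z) * ennreal (f (x + h *\<^sub>R z)) \<partial>lborel)"
    unfolding std_gauss_def by (subst nn_integral_density) auto
  also have "\<dots> \<le> (\<integral>\<^sup>+z. 1 * ennreal (f (x + h *\<^sub>R z)) \<partial>lborel)"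
    using gauss_density_le_1 by (intro nn_integral_mono mult_right_mono) auto
  finally have le: "ennreal (avg (scaled_gauss h) f x) \<le> (\<integral>\<^sup>+z. ennreal (f (x + h *\<^sub>R z)) \<partial>lborel)" by simp
  have "(\<integral>\<^sup>+z. ennreal (f z) \<partial>lborel)
      = (\<integral>\<^sup>+z. ennreal (f z) \<partial>density (distr lborel borel (\<lambda>z. x + h *\<^sub>R z)) (\<lambda>_. \<bar>h\<bar> ^ DIM('e)))"
    using lborel_affine [of h x] h by simp
  also have "\<dots> = (\<integral>\<^sup>+z. ennreal (h ^ DIM('e)) * ennreal (f (x + h *\<^sub>R z)) \<partial>lborel)"
    using h by (simp add: nn_integral_density nn_integral_distr)
  also have "\<dots> = ennreal (h ^ DIM('e)) * (\<integral>\<^sup>+z. ennreal (f (x + h *\<^sub>R z)) \<partial>lborel)"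
    by (rule nn_integral_cmult) auto
  finally have "ennreal (h ^ DIM('e)) * ennreal (avg (scaled_gauss h) f x) \<le> ennreal v"
    using v mult_left_mono [OF le, of "ennreal (h ^ DIM('e))"] by (metis order.trans zero_le)
  then have "h ^ DIM('e) * avg (scaled_gauss h) f x \<le> v"
    using h v0 by (simp add: ennreal_mult' [symmetric])
  moreover have "0 \<le> avg (scaled_gauss h) f x"
    unfolding avg_def using f by (intro integral_nonneg_AE) auto
  ultimately show ?thesis using h by (simp add: field_simps)
qed

text \<open>Telescoping writes \<open>smooth h k f\<close> as a Gaussian average at scale \<open>h\<close>, so it is as regular as a
  plain average, while its error is a \<open>k\<close>-fold difference instead of a single one. A single
  difference would only give the summability needed below for a larger exponent than \<open>2 + \<epsilon>\<close>.\<close>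

definition smooth :: "real \<Rightarrow> nat \<Rightarrow> ('e::euclidean_space \<Rightarrow> real) \<Rightarrow> 'e \<Rightarrow> real" where
  "smooth h k f x = f x - (davg (scaled_gauss h) ^^ k) f x"

lemma smooth_eq_sum_avg:
  "bmf f \<Longrightarrow> smooth h k f x = (\<Sum>i<k. avg (scaled_gauss h) ((davg (scaled_gauss h) ^^ i) f) x)"
  unfolding smooth_def by (intro funpow_davg_telescope prob_borel_scaled_gauss)

lemma sum_power_two: "(\<Sum>i<k. 2 ^ i * B) \<le> 2 ^ k * (B::real)" if "0 \<le> B"
  using that by (induction k) (auto simp: algebra_simps)

lemma bmf_smooth: "bmf f \<Longrightarrow> bmf (smooth h k f)"
  unfolding smooth_def [abs_def] by (intro bmf_diff bmf_funpow_davg prob_borel_scaled_gauss)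

lemma smooth_lipschitz:
  assumes f: "bmf f" and B: "\<And>x. \<bar>f x\<bar> \<le> B" and h: "0 < h"
  shows "\<bar>smooth h k f x - smooth h k f y\<bar> \<le> 2 ^ k * (2 * B / h * norm (x - y))"
proof -
  have B0: "0 \<le> B" using B [of undefined] by linarith
  have "\<bar>smooth h k f x - smooth h k f y\<bar> \<le> (\<Sum>i<k. \<bar>avg (scaled_gauss h) ((davg (scaled_gauss h) ^^ i) f) x
      - avg (scaled_gauss h) ((davg (scaled_gauss h) ^^ i) f) y\<bar>)"
    unfolding smooth_eq_sum_avg [OF f] sum_subtractf [symmetric] by (rule sum_abs)
  also have "\<dots> \<le> (\<Sum>i<k. 2 ^ i * (2 * B / h * norm (x - y)))"
  proof (intro sum_mono)
    fix i
    show "\<bar>avg (scaled_gauss h) ((davg (scaled_gauss h) ^^ i) f) x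
      - avg (scaled_gauss h) ((davg (scaled_gauss h) ^^ i) f) y\<bar> \<le> 2 ^ i * (2 * B / h * norm (x - y))"
    proof -
      have "\<bar>avg (scaled_gauss h) ((davg (scaled_gauss h) ^^ i) f) x
        - avg (scaled_gauss h) ((davg (scaled_gauss h) ^^ i) f) y\<bar> \<le> 2 * (2 ^ i * B) / h * norm (x - y)"
        by (rule avg_scaled_gauss_lipschitz [OF bmf_funpow_davg [OF prob_borel_scaled_gauss f] _ h])
          (rule funpow_davg_bound [OF prob_borel_scaled_gauss B])
      then show ?thesis by (simp add: ac_simps)
    qed
  qed
  also have "\<dots> \<le> 2 ^ k * (2 * B / h * norm (x - y))"
    using B0 h by (intro sum_power_two) auto
  finally show ?thesis .
qed

lemma smooth_density_bound:
  fixes f :: "'e::euclidean_space \<Rightarrow> real"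
  assumes f: "bmf f" "\<And>x. 0 \<le> f x" and v: "(\<integral>\<^sup>+x. ennreal (f x) \<partial>lborel) \<le> ennreal v"
    and h: "0 < h" and v0: "0 \<le> v"
  shows "\<bar>smooth h k f x\<bar> \<le> 2 ^ k * (v / h ^ DIM('e))"
proof -
  have "\<bar>smooth h k f x\<bar> \<le> (\<Sum>i<k. \<bar>avg (scaled_gauss h) ((davg (scaled_gauss h) ^^ i) f) x\<bar>)"
    unfolding smooth_eq_sum_avg [OF f(1)] by (rule sum_abs)
  also have "\<dots> \<le> (\<Sum>i<k. 2 ^ i * (v / h ^ DIM('e)))"
  proof (intro sum_mono)
    fix i
    show "\<bar>avg (scaled_gauss h) ((davg (scaled_gauss h) ^^ i) f) x\<bar> \<le> 2 ^ i * (v / h ^ DIM('e))"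
      \<comment> \<open>The average acts on \<open>f\<close> first: the density bound needs a
        nonnegative argument, and \<open>davg\<close> does not preserve the sign.\<close>
      unfolding avg_funpow_davg_commute [OF prob_borel_scaled_gauss prob_borel_scaled_gauss f(1)]
      by (intro funpow_davg_bound prob_borel_scaled_gauss avg_scaled_gauss_density_bound f v h v0)
  qed
  also have "\<dots> \<le> 2 ^ k * (v / h ^ DIM('e))"
    using v0 h by (intro sum_power_two) auto
  finally show ?thesis .
qed

text \<open>One of the \<open>k + 1\<close> differences uses the Lipschitz constant and gains
  \<open>h\<close>; each of the others costs at most a factor 2. Only the limit of vanishing
  \<open>h\<close> is taken from this later, so the dependence on \<open>L\<close> does no
  harm.\<close>

lemma smooth_approx:
  fixes f :: "'e::euclidean_space \<Rightarrow> real"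
  assumes f: "bmf f" and L: "\<And>x y. \<bar>f x - f y\<bar> \<le> L * norm (x - y)" and h: "0 < h"
  shows "\<bar>f x - smooth h (Suc k) f x\<bar> \<le> 2 ^ k * (L * h * gauss_mean_norm TYPE('e))"
  unfolding smooth_def diff_diff_eq2 diff_add_cancel funpow_Suc_right comp_def
  using funpow_davg_bound [OF prob_borel_scaled_gauss davg_scaled_gauss_lipschitz_bound [OF f L h]]
  by simp

section \<open>Brownian increments\<close>

lemma Basis_vec_real: "(Basis :: (real^'n) set) = range (\<lambda>j. axis j 1)"
  by (auto simp: Basis_vec_def)

lemma prod_Basis_vec: "(\<Prod>b\<in>(Basis::(real^'n) set). f (x \<bullet> b)) = (\<Prod>j\<in>UNIV. f (x $ j))"
proof -
  have "inj (\<lambda>j::'n. axis j (1::real))" by (auto simp: inj_on_def axis_eq_axis)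
  then show ?thesis unfolding Basis_vec_real
    by (subst prod.reindex) (auto simp: cart_eq_inner_axis)
qed

text \<open>The substitution \<open>x = h z\<close> identifies the image measure used for averaging
  with the product density that describes Brownian increments.\<close>

lemma scaled_gauss_density:
  fixes h :: real
  assumes h: "0 < h"
  shows "scaled_gauss h = density lborel (\<lambda>x::'e::euclidean_space. \<Prod>b\<in>Basis. ennreal (normal_density 0 h (x \<bullet> b)))"
    (is "_ = ?D")
proof (rule measure_eqI)
  fix S :: "'e set" assume "S \<in> sets (scaled_gauss h)"
  then have [measurable]: "S \<in> sets borel" by (simp add: scaled_gauss_def)
  have nd: "normal_density 0 h (h * t) = normal_density 0 1 t / h" for t
    using h by (simp add: normal_density_def real_sqrt_mult power_mult_distrib)
  have pr: "ennreal (h ^ DIM('e)) * (\<Prod>b\<in>Basis. ennreal (normal_density 0 h (h *\<^sub>R z \<bullet> b))) = ennreal (gauss_density z)" for z :: 'e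
  proof -
    have "(\<Prod>b\<in>Basis. ennreal (normal_density 0 h (h *\<^sub>R z \<bullet> b))) = ennreal (gauss_density z / h ^ DIM('e))"
      unfolding gauss_density_def using h by (simp add: prod_ennreal nd prod_dividef)
    then show ?thesis using h by (simp add: ennreal_mult' [symmetric] less_imp_le [OF gauss_density_pos])
  qed
  have "emeasure ?D S = (\<integral>\<^sup>+x. (\<Prod>b\<in>Basis. ennreal (normal_density 0 h (x \<bullet> b))) * indicator S x \<partial>lborel)"
    by (simp add: emeasure_density)
  also have "\<dots> = (\<integral>\<^sup>+x. (\<Prod>b\<in>Basis. ennreal (normal_density 0 h (x \<bullet> b))) * indicator S x
      \<partial>density (distr lborel borel (\<lambda>z. 0 + h *\<^sub>R z)) (\<lambda>_. \<bar>h\<bar> ^ DIM('e)))"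
    using lborel_affine [of h "0::'e"] h by simp
  also have "\<dots> = (\<integral>\<^sup>+z. ennreal (h ^ DIM('e)) * ((\<Prod>b\<in>Basis. ennreal (normal_density 0 h (h *\<^sub>R z \<bullet> b))) * indicator S (h *\<^sub>R z)) \<partial>lborel)"
    using h by (simp add: nn_integral_density nn_integral_distr)
  also have "\<dots> = (\<integral>\<^sup>+z. ennreal (gauss_density z) * indicator S (h *\<^sub>R z) \<partial>lborel)"
    unfolding mult.assoc [symmetric] pr ..
  also have "\<dots> = (\<integral>\<^sup>+z. indicator S (h *\<^sub>R z) \<partial>(std_gauss :: 'e measure))"
    unfolding std_gauss_def by (subst nn_integral_density) auto
  also have "\<dots> = (\<integral>\<^sup>+z. indicator S z \<partial>(scaled_gauss h :: 'e measure))"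
    unfolding scaled_gauss_def by (subst nn_integral_distr) auto
  also have "\<dots> = emeasure (scaled_gauss h) S"
    by (simp add: scaled_gauss_def)
  finally show "emeasure (scaled_gauss h) S = emeasure ?D S" ..
qed (simp add: scaled_gauss_def)

locale brownian = prob_space M for M :: "'a measure" +
  fixes F :: "real \<Rightarrow> 'a measure" and W :: "'a \<Rightarrow> real \<Rightarrow> real^'n"
  assumes filt: "filtration_nonneg M F" and bm: "brownian_motion M F W"
begin

lemma subalgebra_F: "0 \<le> t \<Longrightarrow> subalgebra M (F t)"
  using filt by (simp add: filtration_nonneg_def)

lemma space_F: "0 \<le> t \<Longrightarrow> space (F t) = space M"
  using subalgebra_F by (simp add: subalgebra_def)

lemma sets_F_mono: "0 \<le> s \<Longrightarrow> s \<le> t \<Longrightarrow> sets (F s) \<subseteq> sets (F t)"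
  using filt unfolding filtration_nonneg_def filtration_def by (metis max.absorb2 order.trans)

lemma measurable_F_mono: "0 \<le> s \<Longrightarrow> s \<le> t \<Longrightarrow> f \<in> measurable (F s) N \<Longrightarrow> f \<in> measurable (F t) N"
  by (rule measurable_from_subalg [of "F t" "F s"])
     (auto simp: subalgebra_def space_F sets_F_mono subsetD [OF sets_F_mono])

lemma measurable_F_M: "0 \<le> s \<Longrightarrow> f \<in> measurable (F s) N \<Longrightarrow> f \<in> measurable M N"
  by (rule measurable_from_subalg [OF subalgebra_F])

lemma W_measurable: "0 \<le> s \<Longrightarrow> s \<le> t \<Longrightarrow> (\<lambda>\<omega>. W \<omega> s) \<in> borel_measurable (F t)"
  using bm measurable_F_mono [of s t] by (auto simp: brownian_motion_def adapted_def)

lemma W_measurable_M [measurable]: "0 \<le> s \<Longrightarrow> (\<lambda>\<omega>. W \<omega> s) \<in> borel_measurable M"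
  using measurable_F_M W_measurable by blast

lemma increment_measurable [measurable]:
  "0 \<le> s \<Longrightarrow> 0 \<le> t \<Longrightarrow> (\<lambda>\<omega>. W \<omega> t - W \<omega> s) \<in> borel_measurable M"
  by auto

lemma increment_indep_set:
  assumes "0 \<le> s" "s < t"
  shows "indep_set (sets (F s)) {(\<lambda>\<omega>. W \<omega> t - W \<omega> s) -` A \<inter> space M | A. A \<in> sets borel}"
  using bm assms unfolding brownian_motion_def by blast

text \<open>The increment events form a \<pi>-system, so independence passes to the generated
  \<sigma>-algebras and from there to functions of the increment.\<close>

lemma increment_indep_var:
  fixes \<xi> :: "'a \<Rightarrow> real" and g :: "real^'n \<Rightarrow> real"
  assumes st: "0 \<le> s" "s < t" and \<xi>: "\<xi> \<in> borel_measurable (F s)"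
    and g [measurable]: "g \<in> borel_measurable borel"
  shows "indep_var borel \<xi> borel (\<lambda>\<omega>. g (W \<omega> t - W \<omega> s))"
proof -
  define G where "G = {(\<lambda>\<omega>. W \<omega> t - W \<omega> s) -` A \<inter> space M | A. A \<in> sets borel}"
  have "Int_stable G"
  proof (rule Int_stableI)
    fix a b assume "a \<in> G" "b \<in> G"
    then obtain A B where "A \<in> sets borel" "B \<in> sets borel"
      "a = (\<lambda>\<omega>. W \<omega> t - W \<omega> s) -` A \<inter> space M" "b = (\<lambda>\<omega>. W \<omega> t - W \<omega> s) -` B \<inter> space M"
      unfolding G_def by blast
    then have "a \<inter> b = (\<lambda>\<omega>. W \<omega> t - W \<omega> s) -` (A \<inter> B) \<inter> space M" "A \<inter> B \<in> sets borel" by auto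
    then show "a \<inter> b \<in> G" unfolding G_def by blast
  qed
  then have ind: "indep_set (sigma_sets (space M) (sets (F s))) (sigma_sets (space M) G)"
    using increment_indep_set [OF st] unfolding G_def
    by (intro indep_set_sigma_sets sets.Int_stable)
  have "sigma_sets (space M) {\<xi> -` A \<inter> space M | A. A \<in> sets borel} \<subseteq> sigma_sets (space M) (sets (F s))"
    using measurable_sets [OF \<xi>] st by (intro sigma_sets_mono') (auto simp: space_F)
  moreover have "sigma_sets (space M) {(\<lambda>\<omega>. g (W \<omega> t - W \<omega> s)) -` A \<inter> space M | A. A \<in> sets borel} \<subseteq> sigma_sets (space M) G"
  proof (intro sigma_sets_mono' subsetI)
    fix S assume "S \<in> {(\<lambda>\<omega>. g (W \<omega> t - W \<omega> s)) -` A \<inter> space M | A. A \<in> sets borel}"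
    then obtain A where "A \<in> sets borel" "S = (\<lambda>\<omega>. W \<omega> t - W \<omega> s) -` (g -` A) \<inter> space M" by auto
    moreover have "g -` A \<in> sets borel" if "A \<in> sets borel" for A
      using measurable_sets [OF g that] by simp
    ultimately show "S \<in> G" unfolding G_def by blast
  qed
  ultimately have "indep_set (sigma_sets (space M) {\<xi> -` A \<inter> space M | A. A \<in> sets borel})
      (sigma_sets (space M) {(\<lambda>\<omega>. g (W \<omega> t - W \<omega> s)) -` A \<inter> space M | A. A \<in> sets borel})"
    using ind unfolding indep_sets2_eq by blast
  moreover have "(\<lambda>\<omega>. g (W \<omega> t - W \<omega> s)) \<in> borel_measurable M"
    using st by (intro measurable_compose [OF increment_measurable g]) auto
  ultimately show ?thesis unfolding indep_var_eq using measurable_F_M [OF st(1) \<xi>] by simp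
qed

text \<open>\<open>V\<close> takes values in an arbitrary measurable space, since later it is the
  pair of coefficient matrix and frozen position. Rectangles determine the product law, and on
  rectangles the claim is independence.\<close>

lemma increment_joint_distr:
  assumes st: "0 \<le> s" "s < t" and V: "V \<in> measurable (F s) N"
  shows "distr M (N \<Otimes>\<^sub>M borel) (\<lambda>\<omega>. (V \<omega>, W \<omega> t - W \<omega> s))
    = distr M N V \<Otimes>\<^sub>M distr M borel (\<lambda>\<omega>. W \<omega> t - W \<omega> s)"
proof -
  have [measurable]: "V \<in> measurable M N" "(\<lambda>\<omega>. W \<omega> t - W \<omega> s) \<in> borel_measurable M"
    using st V measurable_F_M by auto
  interpret V: prob_space "distr M N V" by (rule prob_space_distr) simp
  interpret G: prob_space "distr M borel (\<lambda>\<omega>. W \<omega> t - W \<omega> s)" by (rule prob_space_distr) simp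
  show ?thesis
  proof (rule pair_measure_eqI [symmetric])
    show "sigma_finite_measure (distr M N V)" "sigma_finite_measure (distr M borel (\<lambda>\<omega>. W \<omega> t - W \<omega> s))" ..
    fix A B assume "A \<in> sets (distr M N V)" "B \<in> sets (distr M borel (\<lambda>\<omega>. W \<omega> t - W \<omega> s))"
    then have AB [measurable]: "A \<in> sets N" "B \<in> sets borel" by auto
    have "V -` A \<inter> space M \<in> sets (F s)"
      using measurable_sets [OF V AB(1)] st by (simp add: space_F)
    then have "prob ((V -` A \<inter> space M) \<inter> ((\<lambda>\<omega>. W \<omega> t - W \<omega> s) -` B \<inter> space M))
        = prob (V -` A \<inter> space M) * prob ((\<lambda>\<omega>. W \<omega> t - W \<omega> s) -` B \<inter> space M)"
      using AB by (intro indep_setD [OF increment_indep_set [OF st]]) auto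
    moreover have "(V -` A \<inter> space M) \<inter> ((\<lambda>\<omega>. W \<omega> t - W \<omega> s) -` B \<inter> space M)
        = (\<lambda>\<omega>. (V \<omega>, W \<omega> t - W \<omega> s)) -` (A \<times> B) \<inter> space M" by auto
    ultimately show "emeasure (distr M N V) A * emeasure (distr M borel (\<lambda>\<omega>. W \<omega> t - W \<omega> s)) B
        = emeasure (distr M (N \<Otimes>\<^sub>M borel) (\<lambda>\<omega>. (V \<omega>, W \<omega> t - W \<omega> s))) (A \<times> B)"
      by (simp add: emeasure_distr emeasure_eq_measure ennreal_mult')
  qed simp
qed

lemma increment_distr:
  assumes st: "0 \<le> s" "s < t"
  shows "distr M borel (\<lambda>\<omega>. W \<omega> t - W \<omega> s) = scaled_gauss (sqrt (t - s))"
proof -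
  have "distributed M lborel (\<lambda>\<omega>. W \<omega> t - W \<omega> s)
          (\<lambda>x. \<Prod>j\<in>UNIV. ennreal (normal_density 0 (sqrt (t - s)) (x $ j)))"
    using bm st unfolding brownian_motion_def by blast
  then have "distr M lborel (\<lambda>\<omega>. W \<omega> t - W \<omega> s) = scaled_gauss (sqrt (t - s))"
    using st unfolding distributed_def
    by (simp add: scaled_gauss_density prod_Basis_vec [of "\<lambda>y. ennreal (normal_density 0 (sqrt (t - s)) y)"])
  moreover have "distr M lborel (\<lambda>\<omega>. W \<omega> t - W \<omega> s) = distr M borel (\<lambda>\<omega>. W \<omega> t - W \<omega> s)"
    by (rule distr_cong) auto
  ultimately show ?thesis by simp
qed

text \<open>This does the work of conditioning on \<open>F s\<close>: \<open>V\<close> is known at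
  time \<open>s\<close>, so by the product law the fresh increment can be integrated out with
  \<open>V\<close> held fixed.\<close>

lemma expectation_freeze:
  assumes st: "0 \<le> s" "s < t" and V: "V \<in> measurable (F s) N"
    and f [measurable]: "f \<in> borel_measurable (N \<Otimes>\<^sub>M borel)" and B: "\<And>v. \<bar>f v\<bar> \<le> (B::real)"
  shows "expectation (\<lambda>\<omega>. f (V \<omega>, W \<omega> t - W \<omega> s))
    = expectation (\<lambda>\<omega>. \<integral>z. f (V \<omega>, sqrt (t - s) *\<^sub>R z) \<partial>std_gauss)"
proof -
  have [measurable]: "V \<in> measurable M N" "(\<lambda>\<omega>. W \<omega> t - W \<omega> s) \<in> borel_measurable M"
    using st V measurable_F_M by auto
  have ps: "prob_space (distr M N V)" "prob_space (scaled_gauss (sqrt (t - s)) :: (real^'n) measure)"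
    using prob_borel_scaled_gauss by (auto simp: prob_borel_def intro: prob_space_distr)
  interpret V: prob_space "distr M N V" by (rule ps)
  interpret G: prob_space "scaled_gauss (sqrt (t - s)) :: (real^'n) measure" by (rule ps)
  interpret P: pair_prob_space "distr M N V" "scaled_gauss (sqrt (t - s)) :: (real^'n) measure" ..
  have [measurable_cong]: "sets (scaled_gauss (sqrt (t - s)) :: (real^'n) measure) = sets borel"
    by (simp add: scaled_gauss_def)
  have "expectation (\<lambda>\<omega>. f (V \<omega>, W \<omega> t - W \<omega> s))
      = integral\<^sup>L (distr M (N \<Otimes>\<^sub>M borel) (\<lambda>\<omega>. (V \<omega>, W \<omega> t - W \<omega> s))) f"
    by (subst integral_distr) auto
  also have "distr M (N \<Otimes>\<^sub>M borel) (\<lambda>\<omega>. (V \<omega>, W \<omega> t - W \<omega> s))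
      = distr M N V \<Otimes>\<^sub>M scaled_gauss (sqrt (t - s))"
    unfolding increment_joint_distr [OF st V] increment_distr [OF st] ..
  also have "integral\<^sup>L (distr M N V \<Otimes>\<^sub>M scaled_gauss (sqrt (t - s))) f
      = (\<integral>v. \<integral>w. f (v, w) \<partial>scaled_gauss (sqrt (t - s)) \<partial>distr M N V)"
    by (rule P.integral_fst' [symmetric]) (auto intro!: P.integrable_const_bound [of _ B] simp: B)
  also have "\<dots> = expectation (\<lambda>\<omega>. \<integral>w. f (V \<omega>, w) \<partial>scaled_gauss (sqrt (t - s)))"
    by (subst integral_distr) auto
  also have "\<dots> = expectation (\<lambda>\<omega>. \<integral>z. f (V \<omega>, sqrt (t - s) *\<^sub>R z) \<partial>std_gauss)"
  proof (rule Bochner_Integration.integral_cong [OF refl])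
    fix \<omega> assume "\<omega> \<in> space M"
    then have [measurable]: "V \<omega> \<in> space N" using measurable_space [of V M N] by simp
    show "(\<integral>w. f (V \<omega>, w) \<partial>scaled_gauss (sqrt (t - s))) = (\<integral>z. f (V \<omega>, sqrt (t - s) *\<^sub>R z) \<partial>std_gauss)"
      unfolding scaled_gauss_def by (subst integral_distr) auto
  qed
  finally show ?thesis .
qed

text \<open>The weight is integrable rather than bounded, because in the cross terms of the isometry
  it contains an earlier Brownian increment.\<close>

lemma increment_moments:
  assumes st: "0 \<le> s" "s \<le> t" and \<xi>: "\<xi> \<in> borel_measurable (F s)" "integrable M (\<xi> :: _ \<Rightarrow> real)"
  shows "integrable M (\<lambda>\<omega>. \<xi> \<omega> * (W \<omega> t $ j - W \<omega> s $ j))" (is ?i1)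
    "expectation (\<lambda>\<omega>. \<xi> \<omega> * (W \<omega> t $ j - W \<omega> s $ j)) = 0" (is ?e1)
    "integrable M (\<lambda>\<omega>. \<xi> \<omega> * (W \<omega> t $ j - W \<omega> s $ j)\<^sup>2)" (is ?i2)
    "expectation (\<lambda>\<omega>. \<xi> \<omega> * (W \<omega> t $ j - W \<omega> s $ j)\<^sup>2) = expectation \<xi> * (t - s)" (is ?e2)
proof -
  have b: "axis j 1 \<in> (Basis :: (real^'n) set)" by (simp add: Basis_vec_real)
  have main: "integrable M (\<lambda>\<omega>. \<xi> \<omega> * g (W \<omega> t $ j - W \<omega> s $ j)) \<and>
     expectation (\<lambda>\<omega>. \<xi> \<omega> * g (W \<omega> t $ j - W \<omega> s $ j))
       = expectation \<xi> * (\<integral>z. g (sqrt (t - s) * (z \<bullet> axis j 1)) \<partial>(std_gauss :: (real^'n) measure))"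
    if s: "s < t" and [measurable]: "g \<in> borel_measurable borel"
      and i: "integrable (std_gauss :: (real^'n) measure) (\<lambda>z. g (sqrt (t - s) * (z \<bullet> axis j 1)))"
    for g :: "real \<Rightarrow> real"
  proof -
    have [measurable]: "(\<lambda>\<omega>. W \<omega> t - W \<omega> s) \<in> borel_measurable M" using st by auto
    have iv: "indep_var borel \<xi> borel (\<lambda>\<omega>. g (W \<omega> t $ j - W \<omega> s $ j))"
      using increment_indep_var [OF st(1) s \<xi>(1), of "\<lambda>w. g (w $ j)"] by simp
    have "integrable (distr M borel (\<lambda>\<omega>. W \<omega> t - W \<omega> s)) (\<lambda>w. g (w $ j))"
      unfolding increment_distr [OF st(1) s] scaled_gauss_def using i
      by (subst integrable_distr_eq) (auto simp: inner_axis)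
    then have i2: "integrable M (\<lambda>\<omega>. g (W \<omega> t $ j - W \<omega> s $ j))"
      by (subst (asm) integrable_distr_eq) auto
    have "integral\<^sup>L (distr M borel (\<lambda>\<omega>. W \<omega> t - W \<omega> s)) (\<lambda>w. g (w $ j))
       = (\<integral>z. g (sqrt (t - s) * (z \<bullet> axis j 1)) \<partial>(std_gauss :: (real^'n) measure))"
      unfolding increment_distr [OF st(1) s] scaled_gauss_def
      by (subst integral_distr) (auto simp: inner_axis)
    then have "expectation (\<lambda>\<omega>. g (W \<omega> t $ j - W \<omega> s $ j))
       = (\<integral>z. g (sqrt (t - s) * (z \<bullet> axis j 1)) \<partial>(std_gauss :: (real^'n) measure))"
      by (subst (asm) integral_distr) auto
    then show ?thesis
      using indep_var_integrable [OF iv \<xi>(2) i2] indep_var_lebesgue_integral [OF iv \<xi>(2) i2] by simp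
  qed
  have i1: "integrable (std_gauss :: (real^'n) measure) (\<lambda>z. sqrt (t - s) * (z \<bullet> axis j 1))"
    and i2: "integrable (std_gauss :: (real^'n) measure) (\<lambda>z. (sqrt (t - s) * (z \<bullet> axis j 1))\<^sup>2)"
    and e1: "(\<integral>z. sqrt (t - s) * (z \<bullet> axis j 1) \<partial>(std_gauss :: (real^'n) measure)) = 0"
    and e2: "(\<integral>z. (sqrt (t - s) * (z \<bullet> axis j 1))\<^sup>2 \<partial>(std_gauss :: (real^'n) measure)) = t - s"
    using std_gauss_coord_moments [OF b] st by (simp_all only: power_mult_distrib integrable_mult_right
        integral_mult_right_zero real_sqrt_pow2 diff_ge_0_iff_ge) auto
  have "?i1 \<and> ?e1 \<and> ?i2 \<and> ?e2"
  \<comment> \<open>The law of the increment is available for \<open>s < t\<close>; for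
    \<open>s = t\<close> the increment is identically 0.\<close>
  proof (cases "s = t")
    case False
    then have "s < t" using st by simp
    moreover have "(\<lambda>x::real. x) \<in> borel_measurable borel" "(\<lambda>x::real. x\<^sup>2) \<in> borel_measurable borel"
      by auto
    ultimately have "?i1 \<and> expectation (\<lambda>\<omega>. \<xi> \<omega> * (W \<omega> t $ j - W \<omega> s $ j)) = expectation \<xi> * 0" "?i2 \<and> ?e2"
      using main [OF _ _ i1] main [OF _ _ i2] unfolding e1 e2 by blast+
    then show ?thesis by simp
  qed simp
  then show ?i1 ?e1 ?i2 ?e2 by blast+
qed

section \<open>The isometry for elementary stochastic integrals\<close>

definition dW :: "'n \<Rightarrow> real \<Rightarrow> real \<Rightarrow> 'a \<Rightarrow> real" where
  "dW j s t \<omega> = W \<omega> t $ j - W \<omega> s $ j"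

lemma dW_measurable: "0 \<le> s \<Longrightarrow> s \<le> t \<Longrightarrow> t \<le> u \<Longrightarrow> dW j s t \<in> borel_measurable (F u)"
  unfolding dW_def [abs_def]
  by (intro borel_measurable_diff measurable_compose [OF W_measurable borel_measurable_nth]) auto

lemma dW_measurable_M [measurable]: "0 \<le> s \<Longrightarrow> 0 \<le> t \<Longrightarrow> dW j s t \<in> borel_measurable M"
  unfolding dW_def [abs_def]
  by (intro borel_measurable_diff measurable_compose [OF W_measurable_M borel_measurable_nth])

lemma dW_square_integrable:
  assumes "0 \<le> s" "s \<le> t" shows "integrable M (\<lambda>\<omega>. (dW j s t \<omega>)\<^sup>2)"
proof -
  have "integrable M (\<lambda>\<omega>. 1 * (W \<omega> t $ j - W \<omega> s $ j)\<^sup>2)"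
    using assms by (intro increment_moments(3)) auto
  then show ?thesis unfolding dW_def by simp
qed

lemma integrable_dW_dW:
  assumes ab: "0 \<le> a" "a \<le> b" "0 \<le> c" "c \<le> d"
    and \<zeta> [measurable]: "\<zeta> \<in> borel_measurable M" and K: "\<And>\<omega>. \<omega> \<in> space M \<Longrightarrow> \<bar>\<zeta> \<omega>\<bar> \<le> K"
  shows "integrable M (\<lambda>\<omega>. \<zeta> \<omega> * (dW j a b \<omega> * dW j c d \<omega>))"
proof (rule Bochner_Integration.integrable_bound)
  show "integrable M (\<lambda>\<omega>. K * ((dW j a b \<omega>)\<^sup>2 + (dW j c d \<omega>)\<^sup>2))"
    using ab by (intro integrable_mult_right Bochner_Integration.integrable_add dW_square_integrable)
  show "(\<lambda>\<omega>. \<zeta> \<omega> * (dW j a b \<omega> * dW j c d \<omega>)) \<in> borel_measurable M"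
    using ab by (intro borel_measurable_times \<zeta> dW_measurable_M) auto
  show "AE \<omega> in M. norm (\<zeta> \<omega> * (dW j a b \<omega> * dW j c d \<omega>))
      \<le> norm (K * ((dW j a b \<omega>)\<^sup>2 + (dW j c d \<omega>)\<^sup>2))"
  proof (intro AE_I2)
    fix \<omega> assume w: "\<omega> \<in> space M"
    have xy: "\<bar>x * y\<bar> \<le> x\<^sup>2 + y\<^sup>2" for x y :: real
    proof -
      have "2 * \<bar>x * y\<bar> \<le> x\<^sup>2 + y\<^sup>2"
        using sum_squares_bound [of "\<bar>x\<bar>" "\<bar>y\<bar>"] by (simp add: abs_mult)
      then show ?thesis using abs_ge_zero [of "x * y"] by linarith
    qed
    show "norm (\<zeta> \<omega> * (dW j a b \<omega> * dW j c d \<omega>))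
      \<le> norm (K * ((dW j a b \<omega>)\<^sup>2 + (dW j c d \<omega>)\<^sup>2))"
    proof -
      have "\<bar>\<zeta> \<omega>\<bar> * \<bar>dW j a b \<omega> * dW j c d \<omega>\<bar> \<le> K * ((dW j a b \<omega>)\<^sup>2 + (dW j c d \<omega>)\<^sup>2)"
        using order.trans [OF abs_ge_zero K [OF w]] by (intro mult_mono K [OF w] xy) auto
      also have "\<dots> \<le> \<bar>K * ((dW j a b \<omega>)\<^sup>2 + (dW j c d \<omega>)\<^sup>2)\<bar>" by (rule abs_ge_self)
      finally show ?thesis by (simp only: real_norm_def abs_mult)
    qed
  qed
qed

text \<open>The earlier increment joins the weight, which remains known at time \<open>c\<close>,
  and the later increment is centred.\<close>

lemma expectation_dW_disjoint:
  assumes ab: "0 \<le> a" "a \<le> b" "b \<le> c" "c \<le> d"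
    and \<zeta>: "\<zeta> \<in> borel_measurable (F c)" and K: "\<And>\<omega>. \<omega> \<in> space M \<Longrightarrow> \<bar>\<zeta> \<omega>\<bar> \<le> K"
  shows "expectation (\<lambda>\<omega>. \<zeta> \<omega> * (dW j a b \<omega> * dW j c d \<omega>)) = 0"
proof -
  have \<zeta>M: "\<zeta> \<in> borel_measurable M" by (rule measurable_F_M [OF _ \<zeta>]) (use ab in auto)
  have "expectation (\<lambda>\<omega>. (\<zeta> \<omega> * dW j a b \<omega>) * (W \<omega> d $ j - W \<omega> c $ j)) = 0"
  proof (rule increment_moments(2))
    show "(\<lambda>\<omega>. \<zeta> \<omega> * dW j a b \<omega>) \<in> borel_measurable (F c)"
      using ab by (intro borel_measurable_times \<zeta> dW_measurable) auto
    have "integrable M (dW j a b)"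
      by (rule expectation_abs_le_sqrt(1) [OF dW_measurable_M dW_square_integrable]) (use ab in auto)
    then have "integrable M (\<lambda>\<omega>. K * dW j a b \<omega>)" by simp
    then show "integrable M (\<lambda>\<omega>. \<zeta> \<omega> * dW j a b \<omega>)"
    proof (rule Bochner_Integration.integrable_bound)
      show "(\<lambda>\<omega>. \<zeta> \<omega> * dW j a b \<omega>) \<in> borel_measurable M"
        using ab by (intro borel_measurable_times \<zeta>M dW_measurable_M) auto
      show "AE \<omega> in M. norm (\<zeta> \<omega> * dW j a b \<omega>) \<le> norm (K * dW j a b \<omega>)"
      proof (intro AE_I2)
        fix \<omega> assume "\<omega> \<in> space M"
        then have "\<bar>\<zeta> \<omega>\<bar> \<le> \<bar>K\<bar>" using K [of \<omega>] by linarith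
        then show "norm (\<zeta> \<omega> * dW j a b \<omega>) \<le> norm (K * dW j a b \<omega>)"
          by (simp add: abs_mult mult_right_mono)
      qed
    qed
  qed (use ab in auto)
  then show ?thesis by (simp add: dW_def mult.assoc)
qed

lemma expectation_dW_same:
  assumes ab: "0 \<le> c" "c \<le> d"
    and \<zeta>: "\<zeta> \<in> borel_measurable (F c)" and K: "\<And>\<omega>. \<omega> \<in> space M \<Longrightarrow> \<bar>\<zeta> \<omega>\<bar> \<le> K"
  shows "expectation (\<lambda>\<omega>. \<zeta> \<omega> * (dW j c d \<omega> * dW j c d \<omega>)) = expectation \<zeta> * (d - c)"
proof -
  have "\<zeta> \<in> borel_measurable M" by (rule measurable_F_M [OF _ \<zeta>]) (use ab in auto)
  then have "integrable M \<zeta>" by (intro integrable_const_bound [of _ K]) (auto simp: K)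
  then show ?thesis using increment_moments(4) [OF ab \<zeta>] by (simp add: dW_def power2_eq_square)
qed

text \<open>Cutting at \<open>c\<close> and at \<open>m = min b d\<close> leaves
  \<open>{c<..m}\<close> as the only piece common to both intervals. Every other product contains an
  increment that is centred given the rest, and so has mean 0.\<close>

lemma expectation_dW_dW_ordered:
  assumes ab: "0 \<le> a" "a \<le> b" "a \<le> c" "c \<le> d"
    and \<zeta>: "\<zeta> \<in> borel_measurable (F c)" and K: "\<And>\<omega>. \<omega> \<in> space M \<Longrightarrow> \<bar>\<zeta> \<omega>\<bar> \<le> K"
  shows "expectation (\<lambda>\<omega>. \<zeta> \<omega> * (dW j a b \<omega> * dW j c d \<omega>))
    = expectation \<zeta> * measure lborel ({a<..b} \<inter> {c<..d})"
proof (cases "b \<le> c")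
  case True
  then have e: "{a<..b} \<inter> {c<..d} = {}" by auto
  show ?thesis unfolding e using expectation_dW_disjoint [OF ab(1,2) True ab(4) \<zeta> K, of j] by simp
next
  case False
  have c0: "0 \<le> c" using ab by simp
  have \<zeta>M: "\<zeta> \<in> borel_measurable M" by (rule measurable_F_M [OF _ \<zeta>]) (use ab in auto)
  have I: "integrable M (\<lambda>\<omega>. \<zeta> \<omega> * (dW j p q \<omega> * dW j r s \<omega>))"
    if "0 \<le> p" "p \<le> q" "0 \<le> r" "r \<le> s" for p q r s
    using that K by (intro integrable_dW_dW \<zeta>M) auto
  have Z: "\<zeta> \<in> borel_measurable (F u)" if "c \<le> u" for u
    by (rule measurable_F_mono [OF c0 that \<zeta>])
  define m where "m = min b d"
  have m: "c \<le> m" "m \<le> b" "m \<le> d" using False ab by (auto simp: m_def)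
  have "{a<..b} \<inter> {c<..d} = {c<..m}" using ab by (auto simp: m_def)
  then have meas: "measure lborel ({a<..b} \<inter> {c<..d}) = m - c" using m by simp
  have split: "\<zeta> \<omega> * (dW j a b \<omega> * dW j c d \<omega>) = \<zeta> \<omega> * (dW j a c \<omega> * dW j c d \<omega>)
      + \<zeta> \<omega> * (dW j c m \<omega> * dW j c m \<omega>) + \<zeta> \<omega> * (dW j c m \<omega> * dW j m d \<omega>)
      + \<zeta> \<omega> * (dW j c d \<omega> * dW j m b \<omega>)" for \<omega>
    by (simp add: dW_def algebra_simps)
  have "expectation (\<lambda>\<omega>. \<zeta> \<omega> * (dW j c d \<omega> * dW j m b \<omega>)) = 0"
  \<comment> \<open>Either \<open>m = b\<close> and the piece after \<open>m\<close> is empty, or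
    \<open>m = d\<close> and it comes after all of \<open>{c<..d}\<close>.\<close>
  proof (cases "b \<le> d")
    case True
    then have "m = b" by (simp add: m_def)
    then show ?thesis by (simp add: dW_def)
  next
    case False
    then have "m = d" by (simp add: m_def)
    then show ?thesis using m c0 ab K by (auto intro!: expectation_dW_disjoint Z)
  qed
  moreover have "expectation (\<lambda>\<omega>. \<zeta> \<omega> * (dW j a c \<omega> * dW j c d \<omega>)) = 0"
    using ab K by (auto intro!: expectation_dW_disjoint Z)
  moreover have "expectation (\<lambda>\<omega>. \<zeta> \<omega> * (dW j c m \<omega> * dW j m d \<omega>)) = 0"
    using m c0 K by (auto intro!: expectation_dW_disjoint Z)
  moreover have "expectation (\<lambda>\<omega>. \<zeta> \<omega> * (dW j c m \<omega> * dW j c m \<omega>)) = expectation \<zeta> * (m - c)"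
    using m c0 K by (auto intro!: expectation_dW_same Z)
  ultimately show ?thesis unfolding split meas
    using I ab m c0 by (simp add: Bochner_Integration.integral_add Bochner_Integration.integrable_add)
qed

lemma expectation_dW_dW:
  fixes \<xi> \<eta> :: "'a \<Rightarrow> 'e::euclidean_space"
  assumes ab: "0 \<le> a" "a \<le> b" "0 \<le> c" "c \<le> d"
    and \<xi>: "\<xi> \<in> borel_measurable (F a)" "bounded (\<xi> ` space M)"
    and \<eta>: "\<eta> \<in> borel_measurable (F c)" "bounded (\<eta> ` space M)"
  shows "integrable M (\<lambda>\<omega>. (\<xi> \<omega> \<bullet> \<eta> \<omega>) * (dW j a b \<omega> * dW j c d \<omega>))"
    "integrable M (\<lambda>\<omega>. \<xi> \<omega> \<bullet> \<eta> \<omega>)"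
    "expectation (\<lambda>\<omega>. (\<xi> \<omega> \<bullet> \<eta> \<omega>) * (dW j a b \<omega> * dW j c d \<omega>))
    = expectation (\<lambda>\<omega>. \<xi> \<omega> \<bullet> \<eta> \<omega>) * measure lborel ({a<..b} \<inter> {c<..d})"
proof -
  obtain K L where "\<And>\<omega>. \<omega> \<in> space M \<Longrightarrow> norm (\<xi> \<omega>) \<le> K" "\<And>\<omega>. \<omega> \<in> space M \<Longrightarrow> norm (\<eta> \<omega>) \<le> L"
    using \<xi>(2) \<eta>(2) by (fastforce simp: bounded_iff)
  then have KL: "\<bar>\<xi> \<omega> \<bullet> \<eta> \<omega>\<bar> \<le> K * L" if "\<omega> \<in> space M" for \<omega>
    using that Cauchy_Schwarz_ineq2 [of "\<xi> \<omega>" "\<eta> \<omega>"]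
    by (meson mult_mono norm_ge_zero order.trans)
  have m: "(\<lambda>\<omega>. \<xi> \<omega> \<bullet> \<eta> \<omega>) \<in> borel_measurable (F u)" if "a \<le> u" "c \<le> u" for u
    using that ab \<xi> \<eta> by (intro borel_measurable_inner measurable_F_mono [of a u] measurable_F_mono [of c u]) auto
  have mM: "(\<lambda>\<omega>. \<xi> \<omega> \<bullet> \<eta> \<omega>) \<in> borel_measurable M"
    by (rule measurable_F_M [of "max a c", OF _ m]) (use ab in auto)
  show "integrable M (\<lambda>\<omega>. (\<xi> \<omega> \<bullet> \<eta> \<omega>) * (dW j a b \<omega> * dW j c d \<omega>))"
    by (rule integrable_dW_dW [OF ab mM KL])
  show "integrable M (\<lambda>\<omega>. \<xi> \<omega> \<bullet> \<eta> \<omega>)"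
    using KL mM by (intro integrable_const_bound [of _ "K * L"]) auto
  show "expectation (\<lambda>\<omega>. (\<xi> \<omega> \<bullet> \<eta> \<omega>) * (dW j a b \<omega> * dW j c d \<omega>))
    = expectation (\<lambda>\<omega>. \<xi> \<omega> \<bullet> \<eta> \<omega>) * measure lborel ({a<..b} \<inter> {c<..d})"
  proof (cases "a \<le> c")
    case True
    then show ?thesis using ab KL m by (intro expectation_dW_dW_ordered) auto
  next
    case False
    then show ?thesis using ab KL m expectation_dW_dW_ordered [of c d a b "\<lambda>\<omega>. \<xi> \<omega> \<bullet> \<eta> \<omega>" "K * L" j]
      by (simp add: mult.commute [of "dW j c d _"] Int_commute)
  qed
qed

text \<open>Expanding the square into pairs reduces both sides to the lengths of pairwise
  intersections. The intervals may overlap arbitrarily, so sums and differences of integrands on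
  different partitions need no common refinement.\<close>

lemma elementary_isometry:
  fixes \<xi> :: "'i \<Rightarrow> 'a \<Rightarrow> 'e::euclidean_space"
  assumes I: "finite I"
    and ab: "\<And>i. i \<in> I \<Longrightarrow> 0 \<le> a i \<and> a i \<le> b i"
    and \<xi>: "\<And>i. i \<in> I \<Longrightarrow> \<xi> i \<in> borel_measurable (F (a i)) \<and> bounded (\<xi> i ` space M)"
  shows "(\<integral>\<^sup>+\<omega>. ennreal ((norm (\<Sum>i\<in>I. dW j (a i) (b i) \<omega> *\<^sub>R \<xi> i \<omega>))\<^sup>2) \<partial>M)
    = (\<integral>\<^sup>+\<omega>. (\<integral>\<^sup>+s. ennreal ((norm (\<Sum>i\<in>I. indicator {a i<..b i} s *\<^sub>R \<xi> i \<omega>))\<^sup>2) \<partial>lborel) \<partial>M)"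
proof -
  let ?Y = "\<lambda>\<omega>. \<Sum>i\<in>I. dW j (a i) (b i) \<omega> *\<^sub>R \<xi> i \<omega>"
  let ?h = "\<lambda>v s. \<Sum>i\<in>I. indicator {a i<..b i} s *\<^sub>R (v i :: 'e)"
  have sq: "(norm (\<Sum>i\<in>I. x i *\<^sub>R v i))\<^sup>2 = (\<Sum>i\<in>I. \<Sum>k\<in>I. (v i \<bullet> v k) * (x i * x k))" for x and v :: "'i \<Rightarrow> 'e"
    unfolding power2_norm_eq_inner inner_sum_left inner_sum_right by (intro sum.cong refl) (simp add: inner_commute)
  define m where "m i k = measure lborel ({a i<..b i} \<inter> {a k<..b k})" for i k
  let ?E = "\<Sum>i\<in>I. \<Sum>k\<in>I. expectation (\<lambda>\<omega>. \<xi> i \<omega> \<bullet> \<xi> k \<omega>) * m i k"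
  have 1: "(\<integral>\<^sup>+\<omega>. ennreal ((norm (?Y \<omega>))\<^sup>2) \<partial>M)
      = ennreal ?E"
  proof (subst nn_integral_eq_integral)
    show "integrable M (\<lambda>\<omega>. (norm (?Y \<omega>))\<^sup>2)"
      unfolding sq using ab \<xi> by (intro Bochner_Integration.integrable_sum expectation_dW_dW) auto
    have i: "integrable M (\<lambda>\<omega>. (\<xi> i \<omega> \<bullet> \<xi> k \<omega>) * (dW j (a i) (b i) \<omega> * dW j (a k) (b k) \<omega>))"
      if "i \<in> I" "k \<in> I" for i k
      using ab [OF that(1)] ab [OF that(2)] \<xi> [OF that(1)] \<xi> [OF that(2)]
      by (intro expectation_dW_dW) auto
    have "expectation (\<lambda>\<omega>. (norm (?Y \<omega>))\<^sup>2)
        = (\<Sum>i\<in>I. expectation (\<lambda>\<omega>. \<Sum>k\<in>I. (\<xi> i \<omega> \<bullet> \<xi> k \<omega>) * (dW j (a i) (b i) \<omega> * dW j (a k) (b k) \<omega>)))"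
      unfolding sq by (intro Bochner_Integration.integral_sum Bochner_Integration.integrable_sum i)
    also have "\<dots> = (\<Sum>i\<in>I. \<Sum>k\<in>I. expectation (\<lambda>\<omega>. (\<xi> i \<omega> \<bullet> \<xi> k \<omega>) * (dW j (a i) (b i) \<omega> * dW j (a k) (b k) \<omega>)))"
      by (intro sum.cong refl Bochner_Integration.integral_sum i)
    also have "\<dots> = ?E"
      unfolding m_def using ab \<xi> by (intro sum.cong refl expectation_dW_dW) auto
    finally have "expectation (\<lambda>\<omega>. (norm (?Y \<omega>))\<^sup>2)
        = ?E" .
    then show "ennreal (expectation (\<lambda>\<omega>. (norm (?Y \<omega>))\<^sup>2))
        = ennreal ?E" by simp
  qed auto
  have lb: "integrable lborel (\<lambda>s. (norm (?h v s))\<^sup>2)"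
      "(\<integral>s. (norm (?h v s))\<^sup>2 \<partial>lborel)
        = (\<Sum>i\<in>I. \<Sum>k\<in>I. (v i \<bullet> v k) * m i k)" for v :: "'i \<Rightarrow> 'e"
  proof -
    have "emeasure lborel ({a i<..b i} \<inter> {a k<..b k}) < \<infinity>" if "i \<in> I" for i k
      by (rule order.strict_trans1 [OF emeasure_mono [of _ "{a i<..b i}"]]) (use ab that in auto)
    then have i: "integrable lborel (\<lambda>s. indicator ({a i<..b i} \<inter> {a k<..b k}) s :: real)" if "i \<in> I" for i k
      using that by (intro integrable_real_indicator) auto
    have eq: "(norm (?h v s))\<^sup>2
        = (\<Sum>i\<in>I. \<Sum>k\<in>I. (v i \<bullet> v k) * indicator ({a i<..b i} \<inter> {a k<..b k}) s)" for s
      unfolding sq indicator_inter_arith ..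
    have i': "integrable lborel (\<lambda>s. (v i \<bullet> v k) * indicator ({a i<..b i} \<inter> {a k<..b k}) s)" if "i \<in> I" for i k
      using i [OF that] by simp
    show "integrable lborel (\<lambda>s. (norm (?h v s))\<^sup>2)"
      unfolding eq by (intro Bochner_Integration.integrable_sum i')
    have "(\<integral>s. (norm (?h v s))\<^sup>2 \<partial>lborel)
        = (\<Sum>i\<in>I. \<integral>s. (\<Sum>k\<in>I. (v i \<bullet> v k) * indicator ({a i<..b i} \<inter> {a k<..b k}) s) \<partial>lborel)"
      unfolding eq by (intro Bochner_Integration.integral_sum Bochner_Integration.integrable_sum i')
    also have "\<dots> = (\<Sum>i\<in>I. \<Sum>k\<in>I. \<integral>s. (v i \<bullet> v k) * indicator ({a i<..b i} \<inter> {a k<..b k}) s \<partial>lborel)"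
      by (intro sum.cong refl Bochner_Integration.integral_sum i')
    finally show "(\<integral>s. (norm (?h v s))\<^sup>2 \<partial>lborel)
        = (\<Sum>i\<in>I. \<Sum>k\<in>I. (v i \<bullet> v k) * m i k)"
      by (simp add: m_def)
  qed
  have 2: "(\<integral>\<^sup>+s. ennreal ((norm (?h v s))\<^sup>2) \<partial>lborel)
      = ennreal (\<Sum>i\<in>I. \<Sum>k\<in>I. (v i \<bullet> v k) * m i k)" for v :: "'i \<Rightarrow> 'e"
    using lb [of v] by (subst nn_integral_eq_integral) auto
  have nn: "0 \<le> (\<Sum>i\<in>I. \<Sum>k\<in>I. (v i \<bullet> v k) * m i k)" for v :: "'i \<Rightarrow> 'e"
    unfolding lb(2) [symmetric] by (intro integral_nonneg_AE) auto
  have i2: "integrable M (\<lambda>\<omega>. (\<xi> i \<omega> \<bullet> \<xi> k \<omega>) * m i k)" if "i \<in> I" "k \<in> I" for i k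
    using ab [OF that(1)] ab [OF that(2)] \<xi> [OF that(1)] \<xi> [OF that(2)]
    by (intro integrable_mult_left expectation_dW_dW(2) [of "a i" "b i" "a k" "b k"]) auto
  have "(\<integral>\<^sup>+\<omega>. (\<integral>\<^sup>+s. ennreal ((norm (\<Sum>i\<in>I. indicator {a i<..b i} s *\<^sub>R \<xi> i \<omega>))\<^sup>2) \<partial>lborel) \<partial>M)
      = (\<integral>\<^sup>+\<omega>. ennreal (\<Sum>i\<in>I. \<Sum>k\<in>I. (\<xi> i \<omega> \<bullet> \<xi> k \<omega>) * m i k) \<partial>M)"
    unfolding 2 ..
  also have "\<dots> = ennreal (expectation (\<lambda>\<omega>. \<Sum>i\<in>I. \<Sum>k\<in>I. (\<xi> i \<omega> \<bullet> \<xi> k \<omega>) * m i k))"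
    using nn by (intro nn_integral_eq_integral Bochner_Integration.integrable_sum i2) auto
  also have "expectation (\<lambda>\<omega>. \<Sum>i\<in>I. \<Sum>k\<in>I. (\<xi> i \<omega> \<bullet> \<xi> k \<omega>) * m i k)
      = (\<Sum>i\<in>I. expectation (\<lambda>\<omega>. \<Sum>k\<in>I. (\<xi> i \<omega> \<bullet> \<xi> k \<omega>) * m i k))"
    by (intro Bochner_Integration.integral_sum Bochner_Integration.integrable_sum i2)
  also have "\<dots> = (\<Sum>i\<in>I. \<Sum>k\<in>I. expectation (\<lambda>\<omega>. (\<xi> i \<omega> \<bullet> \<xi> k \<omega>) * m i k))"
    by (intro sum.cong refl Bochner_Integration.integral_sum i2)
  finally show ?thesis using 1 by simp
qed

end

section \<open>Increments of It\^o integrals\<close>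

text \<open>Squared L2 norm with values in \<open>ennreal\<close>, so that comparisons and limits
  make sense before any integrability is known.\<close>

definition sqint :: "'b measure \<Rightarrow> ('b \<Rightarrow> 'e::euclidean_space) \<Rightarrow> ennreal" where
  "sqint N f = (\<integral>\<^sup>+x. ennreal ((norm (f x))\<^sup>2) \<partial>N)"

lemma norm_add_square_le: "(norm (x + y))\<^sup>2 \<le> 2 * (norm x)\<^sup>2 + 2 * (norm (y::'e::real_normed_vector))\<^sup>2"
proof -
  have "(norm (x + y))\<^sup>2 \<le> (norm x + norm y)\<^sup>2" by (intro power_mono norm_triangle_ineq) simp
  also have "\<dots> \<le> 2 * (norm x)\<^sup>2 + 2 * (norm y)\<^sup>2"
    using sum_squares_bound [of "norm x" "norm y"] by (simp add: power2_sum)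
  finally show ?thesis .
qed

text \<open>Replaces the triangle inequality: it stays linear in the squared norms at the price of a
  factor 2. The numerical constants in the increment bound come from iterating it.\<close>

lemma sqint_add:
  assumes [measurable]: "f \<in> borel_measurable N" "g \<in> borel_measurable N"
  shows "sqint N (\<lambda>x. f x + g x) \<le> 2 * sqint N f + 2 * sqint N g"
proof -
  have "sqint N (\<lambda>x. f x + g x) \<le> (\<integral>\<^sup>+x. 2 * ennreal ((norm (f x))\<^sup>2) + 2 * ennreal ((norm (g x))\<^sup>2) \<partial>N)"
    unfolding sqint_def
  proof (rule nn_integral_mono)
    fix x
    have "2 * ennreal ((norm (f x))\<^sup>2) + 2 * ennreal ((norm (g x))\<^sup>2)
        = ennreal (2 * (norm (f x))\<^sup>2 + 2 * (norm (g x))\<^sup>2)"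
      by (simp add: ennreal_plus ennreal_mult')
    then show "ennreal ((norm (f x + g x))\<^sup>2) \<le> 2 * ennreal ((norm (f x))\<^sup>2) + 2 * ennreal ((norm (g x))\<^sup>2)"
      using ennreal_leI [OF norm_add_square_le [of "f x" "g x"]] by metis
  qed
  also have "\<dots> = 2 * sqint N f + 2 * sqint N g"
    unfolding sqint_def by (subst nn_integral_add) (auto simp: nn_integral_cmult)
  finally show ?thesis .
qed

lemma sqint_minus_commute: "sqint N (\<lambda>x. f x - g x) = sqint N (\<lambda>x. g x - f x)"
  by (simp add: sqint_def norm_minus_commute)

lemma sqint_mono: "(\<And>x. x \<in> space N \<Longrightarrow> norm (f x) \<le> norm (g x)) \<Longrightarrow> sqint N f \<le> sqint N g"
  unfolding sqint_def by (intro nn_integral_mono ennreal_leI power_mono) auto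

lemma sqint_diff:
  assumes "f \<in> borel_measurable N" "g \<in> borel_measurable N" "h \<in> borel_measurable N"
  shows "sqint N (\<lambda>x. f x - h x) \<le> 2 * sqint N (\<lambda>x. f x - g x) + 2 * sqint N (\<lambda>x. g x - h x)"
  using sqint_add [of "\<lambda>x. f x - g x" N "\<lambda>x. g x - h x"] assms by simp

context brownian
begin

text \<open>Couples a stochastic integral with its integrand. The terms form a list and may overlap,
  so that addition is concatenation.\<close>

definition elementary :: "'n \<Rightarrow> ('a \<Rightarrow> 'e::euclidean_space) \<Rightarrow> ('a \<Rightarrow> real \<Rightarrow> 'e) \<Rightarrow> bool" where
  "elementary j Y h \<longleftrightarrow> (\<exists>L.
     (\<forall>(a, b, \<xi>)\<in>set L. 0 \<le> a \<and> a \<le> b \<and> \<xi> \<in> borel_measurable (F a) \<and> bounded (\<xi> ` space M)) \<and>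
     Y = (\<lambda>\<omega>. \<Sum>(a, b, \<xi>)\<leftarrow>L. dW j a b \<omega> *\<^sub>R \<xi> \<omega>) \<and>
     h = (\<lambda>\<omega> s. \<Sum>(a, b, \<xi>)\<leftarrow>L. indicator {a<..b} s *\<^sub>R \<xi> \<omega>))"

lemma elementary_zero: "elementary j (\<lambda>_. 0) (\<lambda>_ _. 0)"
  unfolding elementary_def by (rule exI [of _ "[]"]) auto

lemma elementary_single:
  assumes "0 \<le> a" "a \<le> b" "\<xi> \<in> borel_measurable (F a)" "bounded (\<xi> ` space M)"
  shows "elementary j (\<lambda>\<omega>. dW j a b \<omega> *\<^sub>R \<xi> \<omega>) (\<lambda>\<omega> s. indicator {a<..b} s *\<^sub>R \<xi> \<omega>)"
  unfolding elementary_def by (rule exI [of _ "[(a, b, \<xi>)]"]) (use assms in auto)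

lemma elementary_add:
  assumes "elementary j Y h" "elementary j Y' h'"
  shows "elementary j (\<lambda>\<omega>. Y \<omega> + Y' \<omega>) (\<lambda>\<omega> s. h \<omega> s + h' \<omega> s)"
proof -
  obtain L where L: "\<forall>(a, b, \<xi>)\<in>set L. 0 \<le> a \<and> a \<le> b \<and> \<xi> \<in> borel_measurable (F a) \<and> bounded (\<xi> ` space M)"
    "Y = (\<lambda>\<omega>. \<Sum>(a, b, \<xi>)\<leftarrow>L. dW j a b \<omega> *\<^sub>R \<xi> \<omega>)"
    "h = (\<lambda>\<omega> s. \<Sum>(a, b, \<xi>)\<leftarrow>L. indicator {a<..b} s *\<^sub>R \<xi> \<omega>)"
    using assms(1) unfolding elementary_def by blast
  obtain L' where L': "\<forall>(a, b, \<xi>)\<in>set L'. 0 \<le> a \<and> a \<le> b \<and> \<xi> \<in> borel_measurable (F a) \<and> bounded (\<xi> ` space M)"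
    "Y' = (\<lambda>\<omega>. \<Sum>(a, b, \<xi>)\<leftarrow>L'. dW j a b \<omega> *\<^sub>R \<xi> \<omega>)"
    "h' = (\<lambda>\<omega> s. \<Sum>(a, b, \<xi>)\<leftarrow>L'. indicator {a<..b} s *\<^sub>R \<xi> \<omega>)"
    using assms(2) unfolding elementary_def by blast
  show ?thesis
    unfolding elementary_def by (rule exI [of _ "L @ L'"]) (use L L' in auto)
qed

lemma elementary_uminus:
  fixes Y :: "'a \<Rightarrow> 'e::euclidean_space"
  assumes "elementary j Y h"
  shows "elementary j (\<lambda>\<omega>. - Y \<omega>) (\<lambda>\<omega> s. - h \<omega> s)"
proof -
  obtain L where L: "\<forall>(a, b, \<xi>)\<in>set L. 0 \<le> a \<and> a \<le> b \<and> \<xi> \<in> borel_measurable (F a) \<and> bounded (\<xi> ` space M)"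
    "Y = (\<lambda>\<omega>. \<Sum>(a, b, \<xi>)\<leftarrow>L. dW j a b \<omega> *\<^sub>R \<xi> \<omega>)"
    "h = (\<lambda>\<omega> s. \<Sum>(a, b, \<xi>)\<leftarrow>L. indicator {a<..b} s *\<^sub>R \<xi> \<omega>)"
    using assms(1) unfolding elementary_def by blast
  have *: "- (\<Sum>x\<leftarrow>L. f x) = (\<Sum>x\<leftarrow>L. - f x)" for f :: "_ \<Rightarrow> 'e"
    by (induction L) auto
  have **: "bounded ((\<lambda>\<omega>. - \<xi> \<omega>) ` space M)" if "bounded (\<xi> ` space M)" for \<xi> :: "'a \<Rightarrow> 'e"
    using that by (simp add: bounded_iff)
  show ?thesis
    unfolding elementary_def
    by (rule exI [of _ "map (\<lambda>(a, b, \<xi>). (a, b, \<lambda>\<omega>. - \<xi> \<omega>)) L"])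
       (use L(1) ** in \<open>auto simp: L(2,3) * comp_def split_def\<close>)
qed

lemma elementary_diff:
  assumes "elementary j Y h" "elementary j Y' h'"
  shows "elementary j (\<lambda>\<omega>. Y \<omega> - Y' \<omega>) (\<lambda>\<omega> s. h \<omega> s - h' \<omega> s)"
  using elementary_add [OF assms(1) elementary_uminus [OF assms(2)]] by simp

lemma elementary_sum:
  assumes "\<And>i. i < n \<Longrightarrow> elementary j (Y i) (h i)"
  shows "elementary j (\<lambda>\<omega>. \<Sum>i<n. Y i \<omega>) (\<lambda>\<omega> s. \<Sum>i<(n::nat). h i \<omega> s)"
  using assms by (induction n) (auto intro: elementary_zero elementary_add)

lemma elementary_measurable:
  assumes "elementary j Y h"
  shows "Y \<in> borel_measurable M" "(\<lambda>(\<omega>, s). h \<omega> s) \<in> borel_measurable (M \<Otimes>\<^sub>M lborel)"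
proof -
  obtain L where L: "\<forall>(a, b, \<xi>)\<in>set L. 0 \<le> a \<and> a \<le> b \<and> \<xi> \<in> borel_measurable (F a) \<and> bounded (\<xi> ` space M)"
    "Y = (\<lambda>\<omega>. \<Sum>(a, b, \<xi>)\<leftarrow>L. dW j a b \<omega> *\<^sub>R \<xi> \<omega>)"
    "h = (\<lambda>\<omega> s. \<Sum>(a, b, \<xi>)\<leftarrow>L. indicator {a<..b} s *\<^sub>R \<xi> \<omega>)"
    using assms(1) unfolding elementary_def by blast
  have "(\<lambda>\<omega>. \<Sum>(a, b, \<xi>)\<leftarrow>L. dW j a b \<omega> *\<^sub>R \<xi> \<omega>) \<in> borel_measurable M \<and>
    (\<lambda>p. \<Sum>(a, b, \<xi>)\<leftarrow>L. indicator {a<..b} (snd p) *\<^sub>R \<xi> (fst p)) \<in> borel_measurable (M \<Otimes>\<^sub>M lborel)"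
    using L(1)
  proof (induction L)
    case (Cons x L)
    obtain a b \<xi> where x: "x = (a, b, \<xi>)" by (cases x)
    have ab: "0 \<le> a" "a \<le> b" "\<xi> \<in> borel_measurable (F a)" using Cons.prems x by auto
    have [measurable]: "\<xi> \<in> borel_measurable M" by (rule measurable_F_M [OF ab(1,3)])
    have [measurable]: "dW j a b \<in> borel_measurable M" by (rule dW_measurable_M) (use ab in auto)
    have IH: "(\<lambda>\<omega>. \<Sum>(a, b, \<xi>)\<leftarrow>L. dW j a b \<omega> *\<^sub>R \<xi> \<omega>) \<in> borel_measurable M"
      "(\<lambda>p. \<Sum>(a, b, \<xi>)\<leftarrow>L. indicator {a<..b} (snd p) *\<^sub>R \<xi> (fst p)) \<in> borel_measurable (M \<Otimes>\<^sub>M lborel)"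
      using Cons.IH Cons.prems by auto
    show ?case unfolding x list.map sum_list.Cons prod.case
      by (intro conjI borel_measurable_add IH) measurable
  qed auto
  then show "Y \<in> borel_measurable M" "(\<lambda>(\<omega>, s). h \<omega> s) \<in> borel_measurable (M \<Otimes>\<^sub>M lborel)"
    unfolding L(2,3) by (auto simp: split_def)
qed

lemma sqint_elementary:
  assumes "elementary j Y h"
  shows "sqint M Y = sqint (M \<Otimes>\<^sub>M lborel) (\<lambda>(\<omega>, s). h \<omega> s)"
proof -
  obtain L where L: "\<forall>(a, b, \<xi>)\<in>set L. 0 \<le> a \<and> a \<le> b \<and> \<xi> \<in> borel_measurable (F a) \<and> bounded (\<xi> ` space M)"
    "Y = (\<lambda>\<omega>. \<Sum>(a, b, \<xi>)\<leftarrow>L. dW j a b \<omega> *\<^sub>R \<xi> \<omega>)"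
    "h = (\<lambda>\<omega> s. \<Sum>(a, b, \<xi>)\<leftarrow>L. indicator {a<..b} s *\<^sub>R \<xi> \<omega>)"
    using assms(1) unfolding elementary_def by blast
  define a b \<xi> where "a i = fst (L ! i)" and "b i = fst (snd (L ! i))" and "\<xi> i = snd (snd (L ! i))" for i
  have P: "0 \<le> a i \<and> a i \<le> b i" "\<xi> i \<in> borel_measurable (F (a i)) \<and> bounded (\<xi> i ` space M)"
    if "i \<in> {0..<length L}" for i
    using that L(1) nth_mem [of i L] unfolding a_def b_def \<xi>_def by (auto simp: split_def)
  have Y: "Y \<omega> = (\<Sum>i\<in>{0..<length L}. dW j (a i) (b i) \<omega> *\<^sub>R \<xi> i \<omega>)" for \<omega>
    unfolding L(2) a_def b_def \<xi>_def by (simp add: sum_list_sum_nth split_def)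
  have h: "h \<omega> s = (\<Sum>i\<in>{0..<length L}. indicator {a i<..b i} s *\<^sub>R \<xi> i \<omega>)" for \<omega> s
    unfolding L(3) a_def b_def \<xi>_def by (simp add: sum_list_sum_nth split_def)
  have "sqint M Y = (\<integral>\<^sup>+\<omega>. (\<integral>\<^sup>+s. ennreal ((norm (h \<omega> s))\<^sup>2) \<partial>lborel) \<partial>M)"
    unfolding sqint_def Y h by (rule elementary_isometry) (use P in auto)
  also have "\<dots> = sqint (M \<Otimes>\<^sub>M lborel) (\<lambda>(\<omega>, s). h \<omega> s)"
  proof -
    have [measurable]: "(\<lambda>(\<omega>, s). h \<omega> s) \<in> borel_measurable (M \<Otimes>\<^sub>M lborel)"
      by (rule elementary_measurable [OF assms])
    show ?thesis unfolding sqint_def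
      by (subst lborel.nn_integral_fst [symmetric]) (auto simp: split_def)
  qed
  finally show ?thesis .
qed

lemma simple_integrand_nonneg:
  assumes "simple_integrand M F n \<tau> \<xi>" "i < n" shows "0 \<le> \<tau> i" "\<tau> i \<le> \<tau> (Suc i)"
    "\<xi> i \<in> borel_measurable (F (\<tau> i))" "bounded (\<xi> i ` space M)"
proof -
  have "0 \<le> \<tau> i" if "i \<le> n" for i
    using that assms(1) unfolding simple_integrand_def by (induction i) (auto intro: order.trans)
  then show "0 \<le> \<tau> i" "\<tau> i \<le> \<tau> (Suc i)" "\<xi> i \<in> borel_measurable (F (\<tau> i))" "bounded (\<xi> i ` space M)"
    using assms unfolding simple_integrand_def by auto
qed

lemma elementary_simple_integral:
  assumes s: "simple_integrand M F n \<tau> \<xi>" and t: "0 \<le> t"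
  shows "elementary j (\<lambda>\<omega>. simple_integral n \<tau> \<xi> (\<lambda>\<omega> t. W \<omega> t $ j) \<omega> t)
    (\<lambda>\<omega> s. indicator {0..t} s *\<^sub>R simple_process n \<tau> \<xi> \<omega> s)"
  unfolding simple_integral_def simple_process_def scaleR_sum_right
proof (rule elementary_sum)
  fix i assume i: "i < n"
  note \<tau> = simple_integrand_nonneg [OF s i]
  show "elementary j (\<lambda>\<omega>. (W \<omega> (min t (\<tau> (Suc i))) $ j - W \<omega> (min t (\<tau> i)) $ j) *\<^sub>R \<xi> i \<omega>)
      (\<lambda>\<omega> s. indicator {0..t} s *\<^sub>R indicator {\<tau> i<..\<tau> (Suc i)} s *\<^sub>R \<xi> i \<omega>)"
  \<comment> \<open>An interval that starts at or after \<open>t\<close> contributes neither to the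
    integral nor to the truncated integrand; the others are cut at \<open>t\<close>.\<close>
  proof (cases "\<tau> i < t")
    case True
    have "(\<lambda>\<omega> s. indicator {0..t} s *\<^sub>R indicator {\<tau> i<..\<tau> (Suc i)} s *\<^sub>R \<xi> i \<omega>)
        = (\<lambda>\<omega> s. indicator {\<tau> i<..min t (\<tau> (Suc i))} s *\<^sub>R \<xi> i \<omega>)"
      using \<tau> by (auto simp: fun_eq_iff indicator_def)
    moreover have "(\<lambda>\<omega>. (W \<omega> (min t (\<tau> (Suc i))) $ j - W \<omega> (min t (\<tau> i)) $ j) *\<^sub>R \<xi> i \<omega>)
        = (\<lambda>\<omega>. dW j (\<tau> i) (min t (\<tau> (Suc i))) \<omega> *\<^sub>R \<xi> i \<omega>)"
      using True by (simp add: dW_def)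
    ultimately show ?thesis using \<tau> True by (simp only:) (rule elementary_single, auto)
  next
    case False
    then have "(\<lambda>\<omega> s. indicator {0..t} s *\<^sub>R indicator {\<tau> i<..\<tau> (Suc i)} s *\<^sub>R \<xi> i \<omega>) = (\<lambda>_ _. 0)"
      by (auto simp: fun_eq_iff indicator_def)
    moreover have "(\<lambda>\<omega>. (W \<omega> (min t (\<tau> (Suc i))) $ j - W \<omega> (min t (\<tau> i)) $ j) *\<^sub>R \<xi> i \<omega>) = (\<lambda>_. 0)"
      using False \<tau> by (simp add: min_absorb1)
    ultimately show ?thesis by (simp only: elementary_zero)
  qed
qed

lemma indicator_scaleR_weight:
  assumes A: "A \<in> sets (F a)" and \<xi>: "\<xi> \<in> borel_measurable (F a)" "bounded (\<xi> ` space M)"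
  shows "(\<lambda>\<omega>. indicator A \<omega> *\<^sub>R \<xi> \<omega> :: 'e::euclidean_space) \<in> borel_measurable (F a)"
    "bounded ((\<lambda>\<omega>. indicator A \<omega> *\<^sub>R \<xi> \<omega>) ` space M)"
proof -
  show "(\<lambda>\<omega>. indicator A \<omega> *\<^sub>R \<xi> \<omega>) \<in> borel_measurable (F a)"
    using A \<xi> by (intro borel_measurable_scaleR borel_measurable_indicator) auto
  obtain K where K: "\<And>\<omega>. \<omega> \<in> space M \<Longrightarrow> norm (\<xi> \<omega>) \<le> K" using \<xi>(2) by (auto simp: bounded_iff)
  have "norm (indicator A \<omega> *\<^sub>R \<xi> \<omega>) \<le> K" if "\<omega> \<in> space M" for \<omega>
    using K [OF that] order.trans [OF norm_ge_zero K [OF that]] by (auto simp: indicator_def)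
  then show "bounded ((\<lambda>\<omega>. indicator A \<omega> *\<^sub>R \<xi> \<omega>) ` space M)" by (auto simp: bounded_iff)
qed

text \<open>After time \<open>S\<close> every remaining interval starts at
  \<open>max S (\<tau> i)\<close>, where the event \<open>A\<close> is already known, so
  \<open>A\<close> can be absorbed into the weight.\<close>

lemma elementary_simple_increment:
  assumes s: "simple_integrand M F n \<tau> \<xi>" and S: "0 \<le> S" "S \<le> u" and A: "A \<in> sets (F S)"
  shows "elementary j
    (\<lambda>\<omega>. indicator A \<omega> *\<^sub>R (simple_integral n \<tau> \<xi> (\<lambda>\<omega> t. W \<omega> t $ j) \<omega> u
       - simple_integral n \<tau> \<xi> (\<lambda>\<omega> t. W \<omega> t $ j) \<omega> S))
    (\<lambda>\<omega> s. (indicator A \<omega> * indicator {S<..u} s) *\<^sub>R simple_process n \<tau> \<xi> \<omega> s)"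
  unfolding simple_integral_def simple_process_def scaleR_sum_right sum_subtractf [symmetric]
proof (rule elementary_sum)
  fix i assume i: "i < n"
  note \<tau> = simple_integrand_nonneg [OF s i]
  let ?Y = "\<lambda>\<omega>. indicator A \<omega> *\<^sub>R ((W \<omega> (min u (\<tau> (Suc i))) $ j - W \<omega> (min u (\<tau> i)) $ j) *\<^sub>R \<xi> i \<omega>
         - (W \<omega> (min S (\<tau> (Suc i))) $ j - W \<omega> (min S (\<tau> i)) $ j) *\<^sub>R \<xi> i \<omega>)"
  let ?h = "\<lambda>\<omega> s. (indicator A \<omega> * indicator {S<..u} s) *\<^sub>R indicator {\<tau> i<..\<tau> (Suc i)} s *\<^sub>R \<xi> i \<omega>"
  show "elementary j ?Y ?h"
  proof (cases "\<tau> i < u \<and> S < \<tau> (Suc i)")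
    case True
    have 1: "?h = (\<lambda>\<omega> s. indicator {max S (\<tau> i)<..min u (\<tau> (Suc i))} s *\<^sub>R (indicator A \<omega> *\<^sub>R \<xi> i \<omega>))"
      using \<tau> by (auto simp: fun_eq_iff indicator_def)
    have "(W \<omega> (min u (\<tau> (Suc i))) $ j - W \<omega> (min u (\<tau> i)) $ j)
        - (W \<omega> (min S (\<tau> (Suc i))) $ j - W \<omega> (min S (\<tau> i)) $ j)
        = dW j (max S (\<tau> i)) (min u (\<tau> (Suc i))) \<omega>" for \<omega>
      using True by (cases "\<tau> i \<le> S") (auto simp: dW_def min_def max_def)
    then have 2: "?Y = (\<lambda>\<omega>. dW j (max S (\<tau> i)) (min u (\<tau> (Suc i))) \<omega> *\<^sub>R (indicator A \<omega> *\<^sub>R \<xi> i \<omega>))"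
      unfolding scaleR_diff_left [symmetric] by (simp add: mult.commute)
    have "A \<in> sets (F (max S (\<tau> i)))" using A sets_F_mono [of S "max S (\<tau> i)"] S by auto
    moreover have "\<xi> i \<in> borel_measurable (F (max S (\<tau> i)))"
      by (rule measurable_F_mono [OF _ _ \<tau>(3)]) (use \<tau> in auto)
    ultimately show ?thesis unfolding 1 2 using True S \<tau>
      by (intro elementary_single indicator_scaleR_weight) auto
  next
    case False
    then have "?h = (\<lambda>_ _. 0)" by (auto simp: fun_eq_iff indicator_def)
    moreover have "?Y = (\<lambda>_. 0)"
    proof (cases "\<tau> i < u")
      case True
      then have "\<tau> (Suc i) \<le> S" using False by simp
      then have "min u (\<tau> (Suc i)) = min S (\<tau> (Suc i))" "min u (\<tau> i) = min S (\<tau> i)"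
        using \<tau> S by auto
      then show ?thesis by simp
    next
      case False
      then show ?thesis using \<tau> S by (simp add: min_absorb1)
    qed
    ultimately show ?thesis by (simp only: elementary_zero)
  qed
qed

lemma prog_measurable_joint:
  fixes H :: "'a \<Rightarrow> real \<Rightarrow> 'e::euclidean_space"
  assumes H: "prog_measurable F H" and t: "0 \<le> t"
  shows "(\<lambda>(\<omega>, s). indicator {0..t} s *\<^sub>R H \<omega> s) \<in> borel_measurable (M \<Otimes>\<^sub>M lborel)"
proof -
  have id: "(\<lambda>\<omega>. \<omega>) \<in> measurable M (F t)"
    by (rule measurable_F_M [OF t]) simp
  \<comment> \<open>Clamping the time to \<open>[0, t]\<close> turns measurability on the restricted
    space into measurability on the whole line; the indicator hides the altered values.\<close>
  have c: "(\<lambda>s::real. max 0 (min s t)) \<in> measurable lborel (restrict_space borel {0..t})"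
    using t by (intro measurable_restrict_space2) auto
  have "(\<lambda>p. (max 0 (min (snd p) t), fst p)) \<in> measurable (M \<Otimes>\<^sub>M lborel) (restrict_space borel {0..t} \<Otimes>\<^sub>M F t)"
    by (intro measurable_Pair measurable_compose [OF measurable_snd c] measurable_compose [OF measurable_fst id])
  moreover have "(\<lambda>(s, \<omega>). H \<omega> s) \<in> borel_measurable (restrict_space borel {0..t} \<Otimes>\<^sub>M F t)"
    using H t by (auto simp: prog_measurable_def)
  ultimately have "(\<lambda>p. H (fst p) (max 0 (min (snd p) t))) \<in> borel_measurable (M \<Otimes>\<^sub>M lborel)"
    by (auto dest: measurable_compose)
  then have "(\<lambda>p. indicator {0..t} (snd p) *\<^sub>R H (fst p) (max 0 (min (snd p) t))) \<in> borel_measurable (M \<Otimes>\<^sub>M lborel)"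
    by measurable
  moreover have "indicator {0..t} s *\<^sub>R H \<omega> (max 0 (min s t)) = indicator {0..t} s *\<^sub>R H \<omega> s" for \<omega> s
    by (auto simp: indicator_def)
  ultimately show ?thesis by (simp add: split_def)
qed

lemma ito_error_eq_sqint:
  fixes H :: "'a \<Rightarrow> real \<Rightarrow> 'e::euclidean_space"
  assumes H: "prog_measurable F H" and t: "0 \<le> t" and s: "simple_integrand M F n \<tau> \<xi>"
  shows "(\<integral>\<^sup>+\<omega>. (\<integral>\<^sup>+s\<in>{0..t}. ennreal ((norm (simple_process n \<tau> \<xi> \<omega> s - H \<omega> s))\<^sup>2) \<partial>lborel) \<partial>M)
    = sqint (M \<Otimes>\<^sub>M lborel) (\<lambda>(\<omega>, s). indicator {0..t} s *\<^sub>R simple_process n \<tau> \<xi> \<omega> s - indicator {0..t} s *\<^sub>R H \<omega> s)"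
proof -
  have [measurable]: "(\<lambda>(\<omega>, s). indicator {0..t} s *\<^sub>R H \<omega> s) \<in> borel_measurable (M \<Otimes>\<^sub>M lborel)"
    "(\<lambda>(\<omega>, s). indicator {0..t} s *\<^sub>R simple_process n \<tau> \<xi> \<omega> s) \<in> borel_measurable (M \<Otimes>\<^sub>M lborel)"
    by (rule prog_measurable_joint [OF H t] elementary_measurable(2) [OF elementary_simple_integral [OF s t]])+
  have "ennreal ((norm (x - y))\<^sup>2) * indicator {0..t} s
      = ennreal ((norm (indicator {0..t} s *\<^sub>R x - indicator {0..t} s *\<^sub>R y))\<^sup>2)" for x y :: 'e and s
    by (auto simp: indicator_def)
  then show ?thesis unfolding sqint_def
    by (subst lborel.nn_integral_fst [symmetric]) (auto simp: split_def)
qed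

text \<open>The definition of the integral supplies a separate approximating sequence for each time.
  By the isometry on \<open>[0, S]\<close>, the sequence chosen for \<open>u\<close> also works at
  time \<open>S\<close>, so increments of a single sequence approximate the increment of
  \<open>J\<close>. The constant 4 reflects two uses of \<open>sqint_add\<close>.\<close>

lemma ito_increment_bound:
  fixes H :: "'a \<Rightarrow> real \<Rightarrow> 'e::euclidean_space"
  assumes ito: "is_ito_integral M F (\<lambda>\<omega> t. W \<omega> t $ j) H J"
    and S: "0 \<le> S" "S \<le> u" and A: "A \<in> sets (F S)"
    and \<xi>: "\<xi> \<in> borel_measurable (F S)" "bounded (\<xi> ` space M)"
  shows "(\<integral>\<^sup>+\<omega>. ennreal ((norm (indicator A \<omega> *\<^sub>R (J \<omega> u - J \<omega> S - dW j S u \<omega> *\<^sub>R \<xi> \<omega>)))\<^sup>2) \<partial>M)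
    \<le> 4 * (\<integral>\<^sup>+\<omega>. (\<integral>\<^sup>+s. ennreal ((norm ((indicator A \<omega> * indicator {S<..u} s) *\<^sub>R (H \<omega> s - \<xi> \<omega>)))\<^sup>2) \<partial>lborel) \<partial>M)"
proof -
  let ?P = "M \<Otimes>\<^sub>M (lborel :: real measure)"
  let ?B = "\<lambda>\<omega> t. W \<omega> t $ j"
  have u: "0 \<le> u" using S by simp
  have H: "prog_measurable F H" using ito by (simp add: is_ito_integral_def)
  have J: "(\<lambda>\<omega>. J \<omega> t) \<in> borel_measurable M" if "0 \<le> t" for t
    using ito that by (simp add: is_ito_integral_def)
  have ex: "\<exists>N \<tau> \<zeta>. (\<forall>k. simple_integrand M F (N k) (\<tau> k) (\<zeta> k)) \<and>
      (\<lambda>k. sqint ?P (\<lambda>(\<omega>, s). indicator {0..t} s *\<^sub>R simple_process (N k) (\<tau> k) (\<zeta> k) \<omega> s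
        - indicator {0..t} s *\<^sub>R H \<omega> s)) \<longlonglongrightarrow> 0 \<and>
      (\<lambda>k. sqint M (\<lambda>\<omega>. simple_integral (N k) (\<tau> k) (\<zeta> k) ?B \<omega> t - J \<omega> t)) \<longlonglongrightarrow> 0"
    if t: "0 \<le> t" for t
  proof -
    have "\<exists>N \<tau> \<zeta>. (\<forall>k. simple_integrand M F (N k) (\<tau> k) (\<zeta> k)) \<and>
          (\<lambda>k. \<integral>\<^sup>+\<omega>. (\<integral>\<^sup>+s\<in>{0..t}.
             ennreal ((norm (simple_process (N k) (\<tau> k) (\<zeta> k) \<omega> s - H \<omega> s))\<^sup>2) \<partial>lborel) \<partial>M)
            \<longlonglongrightarrow> 0 \<and>
          (\<lambda>k. \<integral>\<^sup>+\<omega>. ennreal ((norm (simple_integral (N k) (\<tau> k) (\<zeta> k) ?B \<omega> t - J \<omega> t))\<^sup>2) \<partial>M)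
            \<longlonglongrightarrow> 0"
      using ito t unfolding is_ito_integral_def by blast
    then obtain N \<tau> \<zeta> where s: "\<And>k. simple_integrand M F (N k) (\<tau> k) (\<zeta> k)"
      and c: "(\<lambda>k. \<integral>\<^sup>+\<omega>. (\<integral>\<^sup>+s\<in>{0..t}.
             ennreal ((norm (simple_process (N k) (\<tau> k) (\<zeta> k) \<omega> s - H \<omega> s))\<^sup>2) \<partial>lborel) \<partial>M)
            \<longlonglongrightarrow> 0"
        "(\<lambda>k. \<integral>\<^sup>+\<omega>. ennreal ((norm (simple_integral (N k) (\<tau> k) (\<zeta> k) ?B \<omega> t - J \<omega> t))\<^sup>2) \<partial>M)
            \<longlonglongrightarrow> 0"
      by blast
    have "(\<lambda>k. sqint ?P (\<lambda>(\<omega>, s). indicator {0..t} s *\<^sub>R simple_process (N k) (\<tau> k) (\<zeta> k) \<omega> s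
        - indicator {0..t} s *\<^sub>R H \<omega> s)) \<longlonglongrightarrow> 0"
      using c(1) unfolding ito_error_eq_sqint [OF H t s] .
    moreover have "(\<lambda>k. sqint M (\<lambda>\<omega>. simple_integral (N k) (\<tau> k) (\<zeta> k) ?B \<omega> t - J \<omega> t)) \<longlonglongrightarrow> 0"
      using c(2) unfolding sqint_def .
    ultimately show ?thesis using s by blast
  qed
  obtain N \<tau> \<zeta> where s: "\<And>k. simple_integrand M F (N k) (\<tau> k) (\<zeta> k)"
    and l1: "(\<lambda>k. sqint ?P (\<lambda>(\<omega>, s). indicator {0..u} s *\<^sub>R simple_process (N k) (\<tau> k) (\<zeta> k) \<omega> s
        - indicator {0..u} s *\<^sub>R H \<omega> s)) \<longlonglongrightarrow> 0"
    and l2: "(\<lambda>k. sqint M (\<lambda>\<omega>. simple_integral (N k) (\<tau> k) (\<zeta> k) ?B \<omega> u - J \<omega> u)) \<longlonglongrightarrow> 0"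
    using ex [OF u] by blast
  obtain N' \<tau>' \<zeta>' where s': "\<And>k. simple_integrand M F (N' k) (\<tau>' k) (\<zeta>' k)"
    and l1': "(\<lambda>k. sqint ?P (\<lambda>(\<omega>, s). indicator {0..S} s *\<^sub>R simple_process (N' k) (\<tau>' k) (\<zeta>' k) \<omega> s
        - indicator {0..S} s *\<^sub>R H \<omega> s)) \<longlonglongrightarrow> 0"
    and l2': "(\<lambda>k. sqint M (\<lambda>\<omega>. simple_integral (N' k) (\<tau>' k) (\<zeta>' k) ?B \<omega> S - J \<omega> S)) \<longlonglongrightarrow> 0"
    using ex [OF S(1)] by blast
  define p where "p k \<omega> s = simple_process (N k) (\<tau> k) (\<zeta> k) \<omega> s" for k \<omega> s
  define p' where "p' k \<omega> s = simple_process (N' k) (\<tau>' k) (\<zeta>' k) \<omega> s" for k \<omega> s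
  define I where "I k t \<omega> = simple_integral (N k) (\<tau> k) (\<zeta> k) ?B \<omega> t" for k t \<omega>
  define I' where "I' k t \<omega> = simple_integral (N' k) (\<tau>' k) (\<zeta>' k) ?B \<omega> t" for k t \<omega>
  have e: "elementary j (I k t) (\<lambda>\<omega> s. indicator {0..t} s *\<^sub>R p k \<omega> s)"
    "elementary j (I' k t) (\<lambda>\<omega> s. indicator {0..t} s *\<^sub>R p' k \<omega> s)" if "0 \<le> t" for k t
    unfolding I_def [abs_def] I'_def [abs_def] p_def p'_def
    by (rule elementary_simple_integral [OF s that] elementary_simple_integral [OF s' that])+
  note I_meas = elementary_measurable(1) [OF e(1)] elementary_measurable(1) [OF e(2)]
  note p_meas = elementary_measurable(2) [OF e(1)] elementary_measurable(2) [OF e(2)]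
  note H_meas = prog_measurable_joint [OF H]
  let ?a = "\<lambda>k. sqint M (\<lambda>\<omega>. I k u \<omega> - J \<omega> u)"
  let ?b = "\<lambda>k. sqint M (\<lambda>\<omega>. I' k S \<omega> - J \<omega> S)"
  let ?c = "\<lambda>k. sqint ?P (\<lambda>(\<omega>, s). indicator {0..u} s *\<^sub>R p k \<omega> s - indicator {0..u} s *\<^sub>R H \<omega> s)"
  let ?d = "\<lambda>k. sqint ?P (\<lambda>(\<omega>, s). indicator {0..S} s *\<^sub>R p' k \<omega> s - indicator {0..S} s *\<^sub>R H \<omega> s)"
  let ?R = "sqint ?P (\<lambda>(\<omega>, s). (indicator A \<omega> * indicator {S<..u} s) *\<^sub>R (H \<omega> s - \<xi> \<omega>))"
  have IS: "sqint M (\<lambda>\<omega>. I k S \<omega> - J \<omega> S) \<le> 4 * ?c k + 4 * ?d k + 2 * ?b k" for k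
  proof -
    have "sqint M (\<lambda>\<omega>. I k S \<omega> - J \<omega> S) \<le> 2 * sqint M (\<lambda>\<omega>. I k S \<omega> - I' k S \<omega>) + 2 * ?b k"
      by (rule sqint_diff) (use I_meas [OF S(1)] J S in auto)
    also have "sqint M (\<lambda>\<omega>. I k S \<omega> - I' k S \<omega>)
        = sqint ?P (\<lambda>(\<omega>, s). indicator {0..S} s *\<^sub>R p k \<omega> s - indicator {0..S} s *\<^sub>R p' k \<omega> s)"
      by (rule sqint_elementary [OF elementary_diff [OF e(1) [OF S(1)] e(2) [OF S(1)]]])
    also have "\<dots> \<le> 2 * sqint ?P (\<lambda>(\<omega>, s). indicator {0..S} s *\<^sub>R p k \<omega> s - indicator {0..S} s *\<^sub>R H \<omega> s)
        + 2 * sqint ?P (\<lambda>(\<omega>, s). indicator {0..S} s *\<^sub>R H \<omega> s - indicator {0..S} s *\<^sub>R p' k \<omega> s)"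
      using sqint_diff [OF p_meas(1) [OF S(1)] H_meas [OF S(1)] p_meas(2) [OF S(1)]]
      by (simp add: split_def)
    also have "sqint ?P (\<lambda>(\<omega>, s). indicator {0..S} s *\<^sub>R H \<omega> s - indicator {0..S} s *\<^sub>R p' k \<omega> s) = ?d k"
      unfolding split_def by (rule sqint_minus_commute)
    also have "sqint ?P (\<lambda>(\<omega>, s). indicator {0..S} s *\<^sub>R p k \<omega> s - indicator {0..S} s *\<^sub>R H \<omega> s) \<le> ?c k"
      using S by (intro sqint_mono) (auto simp: indicator_def)
    finally show ?thesis
      by (simp add: distrib_left mult.assoc [symmetric] add_mono mult_left_mono)
  qed
  have ew: "elementary j (\<lambda>\<omega>. dW j S u \<omega> *\<^sub>R (indicator A \<omega> *\<^sub>R \<xi> \<omega>))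
      (\<lambda>\<omega> s. indicator {S<..u} s *\<^sub>R (indicator A \<omega> *\<^sub>R \<xi> \<omega>))"
    using S by (intro elementary_single indicator_scaleR_weight [OF A \<xi>]) auto
  have ei: "elementary j (\<lambda>\<omega>. indicator A \<omega> *\<^sub>R (I k u \<omega> - I k S \<omega>))
     (\<lambda>\<omega> s. (indicator A \<omega> * indicator {S<..u} s) *\<^sub>R p k \<omega> s)" for k
    unfolding I_def p_def by (rule elementary_simple_increment [OF s S A])
  have AM [measurable]: "A \<in> sets M" using A subalgebra_F [OF S(1)] by (auto simp: subalgebra_def)
  have Hu: "(\<lambda>(\<omega>, s). (indicator A \<omega> * indicator {S<..u} s) *\<^sub>R H \<omega> s) \<in> borel_measurable ?P"
  proof -
    have eq: "(indicator A \<omega> * indicator {S<..u} s) *\<^sub>R H \<omega> s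
        = (indicator A \<omega> * indicator {S<..u} s) *\<^sub>R (indicator {0..u} s *\<^sub>R H \<omega> s)" for \<omega> s
      using S by (auto simp: indicator_def)
    have [measurable]: "(\<lambda>p. indicator {0..u} (snd p) *\<^sub>R H (fst p) (snd p)) \<in> borel_measurable ?P"
      using H_meas [OF u] by (simp add: split_def)
    show ?thesis unfolding split_def by (subst eq) measurable
  qed
  \<comment> \<open>The Brownian increment times a weight known at \<open>S\<close> is itself an
    elementary integral, so the isometry applies to the difference as a whole.\<close>
  have main: "sqint M (\<lambda>\<omega>. indicator A \<omega> *\<^sub>R (I k u \<omega> - I k S \<omega>) - dW j S u \<omega> *\<^sub>R (indicator A \<omega> *\<^sub>R \<xi> \<omega>))
      \<le> 2 * ?c k + 2 * ?R" for k
  proof -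
    have "sqint M (\<lambda>\<omega>. indicator A \<omega> *\<^sub>R (I k u \<omega> - I k S \<omega>) - dW j S u \<omega> *\<^sub>R (indicator A \<omega> *\<^sub>R \<xi> \<omega>))
      = sqint ?P (\<lambda>(\<omega>, s). (indicator A \<omega> * indicator {S<..u} s) *\<^sub>R p k \<omega> s
          - indicator {S<..u} s *\<^sub>R (indicator A \<omega> *\<^sub>R \<xi> \<omega>))"
      by (rule sqint_elementary [OF elementary_diff [OF ei ew]])
    also have "\<dots> \<le> 2 * sqint ?P (\<lambda>(\<omega>, s). (indicator A \<omega> * indicator {S<..u} s) *\<^sub>R p k \<omega> s
          - (indicator A \<omega> * indicator {S<..u} s) *\<^sub>R H \<omega> s)
        + 2 * sqint ?P (\<lambda>(\<omega>, s). (indicator A \<omega> * indicator {S<..u} s) *\<^sub>R H \<omega> s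
          - indicator {S<..u} s *\<^sub>R (indicator A \<omega> *\<^sub>R \<xi> \<omega>))"
      using sqint_diff [OF elementary_measurable(2) [OF ei] Hu elementary_measurable(2) [OF ew]]
      by (simp add: split_def)
    also have "sqint ?P (\<lambda>(\<omega>, s). (indicator A \<omega> * indicator {S<..u} s) *\<^sub>R p k \<omega> s
          - (indicator A \<omega> * indicator {S<..u} s) *\<^sub>R H \<omega> s) \<le> ?c k"
      using S by (intro sqint_mono) (auto simp: indicator_def)
    also have "sqint ?P (\<lambda>(\<omega>, s). (indicator A \<omega> * indicator {S<..u} s) *\<^sub>R H \<omega> s
          - indicator {S<..u} s *\<^sub>R (indicator A \<omega> *\<^sub>R \<xi> \<omega>)) = ?R"
      by (simp add: scaleR_diff_right mult.commute)
    finally show ?thesis by (simp add: add_mono mult_left_mono)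
  qed
  have \<xi>M: "\<xi> \<in> borel_measurable M" by (rule measurable_F_M [OF S(1) \<xi>(1)])
  have L: "sqint M (\<lambda>\<omega>. indicator A \<omega> *\<^sub>R (J \<omega> u - J \<omega> S - dW j S u \<omega> *\<^sub>R \<xi> \<omega>))
      \<le> 4 * ?a k + 4 * (4 * ?c k + 4 * ?d k + 2 * ?b k) + 2 * (2 * ?c k + 2 * ?R)" for k
  proof -
    let ?E = "\<lambda>\<omega>. indicator A \<omega> *\<^sub>R (I k u \<omega> - I k S \<omega>) - dW j S u \<omega> *\<^sub>R (indicator A \<omega> *\<^sub>R \<xi> \<omega>)"
    let ?G = "\<lambda>\<omega>. (J \<omega> u - I k u \<omega>) + (I k S \<omega> - J \<omega> S)"
    have m: "?E \<in> borel_measurable M"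
      by (rule elementary_measurable(1) [OF elementary_diff [OF ei ew]])
    have g: "(\<lambda>\<omega>. J \<omega> u - I k u \<omega>) \<in> borel_measurable M" "(\<lambda>\<omega>. I k S \<omega> - J \<omega> S) \<in> borel_measurable M"
      using I_meas [OF S(1)] I_meas [OF u] J S u by auto
    have "sqint M (\<lambda>\<omega>. indicator A \<omega> *\<^sub>R (J \<omega> u - J \<omega> S - dW j S u \<omega> *\<^sub>R \<xi> \<omega>))
        = sqint M (\<lambda>\<omega>. indicator A \<omega> *\<^sub>R ?G \<omega> + ?E \<omega>)"
      by (intro arg_cong [where f = "sqint M"] ext) (simp add: algebra_simps)
    also have "\<dots> \<le> 2 * sqint M (\<lambda>\<omega>. indicator A \<omega> *\<^sub>R ?G \<omega>) + 2 * sqint M ?E"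
      by (rule sqint_add [OF _ m]) (use g in measurable)
    also have "sqint M (\<lambda>\<omega>. indicator A \<omega> *\<^sub>R ?G \<omega>) \<le> sqint M ?G"
      by (intro sqint_mono) (auto simp: indicator_def)
    also have "sqint M ?G \<le> 2 * sqint M (\<lambda>\<omega>. J \<omega> u - I k u \<omega>) + 2 * sqint M (\<lambda>\<omega>. I k S \<omega> - J \<omega> S)"
      by (rule sqint_add [OF g])
    also have "sqint M (\<lambda>\<omega>. J \<omega> u - I k u \<omega>) = ?a k" by (rule sqint_minus_commute)
    also have "2 * (2 * ?a k + 2 * sqint M (\<lambda>\<omega>. I k S \<omega> - J \<omega> S)) + 2 * sqint M ?E
        \<le> 2 * (2 * ?a k + 2 * (4 * ?c k + 4 * ?d k + 2 * ?b k)) + 2 * (2 * ?c k + 2 * ?R)"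
      by (intro add_mono mult_left_mono IS main order.refl) auto
    also have "\<dots> = 4 * ?a k + 4 * (4 * ?c k + 4 * ?d k + 2 * ?b k) + 2 * (2 * ?c k + 2 * ?R)"
      by (simp add: distrib_left mult.assoc [symmetric])
    finally show ?thesis by (simp add: add_mono mult_left_mono)
  qed
  have "(\<lambda>k. 4 * ?a k + 4 * (4 * ?c k + 4 * ?d k + 2 * ?b k) + 2 * (2 * ?c k + 2 * ?R))
      \<longlonglongrightarrow> 4 * 0 + 4 * (4 * 0 + 4 * 0 + 2 * 0) + 2 * (2 * 0 + 2 * ?R)"
    using l1 l2 l1' l2' unfolding I_def I'_def p_def p'_def
    by (intro tendsto_add ennreal_tendsto_cmult tendsto_const) auto
  then have "sqint M (\<lambda>\<omega>. indicator A \<omega> *\<^sub>R (J \<omega> u - J \<omega> S - dW j S u \<omega> *\<^sub>R \<xi> \<omega>))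
      \<le> 4 * 0 + 4 * (4 * 0 + 4 * 0 + 2 * 0) + 2 * (2 * 0 + 2 * ?R)"
    by (rule LIMSEQ_le_const) (use L in auto)
  also have "\<dots> = 4 * ?R" by (simp add: mult.assoc [symmetric])
  also have "?R = (\<integral>\<^sup>+\<omega>. (\<integral>\<^sup>+s. ennreal ((norm ((indicator A \<omega> * indicator {S<..u} s) *\<^sub>R (H \<omega> s - \<xi> \<omega>)))\<^sup>2) \<partial>lborel) \<partial>M)"
  proof -
    define K where "K p = (indicator A (fst p) * indicator {S<..u} (snd p)) *\<^sub>R (H (fst p) (snd p) - \<xi> (fst p))" for p
    have [measurable]: "K \<in> borel_measurable ?P"
      using borel_measurable_diff [OF Hu elementary_measurable(2) [OF ew]]
      by (simp add: K_def [abs_def] split_def scaleR_diff_right mult.commute)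
    have m: "(\<lambda>p. ennreal ((norm (K p))\<^sup>2)) \<in> borel_measurable ?P" by measurable
    show ?thesis using lborel.nn_integral_fst [OF m, symmetric]
      unfolding K_def sqint_def split_def by (simp only: fst_conv snd_conv)
  qed
  finally show ?thesis unfolding sqint_def .
qed

end

section \<open>Increments of the solution\<close>

lemma norm_sum_square_le:
  fixes x :: "'i \<Rightarrow> 'e::real_normed_vector"
  shows "(norm (\<Sum>i\<in>I. x i))\<^sup>2 \<le> card I * (\<Sum>i\<in>I. (norm (x i))\<^sup>2)"
proof -
  have "(norm (\<Sum>i\<in>I. x i))\<^sup>2 \<le> (\<Sum>i\<in>I. norm (x i))\<^sup>2" by (intro power_mono norm_sum) simp
  also have "\<dots> \<le> (\<Sum>i\<in>I. (norm (x i))\<^sup>2) * card I" by (rule sum_squared_le_sum_of_squares)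
  finally show ?thesis by (simp add: mult.commute)
qed

lemma osc_le:
  assumes "s \<le> t" "\<And>u. s \<le> u \<Longrightarrow> u \<le> t \<Longrightarrow> norm (w u - w s) \<le> B"
  shows "osc s t w \<le> B"
  unfolding osc_def using assms by (intro cSUP_least) auto

text \<open>Compactness of \<open>[s, u]\<close> makes the set of distances bounded, without which
  the real supremum would carry no information.\<close>

lemma osc_nonneg_mono:
  assumes w: "w \<in> cpaths" and s: "0 \<le> s" "s \<le> t" "t \<le> u"
  shows "0 \<le> osc s t w" "osc s t w \<le> osc s u w"
proof -
  have "continuous_on {s..u} (\<lambda>v. norm (w v - w s))"
    using w s by (intro continuous_intros) (auto simp: cpaths_def intro: continuous_on_subset)
  then have "compact ((\<lambda>v. norm (w v - w s)) ` {s..u})"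
    by (intro compact_continuous_image) auto
  then have b: "bdd_above ((\<lambda>v. norm (w v - w s)) ` {s..u})"
    by (intro bounded_imp_bdd_above compact_imp_bounded)
  show "osc s t w \<le> osc s u w"
    unfolding osc_def using s b by (intro cSUP_subset_mono) auto
  have "norm (w s - w s) \<le> osc s t w"
    unfolding osc_def using s by (intro cSUP_upper bdd_above_mono [OF b]) auto
  then show "0 \<le> osc s t w" by simp
qed

text \<open>On (0, 1) the logarithm is positive and decreasing in the size and the exponent is
  negative; the value 0 prescribed at 0 agrees with the limit there.\<close>

lemma log_modulus_mono:
  assumes "0 \<le> x" "x \<le> y" "y < 1" "0 < \<epsilon>"
  shows "log_modulus \<epsilon> x \<le> log_modulus \<epsilon> y"
proof (cases "x = 0")
  case False
  then have "ln (1 / y) \<le> ln (1 / x)" "0 < ln (1 / y)"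
    using assms by (auto intro: frac_le)
  then have "ln (1 / x) powr - (2 + \<epsilon>) \<le> ln (1 / y) powr - (2 + \<epsilon>)"
    using assms by (intro powr_mono2') auto
  then show ?thesis using False assms by (auto simp: log_modulus_def)
qed (simp add: log_modulus_def)

text \<open>Constant in the second moment of an increment. In \<open>8 n^2\<close> there is a factor
  2 for splitting off the drift, 4 from the increment bound for each stochastic integral,
  \<open>n\<close> from Cauchy-Schwarz over the noise components and \<open>n\<close> from summing
  over them. The summand 2 belongs to the drift.\<close>

definition osc_const :: "nat \<Rightarrow> real \<Rightarrow> real" where
  "osc_const n K = (8 * (real n)\<^sup>2 + 2) * K\<^sup>2"

locale sde = brownian M F W
  for M :: "'a measure" and F and W :: "'a \<Rightarrow> real \<Rightarrow> real^'n" +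
  fixes X :: "'a \<Rightarrow> real \<Rightarrow> real^'d"
    and \<sigma> :: "'n \<Rightarrow> (real \<Rightarrow> real^'d) \<Rightarrow> (real \<Rightarrow> real^'d)"
    and b :: "(real \<Rightarrow> real^'d) \<Rightarrow> (real \<Rightarrow> real^'d)"
    and J :: "'n \<Rightarrow> 'a \<Rightarrow> real \<Rightarrow> real^'d"
    and K :: real
  assumes b_paths: "b \<in> cpaths \<rightarrow> cpaths"
    and X_paths: "X \<in> space M \<rightarrow> cpaths"
    and X_adapted: "adapted F X"
    and \<sigma>_adapted: "\<And>j. adapted F (\<lambda>\<omega>. \<sigma> j (X \<omega>))"
    and ito: "\<And>j. is_ito_integral M F (\<lambda>\<omega> t. W \<omega> t $ j) (\<lambda>\<omega>. \<sigma> j (X \<omega>)) (J j)"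
    and eqn: "AE \<omega> in M. \<forall>t\<ge>0. X \<omega> t = X \<omega> 0 + (\<Sum>j\<in>UNIV. J j \<omega> t) + integral {0..t} (b (X \<omega>))"
    and K_pos: "0 < K"
    and \<sigma>_bound: "\<And>j w t. w \<in> cpaths \<Longrightarrow> 0 \<le> t \<Longrightarrow> norm (\<sigma> j w t) \<le> K"
    and b_bound: "\<And>w t. w \<in> cpaths \<Longrightarrow> 0 \<le> t \<Longrightarrow> norm (b w t) \<le> K"
begin

lemma X_cpaths: "\<omega> \<in> space M \<Longrightarrow> X \<omega> \<in> cpaths"
  using X_paths by auto

lemma X_measurable: "0 \<le> s \<Longrightarrow> s \<le> t \<Longrightarrow> (\<lambda>\<omega>. X \<omega> s) \<in> borel_measurable (F t)"
  by (rule measurable_F_mono [of s]) (use X_adapted in \<open>auto simp: adapted_def\<close>)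

lemma X_measurable_M [measurable]: "0 \<le> s \<Longrightarrow> (\<lambda>\<omega>. X \<omega> s) \<in> borel_measurable M"
  by (rule measurable_F_M [of s, OF _ X_measurable]) auto

lemma \<sigma>_measurable: "0 \<le> s \<Longrightarrow> s \<le> t \<Longrightarrow> (\<lambda>\<omega>. \<sigma> j (X \<omega>) s) \<in> borel_measurable (F t)"
  by (rule measurable_F_mono [of s]) (use \<sigma>_adapted [of j] in \<open>auto simp: adapted_def\<close>)

lemma \<sigma>_measurable_M [measurable]: "0 \<le> s \<Longrightarrow> (\<lambda>\<omega>. \<sigma> j (X \<omega>) s) \<in> borel_measurable M"
  by (rule measurable_F_M [of s, OF _ \<sigma>_measurable]) auto

lemma \<sigma>_bounded: "0 \<le> s \<Longrightarrow> bounded ((\<lambda>\<omega>. \<sigma> j (X \<omega>) s) ` space M)"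
  unfolding bounded_iff using \<sigma>_bound X_cpaths by (intro exI [of _ K]) auto

lemma drift_bound:
  assumes w: "w \<in> cpaths" and S: "0 \<le> S" "S \<le> u"
  shows "norm (integral {0..u} (b w) - integral {0..S} (b w)) \<le> K * (u - S)"
proof -
  have "b w \<in> cpaths" using w b_paths by auto
  then have c: "continuous_on {0..} (b w)" by (simp add: cpaths_def)
  have "integral {0..S} (b w) + integral {S..u} (b w) = integral {0..u} (b w)"
    using S by (intro Henstock_Kurzweil_Integration.integral_combine integrable_continuous_real
        continuous_on_subset [OF c]) auto
  then have "integral {0..u} (b w) - integral {0..S} (b w) = integral {S..u} (b w)"
    by (metis add_diff_cancel_left')
  also have "norm \<dots> \<le> K * (u - S)"
    using S w b_bound by (intro integral_bound continuous_on_subset [OF c]) auto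
  finally show ?thesis .
qed

text \<open>Separates the stochastic integrals from the drift, which yields the last term. The event
  \<open>A\<close> keeps the bound usable conditionally on time \<open>S\<close>. The weights \<xi>
  will be either 0, for the size of increments, or the coefficients at time \<open>S\<close>, for
  the freezing error.\<close>

lemma increment_bound:
  assumes S: "0 \<le> S" "S \<le> u" and A: "A \<in> sets (F S)"
    and \<xi>: "\<And>j. \<xi> j \<in> borel_measurable (F S)" "\<And>j. bounded (\<xi> j ` space M)"
    and R: "\<And>j \<omega>. \<omega> \<in> space M \<Longrightarrow>
      (\<integral>\<^sup>+s. ennreal ((norm ((indicator A \<omega> * indicator {S<..u} s) *\<^sub>R (\<sigma> j (X \<omega>) s - \<xi> j \<omega>)))\<^sup>2) \<partial>lborel) \<le> R \<omega>"
    and Rm: "R \<in> borel_measurable M"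
  shows "(\<integral>\<^sup>+\<omega>. ennreal ((norm (indicator A \<omega> *\<^sub>R (X \<omega> u - X \<omega> S - (\<Sum>j\<in>UNIV. dW j S u \<omega> *\<^sub>R \<xi> j \<omega>))))\<^sup>2) \<partial>M)
    \<le> ennreal (8 * (real CARD('n))\<^sup>2) * (\<integral>\<^sup>+\<omega>. R \<omega> \<partial>M) + ennreal (2 * (K * (u - S))\<^sup>2) * emeasure M A"
proof -
  let ?D = "\<lambda>\<omega>. indicator A \<omega> *\<^sub>R (X \<omega> u - X \<omega> S - (\<Sum>j\<in>UNIV. dW j S u \<omega> *\<^sub>R \<xi> j \<omega>))"
  have u: "0 \<le> u" using S by simp
  have AM [measurable]: "A \<in> sets M" using A subalgebra_F [OF S(1)] by (auto simp: subalgebra_def)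
  let ?Z = "\<lambda>j \<omega>. indicator A \<omega> *\<^sub>R (J j \<omega> u - J j \<omega> S - dW j S u \<omega> *\<^sub>R \<xi> j \<omega>)"
  have Jm: "(\<lambda>\<omega>. J j \<omega> t) \<in> borel_measurable M" if "0 \<le> t" for j t
    using ito [of j] that by (simp add: is_ito_integral_def)
  have Zm: "?Z j \<in> borel_measurable M" for j
    using Jm [OF u, of j] Jm [OF S(1), of j] measurable_F_M [OF S(1) \<xi>(1) [of j]] dW_measurable_M [OF S(1) u, of j]
    by (intro borel_measurable_scaleR borel_measurable_diff borel_measurable_indicator AM)
  have AE: "AE \<omega> in M. ennreal ((norm (?D \<omega>))\<^sup>2)
      \<le> ennreal (2 * (real CARD('n))) * (\<Sum>j\<in>UNIV. ennreal ((norm (?Z j \<omega>))\<^sup>2)) + ennreal (2 * (K * (u - S))\<^sup>2) * indicator A \<omega>"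
    using eqn AE_space
  proof eventually_elim
    case (elim \<omega>)
    let ?d = "integral {0..u} (b (X \<omega>)) - integral {0..S} (b (X \<omega>))"
    have Xu: "X \<omega> u = X \<omega> 0 + (\<Sum>j\<in>UNIV. J j \<omega> u) + integral {0..u} (b (X \<omega>))"
      and XS: "X \<omega> S = X \<omega> 0 + (\<Sum>j\<in>UNIV. J j \<omega> S) + integral {0..S} (b (X \<omega>))"
      using elim(1) u S by blast+
    have "X \<omega> u - X \<omega> S - (\<Sum>j\<in>UNIV. dW j S u \<omega> *\<^sub>R \<xi> j \<omega>)
        = (\<Sum>j\<in>UNIV. J j \<omega> u - J j \<omega> S - dW j S u \<omega> *\<^sub>R \<xi> j \<omega>) + ?d"
      unfolding Xu XS sum_subtractf by simp
    then have eq: "?D \<omega>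
        = (\<Sum>j\<in>UNIV. ?Z j \<omega>) + indicator A \<omega> *\<^sub>R ?d"
      by (simp only: scaleR_add_right scaleR_sum_right)
    have "(norm (?D \<omega>))\<^sup>2
        \<le> 2 * (norm (\<Sum>j\<in>UNIV. ?Z j \<omega>))\<^sup>2 + 2 * (norm (indicator A \<omega> *\<^sub>R ?d))\<^sup>2"
      unfolding eq by (rule norm_add_square_le)
    also have "\<dots> \<le> 2 * (real CARD('n) * (\<Sum>j\<in>UNIV. (norm (?Z j \<omega>))\<^sup>2)) + 2 * ((K * (u - S))\<^sup>2 * indicator A \<omega>)"
    proof (intro add_mono mult_left_mono norm_sum_square_le)
      have "(norm ?d)\<^sup>2 \<le> (K * (u - S))\<^sup>2"
        using drift_bound [OF X_cpaths [OF elim(2)] S] by (intro power_mono) auto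
      then show "(norm (indicator A \<omega> *\<^sub>R ?d))\<^sup>2 \<le> (K * (u - S))\<^sup>2 * indicator A \<omega>"
        by (auto simp: indicator_def)
    qed auto
    finally have "ennreal ((norm (?D \<omega>))\<^sup>2)
        \<le> ennreal (2 * (real CARD('n) * (\<Sum>j\<in>UNIV. (norm (?Z j \<omega>))\<^sup>2)) + 2 * ((K * (u - S))\<^sup>2 * indicator A \<omega>))"
      by (rule ennreal_leI)
    also have "\<dots> = ennreal (2 * (real CARD('n) * (\<Sum>j\<in>UNIV. (norm (?Z j \<omega>))\<^sup>2))) + ennreal (2 * ((K * (u - S))\<^sup>2 * indicator A \<omega>))"
      by (rule ennreal_plus) (auto intro!: sum_nonneg mult_nonneg_nonneg)
    also have "ennreal (2 * (real CARD('n) * (\<Sum>j\<in>UNIV. (norm (?Z j \<omega>))\<^sup>2)))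
        = ennreal (2 * (real CARD('n))) * (\<Sum>j\<in>UNIV. ennreal ((norm (?Z j \<omega>))\<^sup>2))"
      by (subst sum_ennreal) (auto simp: ennreal_mult' [symmetric] mult.assoc)
    also have "ennreal (2 * ((K * (u - S))\<^sup>2 * indicator A \<omega>)) = ennreal (2 * (K * (u - S))\<^sup>2) * indicator A \<omega>"
      by (auto simp: indicator_def)
    finally show ?case .
  qed
  have "(\<integral>\<^sup>+\<omega>. ennreal ((norm (?D \<omega>))\<^sup>2) \<partial>M)
      \<le> (\<integral>\<^sup>+\<omega>. ennreal (2 * (real CARD('n))) * (\<Sum>j\<in>UNIV. ennreal ((norm (?Z j \<omega>))\<^sup>2)) + ennreal (2 * (K * (u - S))\<^sup>2) * indicator A \<omega> \<partial>M)"
    by (rule nn_integral_mono_AE [OF AE])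
  also have "\<dots> = ennreal (2 * (real CARD('n))) * (\<Sum>j\<in>UNIV. \<integral>\<^sup>+\<omega>. ennreal ((norm (?Z j \<omega>))\<^sup>2) \<partial>M)
      + ennreal (2 * (K * (u - S))\<^sup>2) * emeasure M A"
  proof -
    have m: "(\<lambda>\<omega>. ennreal ((norm (?Z j \<omega>))\<^sup>2)) \<in> borel_measurable M" for j
      using measurable_compose [OF Zm [of j], of "\<lambda>x. ennreal ((norm x)\<^sup>2)" borel] by simp
    have m2: "(\<lambda>\<omega>. \<Sum>j\<in>UNIV. ennreal ((norm (?Z j \<omega>))\<^sup>2)) \<in> borel_measurable M"
      by (intro borel_measurable_sum m)
    have "(\<integral>\<^sup>+\<omega>. ennreal (2 * (real CARD('n))) * (\<Sum>j\<in>UNIV. ennreal ((norm (?Z j \<omega>))\<^sup>2)) + ennreal (2 * (K * (u - S))\<^sup>2) * indicator A \<omega> \<partial>M)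
        = (\<integral>\<^sup>+\<omega>. ennreal (2 * (real CARD('n))) * (\<Sum>j\<in>UNIV. ennreal ((norm (?Z j \<omega>))\<^sup>2)) \<partial>M)
        + (\<integral>\<^sup>+\<omega>. ennreal (2 * (K * (u - S))\<^sup>2) * indicator A \<omega> \<partial>M)"
      using m2 by (intro nn_integral_add borel_measurable_times_ennreal) auto
    also have "(\<integral>\<^sup>+\<omega>. ennreal (2 * (real CARD('n))) * (\<Sum>j\<in>UNIV. ennreal ((norm (?Z j \<omega>))\<^sup>2)) \<partial>M)
        = ennreal (2 * (real CARD('n))) * (\<integral>\<^sup>+\<omega>. (\<Sum>j\<in>UNIV. ennreal ((norm (?Z j \<omega>))\<^sup>2)) \<partial>M)"
      by (rule nn_integral_cmult [OF m2])
    also have "(\<integral>\<^sup>+\<omega>. (\<Sum>j\<in>UNIV. ennreal ((norm (?Z j \<omega>))\<^sup>2)) \<partial>M) = (\<Sum>j\<in>UNIV. \<integral>\<^sup>+\<omega>. ennreal ((norm (?Z j \<omega>))\<^sup>2) \<partial>M)"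
      by (rule nn_integral_sum [OF m])
    also have "(\<integral>\<^sup>+\<omega>. ennreal (2 * (K * (u - S))\<^sup>2) * indicator A \<omega> \<partial>M) = ennreal (2 * (K * (u - S))\<^sup>2) * emeasure M A"
      by (rule nn_integral_cmult_indicator [OF AM])
    finally show ?thesis .
  qed
  also have "\<dots> \<le> ennreal (2 * (real CARD('n))) * (\<Sum>j\<in>(UNIV::'n set). 4 * (\<integral>\<^sup>+\<omega>. R \<omega> \<partial>M))
      + ennreal (2 * (K * (u - S))\<^sup>2) * emeasure M A"
  proof (intro add_mono mult_left_mono sum_mono order.refl)
    fix j
    have "(\<integral>\<^sup>+\<omega>. ennreal ((norm (?Z j \<omega>))\<^sup>2) \<partial>M) \<le> 4 * (\<integral>\<^sup>+\<omega>. (\<integral>\<^sup>+s.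
        ennreal ((norm ((indicator A \<omega> * indicator {S<..u} s) *\<^sub>R (\<sigma> j (X \<omega>) s - \<xi> j \<omega>)))\<^sup>2) \<partial>lborel) \<partial>M)"
      by (rule ito_increment_bound [OF ito S A \<xi>])
    also have "\<dots> \<le> 4 * (\<integral>\<^sup>+\<omega>. R \<omega> \<partial>M)"
      by (intro mult_left_mono nn_integral_mono R) auto
    finally show "(\<integral>\<^sup>+\<omega>. ennreal ((norm (?Z j \<omega>))\<^sup>2) \<partial>M) \<le> 4 * (\<integral>\<^sup>+\<omega>. R \<omega> \<partial>M)" .
  qed auto
  also have "ennreal (2 * (real CARD('n))) * (\<Sum>j\<in>(UNIV::'n set). 4 * (\<integral>\<^sup>+\<omega>. R \<omega> \<partial>M))
      = ennreal (8 * (real CARD('n))\<^sup>2) * (\<integral>\<^sup>+\<omega>. R \<omega> \<partial>M)"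
  proof -
    have "ennreal (8 * (real CARD('n))\<^sup>2) = ennreal (2 * (real CARD('n))) * (ennreal (real CARD('n)) * 4)"
      by (simp add: ennreal_mult' [symmetric] ennreal_numeral [symmetric] power2_eq_square del: ennreal_numeral)
    then show ?thesis by (simp add: mult.assoc ennreal_of_nat_eq_real_of_nat)
  qed
  finally show ?thesis .
qed

section \<open>Oscillation of the solution over a short interval\<close>

lemma osc_const_pos: "0 < osc_const CARD('n) K"
  unfolding osc_const_def using K_pos by (intro mult_pos_pos add_nonneg_pos) auto

text \<open>The factor \<open>prob A\<close> makes this a conditional moment bound in unconditional
  form, as the first-exit argument requires. The restriction to length at most 1 absorbs the
  quadratic drift term into the linear one.\<close>

lemma increment_second_moment:
  assumes S: "0 \<le> S" "S \<le> u" "u \<le> S + 1" and A: "A \<in> sets (F S)"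
  shows "(\<integral>\<^sup>+\<omega>. ennreal ((norm (indicator A \<omega> *\<^sub>R (X \<omega> u - X \<omega> S)))\<^sup>2) \<partial>M)
    \<le> ennreal (osc_const CARD('n) K * (u - S) * prob A)"
proof -
  have AM [measurable]: "A \<in> sets M" using A subalgebra_F [OF S(1)] by (auto simp: subalgebra_def)
  have R: "(\<integral>\<^sup>+s. ennreal ((norm ((indicator A \<omega> * indicator {S<..u} s) *\<^sub>R (\<sigma> j (X \<omega>) s - 0)))\<^sup>2) \<partial>lborel)
      \<le> ennreal (K\<^sup>2 * (u - S)) * indicator A \<omega>" if "\<omega> \<in> space M" for j \<omega>
  proof -
    have "ennreal ((norm ((indicator A \<omega> * indicator {S<..u} s) *\<^sub>R (\<sigma> j (X \<omega>) s - 0)))\<^sup>2)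
        \<le> (ennreal (K\<^sup>2) * indicator A \<omega>) * indicator {S<..u} s" for s
    proof (cases "s \<in> {S<..u} \<and> \<omega> \<in> A")
      case True
      then have "(norm (\<sigma> j (X \<omega>) s))\<^sup>2 \<le> K\<^sup>2"
        using \<sigma>_bound [OF X_cpaths [OF that], of s j] S by (intro power_mono) auto
      with True show ?thesis by (simp add: ennreal_leI)
    qed (auto simp: indicator_def)
    then have "(\<integral>\<^sup>+s. ennreal ((norm ((indicator A \<omega> * indicator {S<..u} s) *\<^sub>R (\<sigma> j (X \<omega>) s - 0)))\<^sup>2) \<partial>lborel)
        \<le> (\<integral>\<^sup>+s. (ennreal (K\<^sup>2) * indicator A \<omega>) * indicator {S<..u} s \<partial>lborel)"
      by (rule nn_integral_mono)
    also have "\<dots> = (ennreal (K\<^sup>2) * indicator A \<omega>) * ennreal (u - S)"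
      using S by (subst nn_integral_cmult_indicator) auto
    also have "\<dots> = ennreal (K\<^sup>2 * (u - S)) * indicator A \<omega>"
      using S by (simp add: ennreal_mult ac_simps)
    finally show ?thesis .
  qed
  have "(\<integral>\<^sup>+\<omega>. ennreal ((norm (indicator A \<omega> *\<^sub>R (X \<omega> u - X \<omega> S)))\<^sup>2) \<partial>M)
     \<le> ennreal (8 * (real CARD('n))\<^sup>2) * (\<integral>\<^sup>+\<omega>. ennreal (K\<^sup>2 * (u - S)) * indicator A \<omega> \<partial>M)
       + ennreal (2 * (K * (u - S))\<^sup>2) * emeasure M A"
  proof -
    have "bounded ((\<lambda>_. 0 :: real^'d) ` space M)" by (auto simp: bounded_iff)
    then show ?thesis
      using increment_bound [OF S(1,2) A, of "\<lambda>_ _. 0" "\<lambda>\<omega>. ennreal (K\<^sup>2 * (u - S)) * indicator A \<omega>", OF _ _ R]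
      by simp
  qed
  also have "(\<integral>\<^sup>+\<omega>. ennreal (K\<^sup>2 * (u - S)) * indicator A \<omega> \<partial>M) = ennreal (K\<^sup>2 * (u - S)) * emeasure M A"
    by (rule nn_integral_cmult_indicator [OF AM])
  also have "ennreal (8 * (real CARD('n))\<^sup>2) * (ennreal (K\<^sup>2 * (u - S)) * emeasure M A) + ennreal (2 * (K * (u - S))\<^sup>2) * emeasure M A
      = ennreal (8 * (real CARD('n))\<^sup>2 * (K\<^sup>2 * (u - S)) * prob A + 2 * (K * (u - S))\<^sup>2 * prob A)"
    using S by (simp add: emeasure_eq_measure ennreal_mult ennreal_plus mult.assoc)
  also have "\<dots> \<le> ennreal (osc_const CARD('n) K * (u - S) * prob A)"
  proof (rule ennreal_leI)
    have "(u - S)\<^sup>2 \<le> u - S" using S mult_left_mono [of "u - S" 1 "u - S"] by (simp add: power2_eq_square)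
    then have "2 * K\<^sup>2 * (u - S)\<^sup>2 * prob A \<le> 2 * K\<^sup>2 * (u - S) * prob A"
      by (intro mult_right_mono mult_left_mono) auto
    then show "8 * (real CARD('n))\<^sup>2 * (K\<^sup>2 * (u - S)) * prob A + 2 * (K * (u - S))\<^sup>2 * prob A \<le> osc_const CARD('n) K * (u - S) * prob A"
    proof -
      have "osc_const CARD('n) K * (u - S) * prob A
          = 8 * (real CARD('n))\<^sup>2 * (K\<^sup>2 * (u - S)) * prob A + 2 * K\<^sup>2 * (u - S) * prob A"
        by (simp add: osc_const_def algebra_simps)
      moreover have "2 * (K * (u - S))\<^sup>2 * prob A = 2 * K\<^sup>2 * (u - S)\<^sup>2 * prob A"
        by (simp add: power_mult_distrib)
      ultimately show ?thesis using \<open>2 * K\<^sup>2 * (u - S)\<^sup>2 * prob A \<le> 2 * K\<^sup>2 * (u - S) * prob A\<close> by linarith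
    qed
  qed
  finally show ?thesis .
qed

lemma increment_tail:
  assumes S: "0 \<le> S" "S \<le> u" "u \<le> S + 1" and A: "A \<in> sets (F S)" and \<eta>: "0 < \<eta>"
  shows "prob (A \<inter> {\<omega>\<in>space M. \<eta> \<le> norm (X \<omega> u - X \<omega> S)}) \<le> osc_const CARD('n) K * (u - S) / \<eta>\<^sup>2 * prob A"
proof -
  have AM [measurable]: "A \<in> sets M" using A subalgebra_F [OF S(1)] by (auto simp: subalgebra_def)
  have u: "0 \<le> u" using S by simp
  have m [measurable]: "{\<omega>\<in>space M. \<eta> \<le> norm (X \<omega> u - X \<omega> S)} \<in> sets M"
    using X_measurable_M [OF u] X_measurable_M [OF S(1)] by measurable
  let ?B = "A \<inter> {\<omega>\<in>space M. \<eta> \<le> norm (X \<omega> u - X \<omega> S)}"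
  have "ennreal (\<eta>\<^sup>2) * emeasure M ?B = (\<integral>\<^sup>+\<omega>. ennreal (\<eta>\<^sup>2) * indicator ?B \<omega> \<partial>M)"
    by (rule nn_integral_cmult_indicator [symmetric]) measurable
  also have "\<dots> \<le> (\<integral>\<^sup>+\<omega>. ennreal ((norm (indicator A \<omega> *\<^sub>R (X \<omega> u - X \<omega> S)))\<^sup>2) \<partial>M)"
  proof (rule nn_integral_mono)
    fix \<omega>
    show "ennreal (\<eta>\<^sup>2) * indicator ?B \<omega> \<le> ennreal ((norm (indicator A \<omega> *\<^sub>R (X \<omega> u - X \<omega> S)))\<^sup>2)"
      using \<eta> by (cases "\<omega> \<in> ?B") (auto intro!: ennreal_leI power_mono)
  qed
  also have "\<dots> \<le> ennreal (osc_const CARD('n) K * (u - S) * prob A)" by (rule increment_second_moment [OF S A])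
  finally have "\<eta>\<^sup>2 * prob ?B \<le> osc_const CARD('n) K * (u - S) * prob A"
    using S osc_const_pos by (simp add: emeasure_eq_measure ennreal_mult' [symmetric])
  then show ?thesis using \<eta> by (simp add: field_simps)
qed

text \<open>Ottaviani's inequality: Doob's inequality is replaced by a conditional Chebyshev bound for the
  increment after the first time the path leaves the ball of radius \<open>2 \<eta>\<close>.\<close>

lemma maximal_inequality:
  fixes t :: "nat \<Rightarrow> real"
  assumes S: "0 \<le> S" "S \<le> u" "u \<le> S + 1" and \<eta>: "0 < \<eta>"
    and t: "\<And>i. i < n \<Longrightarrow> S \<le> t i \<and> t i \<le> u" "\<And>i k. i \<le> k \<Longrightarrow> k < n \<Longrightarrow> t i \<le> t k"
  shows "prob {\<omega>\<in>space M. \<exists>i<n. 2 * \<eta> \<le> norm (X \<omega> (t i) - X \<omega> S)} \<le> 2 * (osc_const CARD('n) K * (u - S) / \<eta>\<^sup>2)"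
proof (cases "osc_const CARD('n) K * (u - S) / \<eta>\<^sup>2 \<le> 1 / 2")
  \<comment> \<open>Here the right-hand side exceeds 1.\<close>
  case False
  then show ?thesis using prob_le_1 [of "{\<omega>\<in>space M. \<exists>i<n. 2 * \<eta> \<le> norm (X \<omega> (t i) - X \<omega> S)}"] by linarith
next
  case True
  \<comment> \<open>\<open>A i\<close> is the event that the path on the grid first leaves the ball
    at index \<open>i\<close>; \<open>B i\<close> is the event that it moves by at least \<eta>
    between that time and \<open>u\<close>.\<close>
  define A where "A i = {\<omega>\<in>space M. 2 * \<eta> \<le> norm (X \<omega> (t i) - X \<omega> S) \<and> (\<forall>k<i. norm (X \<omega> (t k) - X \<omega> S) < 2 * \<eta>)}" for i
  define B where "B i = {\<omega>\<in>space M. \<eta> \<le> norm (X \<omega> u - X \<omega> (t i))}" for i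
  let ?E = "{\<omega>\<in>space M. \<eta> \<le> norm (X \<omega> u - X \<omega> S)}"
  have u: "0 \<le> u" using S by simp
  have t0: "0 \<le> t i" if "i < n" for i using t(1) [OF that] S by simp
  have AF: "A i \<in> sets (F (t i))" if i: "i < n" for i
  proof -
    have [measurable]: "(\<lambda>\<omega>. X \<omega> (t i)) \<in> borel_measurable (F (t i))"
      using i by (intro X_measurable t0) auto
    have [measurable]: "(\<lambda>\<omega>. X \<omega> S) \<in> borel_measurable (F (t i))"
      using S t(1) [OF i] by (intro X_measurable) auto
    have 1: "{\<omega>\<in>space (F (t i)). 2 * \<eta> \<le> norm (X \<omega> (t i) - X \<omega> S)} \<in> sets (F (t i))"
      by measurable
    have 2: "{\<omega>\<in>space (F (t i)). norm (X \<omega> (t k) - X \<omega> S) < 2 * \<eta>} \<in> sets (F (t i))" if "k < i" for k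
    proof -
      have [measurable]: "(\<lambda>\<omega>. X \<omega> (t k)) \<in> borel_measurable (F (t i))"
      proof -
        have "k < n" "k \<le> i" using that i by simp_all
        then show ?thesis using i by (intro X_measurable t0 t(2)) auto
      qed
      show ?thesis by measurable
    qed
    have "{\<omega>\<in>space (F (t i)). \<forall>k\<in>{..<i}. norm (X \<omega> (t k) - X \<omega> S) < 2 * \<eta>} \<in> sets (F (t i))"
      using 2 by (intro sets.sets_Collect_finite_All) auto
    with 1 have "{\<omega>\<in>space (F (t i)). 2 * \<eta> \<le> norm (X \<omega> (t i) - X \<omega> S)} \<inter>
        {\<omega>\<in>space (F (t i)). \<forall>k\<in>{..<i}. norm (X \<omega> (t k) - X \<omega> S) < 2 * \<eta>} \<in> sets (F (t i))"
      by (rule sets.Int)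
    moreover have "{\<omega>\<in>space (F (t i)). 2 * \<eta> \<le> norm (X \<omega> (t i) - X \<omega> S)} \<inter>
        {\<omega>\<in>space (F (t i)). \<forall>k\<in>{..<i}. norm (X \<omega> (t k) - X \<omega> S) < 2 * \<eta>} = A i"
      using space_F [OF t0 [OF i]] by (auto simp: A_def)
    ultimately show ?thesis by simp
  qed
  have AM: "A i \<in> sets M" if "i < n" for i
    using AF [OF that] subalgebra_F [OF t0 [OF that]] by (auto simp: subalgebra_def)
  have BM: "B i \<in> sets M" if "i < n" for i
    using X_measurable_M [OF u] X_measurable_M [OF t0 [OF that]] unfolding B_def by measurable
  have EM: "?E \<in> sets M" using X_measurable_M [OF u] X_measurable_M [OF S(1)] by measurable
  have disj: "disjoint_family_on A {..<n}"
    unfolding disjoint_family_on_def A_def by (auto simp: neq_iff)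
  then have disj': "disjoint_family_on (\<lambda>i. A i - B i) {..<n}"
    unfolding disjoint_family_on_def by blast
  \<comment> \<open>\<open>A i\<close> is known at time \<open>t i\<close>, so given
    \<open>A i\<close> a move of size \<eta> afterwards has probability at most 1/2. At least half
    of \<open>A i\<close> therefore lies outside \<open>B i\<close>.\<close>
  have half: "prob (A i) \<le> 2 * prob (A i - B i)" if i: "i < n" for i
  proof -
    have "prob (A i \<inter> B i) \<le> osc_const CARD('n) K * (u - t i) / \<eta>\<^sup>2 * prob (A i)"
      unfolding B_def using t(1) [OF i] S \<eta> by (intro increment_tail t0 i AF) auto
    also have "\<dots> \<le> 1 / 2 * prob (A i)"
    proof (rule mult_right_mono)
      have "osc_const CARD('n) K * (u - t i) / \<eta>\<^sup>2 \<le> osc_const CARD('n) K * (u - S) / \<eta>\<^sup>2"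
        using t(1) [OF i] osc_const_pos by (intro divide_right_mono mult_left_mono) auto
      with True show "osc_const CARD('n) K * (u - t i) / \<eta>\<^sup>2 \<le> 1 / 2" by linarith
    qed simp
    finally show ?thesis
      using finite_measure_Diff' [OF AM [OF i] BM [OF i]] by simp
  qed
  have "{\<omega>\<in>space M. \<exists>i<n. 2 * \<eta> \<le> norm (X \<omega> (t i) - X \<omega> S)} \<subseteq> (\<Union>i\<in>{..<n}. A i)"
  proof
    fix \<omega> assume w: "\<omega> \<in> {\<omega>\<in>space M. \<exists>i<n. 2 * \<eta> \<le> norm (X \<omega> (t i) - X \<omega> S)}"
    then obtain i where "i < n" "2 * \<eta> \<le> norm (X \<omega> (t i) - X \<omega> S)" by auto
    define i0 where "i0 = (LEAST i. 2 * \<eta> \<le> norm (X \<omega> (t i) - X \<omega> S))"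
    have "2 * \<eta> \<le> norm (X \<omega> (t i0) - X \<omega> S)" "i0 \<le> i"
      unfolding i0_def using \<open>2 * \<eta> \<le> norm (X \<omega> (t i) - X \<omega> S)\<close>
      by (rule LeastI [where P = "\<lambda>i. 2 * \<eta> \<le> norm (X \<omega> (t i) - X \<omega> S)"],
          rule Least_le [where P = "\<lambda>i. 2 * \<eta> \<le> norm (X \<omega> (t i) - X \<omega> S)"])
    moreover have "\<forall>k<i0. norm (X \<omega> (t k) - X \<omega> S) < 2 * \<eta>"
      unfolding i0_def by (auto dest!: not_less_Least)
    ultimately show "\<omega> \<in> (\<Union>i\<in>{..<n}. A i)" using w \<open>i < n\<close> by (auto simp: A_def)
  qed
  then have "prob {\<omega>\<in>space M. \<exists>i<n. 2 * \<eta> \<le> norm (X \<omega> (t i) - X \<omega> S)} \<le> prob (\<Union>i\<in>{..<n}. A i)"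
    using AM by (intro finite_measure_mono) auto
  also have "\<dots> = (\<Sum>i<n. prob (A i))"
    using AM disj by (intro finite_measure_finite_Union) auto
  also have "\<dots> \<le> (\<Sum>i<n. 2 * prob (A i - B i))" using half by (intro sum_mono) auto
  also have "\<dots> = 2 * prob (\<Union>i\<in>{..<n}. A i - B i)"
    unfolding sum_distrib_left [symmetric] using AM BM disj'
    by (subst finite_measure_finite_Union) auto
  \<comment> \<open>A path that has left the ball of radius \<open>2 \<eta>\<close> and ends less
    than \<eta> from its exit point is still at distance at least \<eta> from its start, so one
    Chebyshev bound at the endpoint finishes.\<close>
  also have "\<dots> \<le> 2 * prob ?E"
  proof (intro mult_left_mono finite_measure_mono EM subsetI)
    fix \<omega> assume "\<omega> \<in> (\<Union>i\<in>{..<n}. A i - B i)"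
    then obtain i where "\<omega> \<in> space M" "2 * \<eta> \<le> norm (X \<omega> (t i) - X \<omega> S)" "norm (X \<omega> u - X \<omega> (t i)) < \<eta>"
      by (auto simp: A_def B_def)
    moreover have "norm (X \<omega> (t i) - X \<omega> S) \<le> norm (X \<omega> u - X \<omega> (t i)) + norm (X \<omega> u - X \<omega> S)"
      by (metis add.commute norm_minus_commute norm_triangle_sub diff_add_cancel add_diff_eq norm_triangle_ineq diff_diff_eq2)
    ultimately show "\<omega> \<in> ?E" by simp
  qed simp
  also have "prob ?E = prob (space M \<inter> ?E)" by (intro arg_cong [where f = prob]) auto
  also have "prob (space M \<inter> ?E) \<le> osc_const CARD('n) K * (u - S) / \<eta>\<^sup>2 * prob (space M)"
    using S \<eta> by (intro increment_tail) (auto simp: space_F [symmetric])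
  finally show ?thesis by (simp add: prob_space)
qed

text \<open>The maximal inequality on dyadic grids passes to the whole interval: the grids are
  nested, so the exceptional events increase to a union with the same bound, and continuity of the
  paths fills in the other times. Delivering a measurable set \<open>G\<close> avoids any claim
  about measurability of the oscillation.\<close>

lemma osc_tail:
  assumes S: "0 \<le> S" "S < u" "u \<le> S + 1" and \<eta>: "0 < \<eta>"
  obtains G where "G \<in> sets M" "prob G \<le> 2 * (osc_const CARD('n) K * (u - S) / \<eta>\<^sup>2)"
    "\<And>\<omega>. \<omega> \<in> space M - G \<Longrightarrow> osc S u (X \<omega>) \<le> 2 * \<eta>"
proof -
  define t where "t m i = S + real i * (u - S) / 2 ^ m" for m i :: nat
  define G where "G m = {\<omega>\<in>space M. \<exists>i<Suc (2 ^ m). 2 * \<eta> \<le> norm (X \<omega> (t m i) - X \<omega> S)}" for m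
  have t1: "S \<le> t m i \<and> t m i \<le> u" if "i < Suc (2 ^ m)" for m i
  proof -
    have "real i \<le> real (2 ^ m)" using that by (intro of_nat_mono) simp
    then have "real i * (u - S) \<le> 2 ^ m * (u - S)" using S by (intro mult_right_mono) auto
    then have "real i * (u - S) / 2 ^ m \<le> u - S" by (simp add: field_simps)
    then show ?thesis using S unfolding t_def by simp
  qed
  have t2: "t m i \<le> t m k" if "i \<le> k" for m i k
    unfolding t_def using S that by (intro add_left_mono divide_right_mono mult_right_mono) auto
  have GM: "G m \<in> sets M" for m
  proof -
    have "{\<omega>\<in>space M. 2 * \<eta> \<le> norm (X \<omega> (t m i) - X \<omega> S)} \<in> sets M" if "i < Suc (2 ^ m)" for i
    proof -
      have "0 \<le> t m i" using t1 [OF that] S by simp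
      then show ?thesis using X_measurable_M [of "t m i"] X_measurable_M [OF S(1)] by measurable
    qed
    then have "(\<Union>i\<in>{..<Suc (2 ^ m)}. {\<omega>\<in>space M. 2 * \<eta> \<le> norm (X \<omega> (t m i) - X \<omega> S)}) \<in> sets M"
      by (intro sets.finite_UN) auto
    moreover have "(\<Union>i\<in>{..<Suc (2 ^ m)}. {\<omega>\<in>space M. 2 * \<eta> \<le> norm (X \<omega> (t m i) - X \<omega> S)}) = G m"
      unfolding G_def by auto
    ultimately show ?thesis by simp
  qed
  have inc: "incseq G"
  proof (rule incseq_SucI, rule subsetI)
    fix m \<omega> assume "\<omega> \<in> G m"
    then obtain i where i: "i < Suc (2 ^ m)" "\<omega> \<in> space M" "2 * \<eta> \<le> norm (X \<omega> (t m i) - X \<omega> S)"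
      unfolding G_def by blast
    have "t m i = t (Suc m) (2 * i)" by (simp add: t_def)
    with i show "\<omega> \<in> G (Suc m)" unfolding G_def by (auto intro!: exI [of _ "2 * i"])
  qed
  have "(\<lambda>m. prob (G m)) \<longlonglongrightarrow> prob (\<Union>m. G m)"
    using GM inc by (intro finite_Lim_measure_incseq) auto
  moreover have "prob (G m) \<le> 2 * (osc_const CARD('n) K * (u - S) / \<eta>\<^sup>2)" for m
    unfolding G_def using S \<eta> t1 t2 by (intro maximal_inequality) auto
  ultimately have P: "prob (\<Union>m. G m) \<le> 2 * (osc_const CARD('n) K * (u - S) / \<eta>\<^sup>2)"
    by (intro LIMSEQ_le_const2) auto
  have "osc S u (X \<omega>) \<le> 2 * \<eta>" if w: "\<omega> \<in> space M - (\<Union>m. G m)" for \<omega>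
  proof (rule osc_le)
    fix s assume s: "S \<le> s" "s \<le> u"
    define r where "r = (s - S) / (u - S)"
    have r: "0 \<le> r" "r \<le> 1" using s S by (auto simp: r_def)
    \<comment> \<open>Index of the left dyadic neighbour of \<open>s\<close>. The endpoint
      \<open>s = u\<close> has index \<open>2 ^ m\<close>, hence the range
      \<open>Suc (2 ^ m)\<close> of the grid.\<close>
    define i where "i m = nat \<lfloor>r * 2 ^ m\<rfloor>" for m
    have i: "real (i m) \<le> r * 2 ^ m" "r * 2 ^ m < real (i m) + 1" for m
      unfolding i_def using r by (auto simp: of_nat_nat)
    have im: "i m < Suc (2 ^ m)" for m
    proof -
      have "r * 2 ^ m \<le> 1 * 2 ^ m" using r by (intro mult_right_mono) auto
      then have "real (i m) \<le> real (2 ^ m)"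
        using i(1) [of m] unfolding of_nat_power of_nat_numeral by linarith
      then show ?thesis by (simp only: of_nat_le_iff less_Suc_eq_le)
    qed
    have small: "norm (X \<omega> (t m (i m)) - X \<omega> S) \<le> 2 * \<eta>" for m
      using w im [of m] unfolding G_def by (force simp: not_le)
    have "(\<lambda>m. (u - S) / 2 ^ m) \<longlonglongrightarrow> 0"
      using tendsto_mult_right_zero [OF LIMSEQ_realpow_zero [of "1 / 2 :: real"], of "u - S"]
      by (simp add: power_divide)
    moreover have "\<bar>t m (i m) - s\<bar> \<le> (u - S) / 2 ^ m" for m
    proof -
      define c where "c = (u - S) / 2 ^ m"
      have "s = S + r * 2 ^ m * c" "t m (i m) = S + real (i m) * c"
        using S by (simp_all add: r_def c_def t_def)
      then have "t m (i m) - s = (real (i m) - r * 2 ^ m) * ((u - S) / 2 ^ m)"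
        unfolding c_def [symmetric] by (simp add: algebra_simps)
      then have "\<bar>t m (i m) - s\<bar> = \<bar>real (i m) - r * 2 ^ m\<bar> * ((u - S) / 2 ^ m)"
        using S by (simp add: abs_mult)
      also have "\<dots> \<le> 1 * ((u - S) / 2 ^ m)"
        using i [of m] S by (intro mult_right_mono) auto
      finally show ?thesis by simp
    qed
    ultimately have "(\<lambda>m. t m (i m) - s) \<longlonglongrightarrow> 0"
      by (intro Lim_null_comparison [of "\<lambda>m. t m (i m) - s" "\<lambda>m. (u - S) / 2 ^ m"]) auto
    then have lim: "(\<lambda>m. t m (i m)) \<longlonglongrightarrow> s" by (rule LIM_zero_cancel)
    have cont: "continuous_on {0..} (X \<omega>)" using X_cpaths w by (auto simp: cpaths_def)
    have "t m (i m) \<in> {0..}" for m using t1 [OF im, of m] S by simp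
    then have "(\<lambda>m. X \<omega> (t m (i m))) \<longlonglongrightarrow> X \<omega> s"
      using s S by (intro continuous_on_tendsto_compose [OF cont lim]) auto
    then have "(\<lambda>m. norm (X \<omega> (t m (i m)) - X \<omega> S)) \<longlonglongrightarrow> norm (X \<omega> s - X \<omega> S)"
      by (intro tendsto_intros)
    then show "norm (X \<omega> s - X \<omega> S) \<le> 2 * \<eta>"
      by (rule LIMSEQ_le_const2) (use small in auto)
  qed (use S in simp)
  with P show thesis using GM by (intro that [of "\<Union>m. G m"]) auto
qed

end

section \<open>Freezing the coefficients at the start of an interval\<close>

locale log_sde = sde M F W X \<sigma> b J K
  for M :: "'a measure" and F and W :: "'a \<Rightarrow> real \<Rightarrow> real^'n"
    and X :: "'a \<Rightarrow> real \<Rightarrow> real^'d" and \<sigma> b J K +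
  fixes \<epsilon> C l :: real
  assumes \<epsilon>_pos: "0 < \<epsilon>" and C_pos: "0 < C" and l_pos: "0 < l"
    and regular: "\<And>j s t w. 0 \<le> s \<Longrightarrow> s \<le> t \<Longrightarrow> w \<in> cpaths \<Longrightarrow> osc s t w < 1 \<Longrightarrow>
           norm (\<sigma> j w t - \<sigma> j w s) \<le> C * log_modulus \<epsilon> (osc s t w)"
    and elliptic: "\<And>t w x. 0 \<le> t \<Longrightarrow> w \<in> cpaths \<Longrightarrow>
      l * (norm x)\<^sup>2 \<le> x \<bullet> ((coeff_matrix \<sigma> t w ** transpose (coeff_matrix \<sigma> t w)) *v x)"
begin

text \<open>One Euler step from time \<open>S\<close> with the drift left out, whose contribution is
  of the order of the length \<open>u - S\<close> and hence smaller than the diffusion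
  error.\<close>

definition frozen :: "real \<Rightarrow> real \<Rightarrow> 'a \<Rightarrow> real^'d" where
  "frozen S u \<omega> = X \<omega> S + (\<Sum>j\<in>UNIV. dW j S u \<omega> *\<^sub>R \<sigma> j (X \<omega>) S)"

lemma frozen_measurable: "0 \<le> S \<Longrightarrow> S \<le> u \<Longrightarrow> frozen S u \<in> borel_measurable M"
  unfolding frozen_def [abs_def]
  by (intro borel_measurable_add borel_measurable_sum borel_measurable_scaleR
      X_measurable_M dW_measurable_M \<sigma>_measurable_M) auto

text \<open>Off the exceptional set the oscillation is at most \<open>2 \<eta>\<close> and the
  modulus of continuity applies; on it the coefficients differ by at most \<open>2 K\<close>,
  weighted with a small probability. The threshold \<eta> is left free because it trades one term
  against the other.\<close>

lemma frozen_error_square: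
  assumes S: "0 \<le> S" "S < u" "u \<le> S + 1" and \<eta>: "0 < \<eta>" "2 * \<eta> < 1"
  shows "(\<integral>\<^sup>+\<omega>. ennreal ((norm (X \<omega> u - frozen S u \<omega>))\<^sup>2) \<partial>M)
    \<le> ennreal ((u - S) * (8 * (real CARD('n))\<^sup>2 * ((C * log_modulus \<epsilon> (2 * \<eta>))\<^sup>2
         + 8 * K\<^sup>2 * (osc_const CARD('n) K * (u - S) / \<eta>\<^sup>2)) + 2 * K\<^sup>2 * (u - S)))"
proof -
  obtain G where G [measurable]: "G \<in> sets M" and PG: "prob G \<le> 2 * (osc_const CARD('n) K * (u - S) / \<eta>\<^sup>2)"
    and oG: "\<And>\<omega>. \<omega> \<in> space M - G \<Longrightarrow> osc S u (X \<omega>) \<le> 2 * \<eta>"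
    using osc_tail [OF S \<eta>(1)] by blast
  let ?L = "(C * log_modulus \<epsilon> (2 * \<eta>))\<^sup>2"
  let ?R = "\<lambda>\<omega>. ennreal ((u - S) * ?L) + ennreal ((u - S) * (2 * K)\<^sup>2) * indicator G \<omega>"
  have SM: "space M \<in> sets (F S)" using space_F [OF S(1)] by (metis sets.top)
  have R: "(\<integral>\<^sup>+s. ennreal ((norm ((indicator (space M) \<omega> * indicator {S<..u} s) *\<^sub>R (\<sigma> j (X \<omega>) s - \<sigma> j (X \<omega>) S)))\<^sup>2) \<partial>lborel) \<le> ?R \<omega>"
    if w: "\<omega> \<in> space M" for j \<omega>
  proof -
    define v where "v = (if \<omega> \<in> G then (2 * K)\<^sup>2 else ?L)"
    have v: "(norm (\<sigma> j (X \<omega>) s - \<sigma> j (X \<omega>) S))\<^sup>2 \<le> v" if s: "s \<in> {S<..u}" for s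
    proof (cases "\<omega> \<in> G")
      case True
      have "norm (\<sigma> j (X \<omega>) s - \<sigma> j (X \<omega>) S) \<le> K + K"
        using s S X_cpaths [OF w] by (intro order.trans [OF norm_triangle_ineq4] add_mono \<sigma>_bound) auto
      then have "(norm (\<sigma> j (X \<omega>) s - \<sigma> j (X \<omega>) S))\<^sup>2 \<le> (2 * K)\<^sup>2" by (intro power_mono) auto
      then show ?thesis unfolding v_def using True by simp
    next
      case False
      have "osc S s (X \<omega>) \<le> osc S u (X \<omega>)" "0 \<le> osc S s (X \<omega>)"
        using osc_nonneg_mono [OF X_cpaths [OF w] S(1), of s u] s by auto
      then have o: "0 \<le> osc S s (X \<omega>)" "osc S s (X \<omega>) \<le> 2 * \<eta>" using oG [of \<omega>] False w by auto
      have "norm (\<sigma> j (X \<omega>) s - \<sigma> j (X \<omega>) S) \<le> C * log_modulus \<epsilon> (osc S s (X \<omega>))"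
        using s S o \<eta> X_cpaths [OF w] by (intro regular) auto
      also have "\<dots> \<le> C * log_modulus \<epsilon> (2 * \<eta>)"
        using o \<eta> C_pos \<epsilon>_pos by (intro mult_left_mono log_modulus_mono) auto
      finally show ?thesis unfolding v_def using False by (simp add: power_mono)
    qed
    have v0: "0 \<le> v" by (simp add: v_def)
    have "(\<integral>\<^sup>+s. ennreal ((norm ((indicator (space M) \<omega> * indicator {S<..u} s) *\<^sub>R (\<sigma> j (X \<omega>) s - \<sigma> j (X \<omega>) S)))\<^sup>2) \<partial>lborel)
        \<le> (\<integral>\<^sup>+s. ennreal v * indicator {S<..u} s \<partial>lborel)"
    proof (rule nn_integral_mono)
      fix s
      show "ennreal ((norm ((indicator (space M) \<omega> * indicator {S<..u} s) *\<^sub>R (\<sigma> j (X \<omega>) s - \<sigma> j (X \<omega>) S)))\<^sup>2)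
          \<le> ennreal v * indicator {S<..u} s"
        using v [of s] w by (cases "s \<in> {S<..u}") (auto intro!: ennreal_leI)
    qed
    also have "\<dots> = ennreal v * ennreal (u - S)"
      using S by (subst nn_integral_cmult_indicator) auto
    also have "\<dots> \<le> ?R \<omega>"
      using S v0 by (auto simp: v_def ennreal_mult' [symmetric] mult.commute)
    finally show ?thesis .
  qed
  have Rm: "?R \<in> borel_measurable M" by measurable
  have \<sigma>S: "(\<lambda>\<omega>. \<sigma> j (X \<omega>) S) \<in> borel_measurable (F S)" "bounded ((\<lambda>\<omega>. \<sigma> j (X \<omega>) S) ` space M)" for j
    using \<sigma>_measurable [OF S(1), of S j] \<sigma>_bounded [OF S(1)] by auto
  have "(\<integral>\<^sup>+\<omega>. ennreal ((norm (X \<omega> u - frozen S u \<omega>))\<^sup>2) \<partial>M)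
      = (\<integral>\<^sup>+\<omega>. ennreal ((norm (indicator (space M) \<omega> *\<^sub>R (X \<omega> u - X \<omega> S - (\<Sum>j\<in>UNIV. dW j S u \<omega> *\<^sub>R \<sigma> j (X \<omega>) S))))\<^sup>2) \<partial>M)"
    by (intro nn_integral_cong) (simp add: frozen_def diff_diff_eq)
  also have "\<dots> \<le> ennreal (8 * (real CARD('n))\<^sup>2) * (\<integral>\<^sup>+\<omega>. ?R \<omega> \<partial>M) + ennreal (2 * (K * (u - S))\<^sup>2) * emeasure M (space M)"
    using S by (intro increment_bound SM \<sigma>S R Rm) auto
  also have "(\<integral>\<^sup>+\<omega>. ?R \<omega> \<partial>M) = ennreal ((u - S) * ?L + (u - S) * (2 * K)\<^sup>2 * prob G)"
    using S by (subst nn_integral_add) (auto simp: nn_integral_cmult_indicator emeasure_eq_measure prob_space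
        ennreal_mult' [symmetric] ennreal_plus [symmetric] simp del: ennreal_plus)
  also have "ennreal (8 * (real CARD('n))\<^sup>2) * ennreal ((u - S) * ?L + (u - S) * (2 * K)\<^sup>2 * prob G)
       + ennreal (2 * (K * (u - S))\<^sup>2) * emeasure M (space M)
      = ennreal (8 * (real CARD('n))\<^sup>2 * ((u - S) * ?L + (u - S) * (2 * K)\<^sup>2 * prob G) + 2 * (K * (u - S))\<^sup>2)"
    using S by (simp add: emeasure_space_1 ennreal_mult' [symmetric] ennreal_plus [symmetric] del: ennreal_plus)
  also have "\<dots> \<le> ennreal ((u - S) * (8 * (real CARD('n))\<^sup>2 * (?L
         + 8 * K\<^sup>2 * (osc_const CARD('n) K * (u - S) / \<eta>\<^sup>2)) + 2 * K\<^sup>2 * (u - S)))"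
  proof (rule ennreal_leI)
    have "(2 * K)\<^sup>2 * prob G \<le> (2 * K)\<^sup>2 * (2 * (osc_const CARD('n) K * (u - S) / \<eta>\<^sup>2))"
      by (intro mult_left_mono PG) auto
    also have "\<dots> = 8 * K\<^sup>2 * (osc_const CARD('n) K * (u - S) / \<eta>\<^sup>2)" by (simp add: power_mult_distrib)
    finally have "8 * (real CARD('n))\<^sup>2 * ((u - S) * (?L + (2 * K)\<^sup>2 * prob G))
        \<le> 8 * (real CARD('n))\<^sup>2 * ((u - S) * (?L + 8 * K\<^sup>2 * (osc_const CARD('n) K * (u - S) / \<eta>\<^sup>2)))"
      using S by (intro mult_left_mono add_left_mono) auto
    then show "8 * (real CARD('n))\<^sup>2 * ((u - S) * ?L + (u - S) * (2 * K)\<^sup>2 * prob G) + 2 * (K * (u - S))\<^sup>2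
        \<le> (u - S) * (8 * (real CARD('n))\<^sup>2 * (?L
         + 8 * K\<^sup>2 * (osc_const CARD('n) K * (u - S) / \<eta>\<^sup>2)) + 2 * K\<^sup>2 * (u - S))"
    proof -
      assume le: "8 * (real CARD('n))\<^sup>2 * ((u - S) * (?L + (2 * K)\<^sup>2 * prob G))
        \<le> 8 * (real CARD('n))\<^sup>2 * ((u - S) * (?L + 8 * K\<^sup>2 * (osc_const CARD('n) K * (u - S) / \<eta>\<^sup>2)))"
      have gen: "N * (d * x) + 2 * (K * d)\<^sup>2 = d * (N * x + 2 * K\<^sup>2 * d)" for N d x :: real
        by (simp add: power2_eq_square algebra_simps)
      have "(u - S) * ?L + (u - S) * (2 * K)\<^sup>2 * prob G = (u - S) * (?L + (2 * K)\<^sup>2 * prob G)"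
        by (simp only: distrib_left mult.assoc)
      with le show ?thesis unfolding gen [symmetric] by simp
    qed
  qed
  finally show ?thesis .
qed

lemma frozen_lipschitz_error:
  assumes S: "0 \<le> S" "S < u" and E: "(\<integral>\<^sup>+\<omega>. ennreal ((norm (X \<omega> u - frozen S u \<omega>))\<^sup>2) \<partial>M) \<le> ennreal (e\<^sup>2)"
    and e: "0 \<le> e" and \<phi>: "bmf \<phi>" and L: "\<And>x y. \<bar>\<phi> x - \<phi> y\<bar> \<le> L * norm (x - y)" and L0: "0 \<le> L"
  shows "\<bar>expectation (\<lambda>\<omega>. \<phi> (X \<omega> u)) - expectation (\<lambda>\<omega>. \<phi> (frozen S u \<omega>))\<bar> \<le> L * e"
proof -
  have u: "0 \<le> u" using S by simp
  have [measurable]: "frozen S u \<in> borel_measurable M" "(\<lambda>\<omega>. X \<omega> u) \<in> borel_measurable M"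
    using frozen_measurable S X_measurable_M [OF u] by auto
  let ?Y = "\<lambda>\<omega>. norm (X \<omega> u - frozen S u \<omega>)"
  have Ym: "?Y \<in> borel_measurable M" by measurable
  have i2: "integrable M (\<lambda>\<omega>. (?Y \<omega>)\<^sup>2)"
    by (rule integrableI_bounded) (use E in \<open>auto simp: ennreal_power [symmetric] intro: le_less_trans\<close>)
  have "ennreal (expectation (\<lambda>\<omega>. (?Y \<omega>)\<^sup>2)) \<le> ennreal (e\<^sup>2)"
    using E by (subst nn_integral_eq_integral [symmetric, OF i2]) auto
  then have "sqrt (expectation (\<lambda>\<omega>. (?Y \<omega>)\<^sup>2)) \<le> e"
    using e by (intro real_le_lsqrt) (auto simp: ennreal_le_iff)
  then have EY: "expectation (\<lambda>\<omega>. \<bar>?Y \<omega>\<bar>) \<le> e"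
    using expectation_abs_le_sqrt(2) [OF Ym i2] by simp
  have iY: "integrable M ?Y" by (rule expectation_abs_le_sqrt(1) [OF Ym i2])
  obtain B where B: "\<And>x. \<bar>\<phi> x\<bar> \<le> B" and [measurable]: "\<phi> \<in> borel_measurable borel"
    using \<phi> by (auto simp: bmf_def)
  have i: "integrable M (\<lambda>\<omega>. \<phi> (X \<omega> u))" "integrable M (\<lambda>\<omega>. \<phi> (frozen S u \<omega>))"
    by (rule integrable_bounded_prob [OF prob_space_axioms _ B], measurable)+
  have "\<bar>expectation (\<lambda>\<omega>. \<phi> (X \<omega> u)) - expectation (\<lambda>\<omega>. \<phi> (frozen S u \<omega>))\<bar>
      = \<bar>expectation (\<lambda>\<omega>. \<phi> (X \<omega> u) - \<phi> (frozen S u \<omega>))\<bar>" using i by simp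
  also have "\<dots> \<le> expectation (\<lambda>\<omega>. L * ?Y \<omega>)"
    using i iY L by (intro order.trans [OF integral_abs_bound] integral_mono) auto
  also have "\<dots> \<le> L * e" using EY L0 by (simp add: mult_left_mono)
  finally show ?thesis .
qed

end

section \<open>The law of the frozen solution\<close>

text \<open>The solution taken is \<open>a^T (a a^T)^-1 y\<close>, the one of least norm. For
  \<open>u = a^T x\<close> the square of its norm is the inner product of \<open>x\<close> and
  \<open>y\<close>, and ellipticity bounds the norm of \<open>x\<close> by that of \<open>y\<close>
  over \<open>l\<close>.\<close>

lemma elliptic_solve:
  fixes a :: "real^'n^'d" and y :: "real^'d"
  assumes l: "0 < l" and ell: "\<And>x. l * (norm x)\<^sup>2 \<le> x \<bullet> ((a ** transpose a) *v x)"
  obtains u where "a *v u = y" "norm u \<le> norm y / sqrt l"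
proof -
  let ?T = "(*v) (a ** transpose a)"
  have "inj ?T"
  proof (subst linear_injective_0)
    show "linear ?T" by (rule matrix_vector_mul_linear)
    show "\<forall>x. ?T x = 0 \<longrightarrow> x = 0"
    proof (intro allI impI)
      fix x assume "?T x = 0"
      then have "l * (norm x)\<^sup>2 \<le> 0" using ell [of x] by simp
      then have "(norm x)\<^sup>2 \<le> 0" using l by (simp add: mult_le_0_iff)
      then show "x = 0" by simp
    qed
  qed
  then have "surj ?T" by (intro linear_inj_imp_surj matrix_vector_mul_linear)
  then obtain x where x: "(a ** transpose a) *v x = y" by (metis surjD)
  define u where "u = transpose a *v x"
  have au: "a *v u = y" unfolding u_def matrix_vector_mul_assoc by (rule x)
  have "u = x v* a" by (simp add: u_def)
  then have "(norm u)\<^sup>2 = x \<bullet> (a *v u)"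
    by (simp add: power2_norm_eq_inner dot_lmul_matrix)
  then have n: "(norm u)\<^sup>2 \<le> norm x * norm y" using norm_cauchy_schwarz [of x y] au by simp
  have "l * (norm x)\<^sup>2 \<le> norm x * norm y" using ell [of x] norm_cauchy_schwarz [of x y] x by simp
  then have lx: "l * norm x \<le> norm y"
    by (cases "norm x = 0") (auto simp: power2_eq_square)
  have "l * (norm u)\<^sup>2 \<le> l * (norm x * norm y)" using l n by simp
  also have "\<dots> \<le> norm y * norm y" using mult_right_mono [OF lx, of "norm y"] by simp
  finally have "(sqrt l * norm u)\<^sup>2 \<le> (norm y)\<^sup>2"
    using l unfolding power_mult_distrib by (simp add: power2_eq_square [of "norm y"])
  then have "sqrt l * norm u \<le> norm y" by (rule power2_le_imp_le) simp
  then have "norm u \<le> norm y / sqrt l" using l by (simp add: field_simps)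
  with au show thesis by (rule that)
qed

text \<open>Centred Gaussian law with covariance \<open>c^2 a a^T\<close>. The form as an image
  measure suits rectangular matrices, with no explicit density.\<close>

definition matrix_gauss :: "real \<Rightarrow> real^'n^'d \<Rightarrow> (real^'d) measure" where
  "matrix_gauss c a = distr std_gauss borel (\<lambda>z. c *\<^sub>R (a *v z))"

lemma matrix_vector_measurable:
  "(\<lambda>p. (fst p :: real^'n^'d) *v snd p) \<in> borel_measurable (borel \<Otimes>\<^sub>M borel)"
proof -
  have "continuous_on UNIV (\<lambda>p::(real^'n^'d) \<times> (real^'n). fst p *v snd p)"
    unfolding matrix_vector_mult_def by (intro continuous_intros)
  then show ?thesis unfolding borel_prod by (rule borel_measurable_continuous_onI)
qed

lemma matrix_vector_mult_measurable: "(\<lambda>z. (a :: real^'n^'d) *v z) \<in> borel_measurable borel"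
  by (intro borel_measurable_continuous_onI linear_continuous_on matrix_vector_mul_bounded_linear)

lemma prob_borel_matrix_gauss: "prob_borel (matrix_gauss c a)"
  unfolding matrix_gauss_def
  by (intro prob_borel_distr prob_space_std_gauss) (use matrix_vector_mult_measurable in measurable)

lemma avg_matrix_gauss:
  assumes f: "f \<in> borel_measurable borel"
  shows "avg (matrix_gauss c a) f y = (\<integral>z. f (y + c *\<^sub>R (a *v z)) \<partial>std_gauss)"
  unfolding avg_def matrix_gauss_def
  by (subst integral_distr) (use f matrix_vector_mult_measurable [of a] in measurable)

text \<open>A displacement of the base point is realized as a shift of the noise through
  \<open>elliptic_solve\<close>, and ellipticity controls the length of that shift.\<close>

lemma avg_matrix_gauss_lipschitz:
  fixes a :: "real^'n^'d"
  assumes l: "0 < l" and ell: "\<And>x. l * (norm x)\<^sup>2 \<le> x \<bullet> ((a ** transpose a) *v x)"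
    and g: "bmf g" and B: "\<And>x. \<bar>g x\<bar> \<le> B" and c: "0 < c"
  shows "\<bar>avg (matrix_gauss c a) g x - avg (matrix_gauss c a) g y\<bar> \<le> 2 * B / (c * sqrt l) * norm (x - y)"
proof -
  have [measurable]: "g \<in> borel_measurable borel" "(\<lambda>z. a *v z) \<in> borel_measurable borel"
    using g matrix_vector_mult_measurable by auto
  have B0: "0 \<le> B" using B [of undefined] by linarith
  obtain u where u: "a *v u = (1 / c) *\<^sub>R (x - y)" "norm u \<le> norm ((1 / c) *\<^sub>R (x - y)) / sqrt l"
    using elliptic_solve [OF l ell] by blast
  have "y + c *\<^sub>R (a *v (z + u)) = x + c *\<^sub>R (a *v z)" for z
    using c by (simp add: matrix_vector_right_distrib u scaleR_add_right)
  then have "\<bar>avg (matrix_gauss c a) g x - avg (matrix_gauss c a) g y\<bar> \<le> 2 * B * norm u"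
    using std_gauss_shift [of "\<lambda>z. g (y + c *\<^sub>R (a *v z))" B u] B
    by (simp add: avg_matrix_gauss)
  also have "\<dots> \<le> 2 * B * (norm ((1 / c) *\<^sub>R (x - y)) / sqrt l)"
    using u B0 by (intro mult_left_mono) auto
  also have "norm ((1 / c) *\<^sub>R (x - y)) = norm (x - y) / c" using c by simp
  finally show ?thesis by (simp add: ac_simps)
qed

text \<open>Joint measurability in matrix and point is what allows the random coefficient matrix to
  be inserted.\<close>

lemma funpow_avg_matrix_measurable:
  fixes \<phi> :: "real^'d \<Rightarrow> real"
  assumes \<phi>: "bmf \<phi>"
  shows "(\<lambda>p. (avg (matrix_gauss c (fst p :: real^'n^'d)) ^^ i) \<phi> (snd p)) \<in> borel_measurable (borel \<Otimes>\<^sub>M borel)"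
proof (induction i)
  case 0
  then show ?case using bmfD [OF \<phi>] by simp
next
  case (Suc i)
  define G where "G p = (avg (matrix_gauss c (fst p :: real^'n^'d)) ^^ i) \<phi> (snd p)" for p
  have [measurable]: "G \<in> borel_measurable (borel \<Otimes>\<^sub>M borel)" using Suc by (simp add: G_def [abs_def])
  have [measurable]: "(\<lambda>q. (fst (fst q) :: real^'n^'d) *v snd q) \<in> borel_measurable ((borel \<Otimes>\<^sub>M (borel :: (real^'d) measure)) \<Otimes>\<^sub>M (std_gauss :: (real^'n) measure))"
  proof -
    have "(\<lambda>q. (fst (fst q) :: real^'n^'d, snd q)) \<in> measurable ((borel \<Otimes>\<^sub>M (borel :: (real^'d) measure)) \<Otimes>\<^sub>M (std_gauss :: (real^'n) measure)) (borel \<Otimes>\<^sub>M borel)"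
      by measurable
    from measurable_compose [OF this matrix_vector_measurable] show ?thesis by simp
  qed
  interpret prob_space "std_gauss :: (real^'n) measure" by (rule prob_space_std_gauss)
  have "(\<lambda>p. \<integral>z. G (fst p, snd p + c *\<^sub>R (fst p *v z)) \<partial>std_gauss) \<in> borel_measurable (borel \<Otimes>\<^sub>M borel)"
    by (rule borel_measurable_lebesgue_integral) measurable
  moreover have "(avg (matrix_gauss c (fst p :: real^'n^'d)) ^^ Suc i) \<phi> (snd p)
      = (\<integral>z. G (fst p, snd p + c *\<^sub>R (fst p *v z)) \<partial>std_gauss)" for p
    unfolding G_def funpow.simps comp_def
    by (subst avg_matrix_gauss) (auto intro!: bmfD bmf_funpow_avg prob_borel_matrix_gauss \<phi>)
  ultimately show ?case by simp
qed

lemma funpow_avg_bound: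
  assumes "prob_borel \<kappa>" "\<And>x. \<bar>f x\<bar> \<le> B" shows "\<bar>(avg \<kappa> ^^ i) f x\<bar> \<le> B"
  by (induction i arbitrary: x) (auto intro!: avg_bound assms)

context log_sde
begin

lemma coeff_matrix_measurable:
  assumes S: "0 \<le> S" "S \<le> t"
  shows "(\<lambda>\<omega>. coeff_matrix \<sigma> S (X \<omega>)) \<in> borel_measurable (F t)"
proof (subst borel_measurable_euclidean_space, rule ballI)
  fix e :: "real^'n^'d" assume "e \<in> Basis"
  then obtain i j where e: "e = axis i (axis j 1)" by (auto simp: Basis_vec_def)
  have "(\<lambda>\<omega>. \<sigma> j (X \<omega>) S $ i) \<in> borel_measurable (F t)"
    by (rule measurable_compose [OF \<sigma>_measurable [OF S] borel_measurable_nth])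
  then show "(\<lambda>\<omega>. coeff_matrix \<sigma> S (X \<omega>) \<bullet> e) \<in> borel_measurable (F t)"
    by (simp add: e inner_axis coeff_matrix_def)
qed

lemma coeff_matrix_mult: "coeff_matrix \<sigma> S w *v v = (\<Sum>j\<in>UNIV. v $ j *\<^sub>R \<sigma> j w S)"
  by (simp add: vec_eq_iff coeff_matrix_def matrix_vector_mult_def mult.commute)

lemma frozen_eq_matrix: "frozen S u \<omega> = X \<omega> S + coeff_matrix \<sigma> S (X \<omega>) *v (W \<omega> u - W \<omega> S)"
  by (simp add: frozen_def coeff_matrix_mult dW_def)

text \<open>One of the iterated Gaussian averages is carried out by the actual Brownian increment
  over \<open>[s, t]\<close>, which is independent of the coefficient matrix and of the position
  reached at time \<open>s\<close>.\<close>

lemma expectation_frozen_step: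
  assumes S: "0 \<le> S" "S \<le> s" "s < t" and \<phi>: "bmf \<phi>"
  shows "expectation (\<lambda>\<omega>. (avg (matrix_gauss (sqrt (t - s)) (coeff_matrix \<sigma> S (X \<omega>))) ^^ Suc i) \<phi> (frozen S s \<omega>))
    = expectation (\<lambda>\<omega>. (avg (matrix_gauss (sqrt (t - s)) (coeff_matrix \<sigma> S (X \<omega>))) ^^ i) \<phi> (frozen S t \<omega>))"
proof -
  let ?c = "sqrt (t - s)"
  let ?A = "\<lambda>\<omega>. coeff_matrix \<sigma> S (X \<omega>)"
  define G where "G p = (avg (matrix_gauss ?c (fst p :: real^'n^'d)) ^^ i) \<phi> (snd p)" for p
  have [measurable]: "G \<in> borel_measurable (borel \<Otimes>\<^sub>M borel)"
    using funpow_avg_matrix_measurable [OF \<phi>] by (simp add: G_def [abs_def])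
  obtain B where B: "\<And>x. \<bar>\<phi> x\<bar> \<le> B" using \<phi> by (auto simp: bmf_def)
  have GB: "\<bar>G p\<bar> \<le> B" for p unfolding G_def by (intro funpow_avg_bound prob_borel_matrix_gauss B)
  define f where "f q = G (fst (fst q), snd (fst q) + fst (fst q) *v snd q)" for q
  have [measurable]: "(\<lambda>q. (fst (fst q) :: real^'n^'d) *v snd q) \<in> borel_measurable ((borel \<Otimes>\<^sub>M (borel :: (real^'d) measure)) \<Otimes>\<^sub>M (borel :: (real^'n) measure))"
  proof -
    have "(\<lambda>q. (fst (fst q) :: real^'n^'d, snd q)) \<in> measurable ((borel \<Otimes>\<^sub>M (borel :: (real^'d) measure)) \<Otimes>\<^sub>M (borel :: (real^'n) measure)) (borel \<Otimes>\<^sub>M borel)"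
      by measurable
    from measurable_compose [OF this matrix_vector_measurable] show ?thesis by simp
  qed
  have fm: "f \<in> borel_measurable ((borel \<Otimes>\<^sub>M borel) \<Otimes>\<^sub>M borel)" unfolding f_def [abs_def] by measurable
  have fB: "\<bar>f q\<bar> \<le> B" for q unfolding f_def by (rule GB)
  have s0: "0 \<le> s" using S by simp
  have fr: "frozen S s \<in> borel_measurable (F s)"
    unfolding frozen_def [abs_def] using S
    by (intro borel_measurable_add borel_measurable_sum borel_measurable_scaleR X_measurable dW_measurable \<sigma>_measurable) auto
  have Vm: "(\<lambda>\<omega>. (?A \<omega>, frozen S s \<omega>)) \<in> measurable (F s) (borel \<Otimes>\<^sub>M borel)"
    by (intro measurable_Pair coeff_matrix_measurable fr S)
  have "expectation (\<lambda>\<omega>. f ((?A \<omega>, frozen S s \<omega>), W \<omega> t - W \<omega> s))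
      = expectation (\<lambda>\<omega>. \<integral>z. f ((?A \<omega>, frozen S s \<omega>), ?c *\<^sub>R z) \<partial>std_gauss)"
    by (rule expectation_freeze [OF s0 S(3) Vm fm fB])
  moreover have "f ((?A \<omega>, frozen S s \<omega>), W \<omega> t - W \<omega> s) = (avg (matrix_gauss ?c (?A \<omega>)) ^^ i) \<phi> (frozen S t \<omega>)" for \<omega>
  proof -
    have "frozen S s \<omega> + ?A \<omega> *v (W \<omega> t - W \<omega> s) = X \<omega> S + ?A \<omega> *v ((W \<omega> s - W \<omega> S) + (W \<omega> t - W \<omega> s))"
      unfolding frozen_eq_matrix matrix_vector_right_distrib by (simp only: add.assoc)
    then show ?thesis by (simp add: f_def G_def frozen_eq_matrix [of S t])
  qed
  moreover have "(\<integral>z. f ((?A \<omega>, frozen S s \<omega>), ?c *\<^sub>R z) \<partial>std_gauss)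
      = (avg (matrix_gauss ?c (?A \<omega>)) ^^ Suc i) \<phi> (frozen S s \<omega>)" for \<omega>
    unfolding f_def G_def funpow.simps comp_def
    by (subst avg_matrix_gauss)
      (auto intro!: bmfD bmf_funpow_avg prob_borel_matrix_gauss \<phi> simp: matrix_vector_mult_scaleR)
  ultimately show ?thesis by simp
qed

lemma expectation_frozen_iterate:
  assumes S: "0 \<le> S" and \<tau>: "0 < \<tau>" and \<phi>: "bmf \<phi>"
  shows "expectation (\<lambda>\<omega>. (avg (matrix_gauss (sqrt \<tau>) (coeff_matrix \<sigma> S (X \<omega>))) ^^ k) \<phi> (X \<omega> S))
    = expectation (\<lambda>\<omega>. \<phi> (frozen S (S + real k * \<tau>) \<omega>))"
proof -
  have "expectation (\<lambda>\<omega>. (avg (matrix_gauss (sqrt \<tau>) (coeff_matrix \<sigma> S (X \<omega>))) ^^ k) \<phi> (X \<omega> S))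
    = expectation (\<lambda>\<omega>. (avg (matrix_gauss (sqrt \<tau>) (coeff_matrix \<sigma> S (X \<omega>))) ^^ (k - j)) \<phi> (frozen S (S + real j * \<tau>) \<omega>))"
    if "j \<le> k" for j
    using that
  proof (induction j)
    case 0
    then show ?case by (simp add: frozen_def dW_def)
  next
    case (Suc j)
    let ?s = "S + real j * \<tau>" and ?t = "S + real (Suc j) * \<tau>"
    have st: "?t - ?s = \<tau>" by (simp add: algebra_simps)
    have k: "k - j = Suc (k - Suc j)" using Suc.prems by simp
    have "S \<le> ?s" "?s < ?t" using \<tau> by (auto simp: algebra_simps)
    from expectation_frozen_step [OF S this \<phi>, of "k - Suc j"] Suc show ?case
      unfolding st k by simp
  qed
  from this [of k] show ?thesis by simp
qed

text \<open>The interval is divided into \<open>k\<close> equal parts to provide one Gaussian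
  average for each of the \<open>k\<close> differences. Every part has length
  \<open>(u - S) / k\<close>, which is where \<open>l / real k\<close> comes from.\<close>

lemma frozen_davg_bound:
  assumes S: "0 \<le> S" "S < u" and h: "0 < h" and f: "bmf f" and B: "\<And>x. \<bar>f x\<bar> \<le> B" and k: "0 < k"
  shows "\<bar>expectation (\<lambda>\<omega>. (davg (scaled_gauss h) ^^ k) f (frozen S u \<omega>))\<bar>
    \<le> (2 * gauss_mean_norm TYPE(real^'d) / sqrt (l / real k) * (h / sqrt (u - S))) ^ k * B"
proof -
  define \<tau> where "\<tau> = (u - S) / real k"
  have \<tau>: "0 < \<tau>" and u: "u = S + real k * \<tau>" using S k by (auto simp: \<tau>_def)
  have B0: "0 \<le> B" using B [of undefined] by linarith
  define q where "q = 2 * gauss_mean_norm TYPE(real^'d) / sqrt (l / real k) * (h / sqrt (u - S))"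
  have q: "2 / (sqrt \<tau> * sqrt l) * h * gauss_mean_norm TYPE(real^'d) = q"
    using S k l_pos by (simp add: q_def \<tau>_def real_sqrt_divide ac_simps)
  define Y where "Y \<omega> = (avg (matrix_gauss (sqrt \<tau>) (coeff_matrix \<sigma> S (X \<omega>))) ^^ k)
      ((davg (scaled_gauss h) ^^ k) f) (X \<omega> S)" for \<omega>
  \<comment> \<open>The estimate is pathwise: at fixed \<omega> the coefficient matrix is a
    constant, so averages and differences commute.\<close>
  have Y: "\<bar>Y \<omega>\<bar> \<le> q ^ k * B" if w: "\<omega> \<in> space M" for \<omega>
    unfolding Y_def
  proof (rule funpow_avg_davg_bound [OF prob_borel_matrix_gauss prob_borel_scaled_gauss f _ B])
    fix g :: "real^'d \<Rightarrow> real" and B x assume g: "bmf g" and gB: "\<And>x. \<bar>g x\<bar> \<le> B"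
    have "\<bar>davg (scaled_gauss h) (avg (matrix_gauss (sqrt \<tau>) (coeff_matrix \<sigma> S (X \<omega>))) g) x\<bar>
        \<le> 2 * B / (sqrt \<tau> * sqrt l) * h * gauss_mean_norm TYPE(real^'d)"
      using \<tau> S by (intro davg_scaled_gauss_lipschitz_bound bmf_avg prob_borel_matrix_gauss g h
          avg_matrix_gauss_lipschitz l_pos elliptic X_cpaths w gB) auto
    also have "\<dots> = q * B" unfolding q [symmetric] by simp
    finally show "\<bar>avg (matrix_gauss (sqrt \<tau>) (coeff_matrix \<sigma> S (X \<omega>))) (davg (scaled_gauss h) g) x\<bar> \<le> q * B"
      by (simp add: avg_davg_commute prob_borel_matrix_gauss prob_borel_scaled_gauss g)
  qed
  have "expectation (\<lambda>\<omega>. (davg (scaled_gauss h) ^^ k) f (frozen S u \<omega>)) = expectation Y"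
    unfolding Y_def u by (rule expectation_frozen_iterate [OF S(1) \<tau> bmf_funpow_davg [OF prob_borel_scaled_gauss f], symmetric])
  moreover have "\<bar>expectation Y\<bar> \<le> q ^ k * B"
  proof -
    have q0: "0 \<le> q ^ k * B"
      using B0 h S l_pos gauss_mean_norm_nonneg [where 'e = "real^'d"] unfolding q_def by (intro mult_nonneg_nonneg zero_le_power divide_nonneg_nonneg) auto
    show ?thesis
    proof (cases "integrable M Y")
      case True
      have "\<bar>expectation Y\<bar> \<le> expectation (\<lambda>\<omega>. \<bar>Y \<omega>\<bar>)" by (rule integral_abs_bound)
      also have "\<dots> \<le> expectation (\<lambda>\<omega>. q ^ k * B)"
        using True Y by (intro integral_mono_AE) auto
      finally show ?thesis by (simp add: prob_space)
    qed (simp add: not_integrable_integral_eq q0)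
  qed
  ultimately show ?thesis unfolding q_def by simp
qed

end

section \<open>Decay on small sets and the density\<close>

text \<open>With \<open>x = (1/2)^(1/a)\<close> the sequence \<open>m x^m\<close> tends to 0 and is
  bounded; raising the bound to the power \<open>a\<close> gives the claim.\<close>

lemma half_power_le_powr:
  fixes a :: real
  assumes a: "0 < a"
  obtains c where "0 < c" "\<And>m. 1 \<le> m \<Longrightarrow> (1 / 2) ^ m \<le> c * real m powr - a"
proof -
  define x where "x = (1 / 2 :: real) powr (1 / a)"
  have x: "0 < x" "x < 1" unfolding x_def using a by (simp_all add: powr_def ln_div)
  have "(\<lambda>n. of_nat n * x ^ n) \<longlonglongrightarrow> 0" using x by (intro powser_times_n_limit_0) auto
  then have "Bseq (\<lambda>n. of_nat n * x ^ n)" by (intro convergent_imp_Bseq convergentI)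
  then obtain b where b: "0 < b" "\<And>n. norm (of_nat n * x ^ n) \<le> b" by (auto elim: BseqE)
  show thesis
  proof (rule that [of "b powr a"])
    show "0 < b powr a" using b by simp
    fix m :: nat assume m: "1 \<le> m"
    have "(real m * x ^ m) powr a \<le> b powr a"
      using b(2) [of m] a x by (intro powr_mono2) auto
    moreover have "(x ^ m) powr a = (1 / 2) ^ m"
      using a x by (simp add: x_def powr_realpow [symmetric] powr_powr)
    ultimately have "real m powr a * (1 / 2) ^ m \<le> b powr a"
      using x by (simp add: powr_mult)
    then show "(1 / 2) ^ m \<le> b powr a * real m powr - a"
      using m by (simp add: powr_minus field_simps)
  qed
qed

text \<open>The exponent is split in half: one half is kept as a power of \<open>m\<close>, the
  other makes the sum converge. The rate is weaker than the optimal \<open>1 + a\<close>, but any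
  exponent above 1 serves.\<close>

lemma sum_powr_tail:
  fixes a :: real
  assumes a: "0 < a"
  obtains Z where "0 \<le> Z"
    "\<And>m n. 1 \<le> m \<Longrightarrow> (\<Sum>i\<in>{m..<n}. real i powr - (2 + a)) \<le> Z * real m powr - (1 + a / 2)"
proof -
  have s: "summable (\<lambda>i. real i powr - (1 + a / 2))"
    using a by (subst summable_real_powr_iff) auto
  show thesis
  proof (rule that [of "\<Sum>i. real i powr - (1 + a / 2)"])
    show "0 \<le> (\<Sum>i. real i powr - (1 + a / 2))" by (intro suminf_nonneg s) auto
    fix m n :: nat assume m: "1 \<le> m"
    have "(\<Sum>i\<in>{m..<n}. real i powr - (2 + a))
        \<le> (\<Sum>i\<in>{m..<n}. real i powr - (1 + a / 2) * real m powr - (1 + a / 2))"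
    proof (rule sum_mono)
      fix i assume i: "i \<in> {m..<n}"
      have "real i powr - (2 + a) = real i powr - (1 + a / 2) * real i powr - (1 + a / 2)"
        by (simp add: powr_add [symmetric])
      also have "\<dots> \<le> real i powr - (1 + a / 2) * real m powr - (1 + a / 2)"
        using i m a by (intro mult_left_mono powr_mono2') auto
      finally show "real i powr - (2 + a) \<le> real i powr - (1 + a / 2) * real m powr - (1 + a / 2)" .
    qed
    also have "\<dots> = (\<Sum>i\<in>{m..<n}. real i powr - (1 + a / 2)) * real m powr - (1 + a / 2)"
      by (simp add: sum_distrib_right)
    also have "\<dots> \<le> (\<Sum>i. real i powr - (1 + a / 2)) * real m powr - (1 + a / 2)"
      by (intro mult_right_mono sum_le_suminf s) auto
    finally show "(\<Sum>i\<in>{m..<n}. real i powr - (2 + a)) \<le> (\<Sum>i. real i powr - (1 + a / 2)) * real m powr - (1 + a / 2)" .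
  qed
qed

text \<open>\<open>ln (1 + s) \<le> s\<close> takes care of the part without the factor
  \<open>t / c\<close>. The Orlicz norm of a density \<open>p\<close> is thereby controlled by the
  integral of \<open>p (1 + ln (1 + p))\<close>, an expectation under the law itself.\<close>

lemma e_log_scaled_le:
  assumes "0 \<le> t" "1 \<le> c" shows "e_log (t / c) \<le> 1 / c * (t * (1 + ln (1 + t)))"
proof -
  have s: "0 \<le> t / c" "t / c \<le> t"
    using assms mult_left_mono [of 1 c t] by (simp_all add: divide_le_eq)
  have "e_log (t / c) = ln (1 + t / c) + t / c * ln (1 + t / c)"
    unfolding e_log_def abs_of_nonneg [OF s(1)] by (simp add: distrib_right)
  also have "\<dots> \<le> t / c + t / c * ln (1 + t)"
  proof (intro add_mono mult_left_mono ln_add_one_self_le_self s)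
    show "ln (1 + t / c) \<le> ln (1 + t)" by (rule ln_mono) (use s in linarith)+
  qed
  finally show ?thesis by (simp add: distrib_left add_divide_distrib)
qed

text \<open>A geometric layer-cake bound: every level \<open>R ^ (k + m)\<close> passed by
  \<open>p\<close> pays \<open>ln R\<close>. The layers below index \<open>k\<close> go into the
  constant, because decay is known only from \<open>k\<close> on.\<close>

lemma ln_le_level_sum:
  fixes R p :: real
  assumes R: "1 < R" and p: "0 \<le> p" "p \<le> R ^ (k + n)"
  shows "ln (1 + p) \<le> (ln 2 + real k * ln R) + (\<Sum>m<n. ln R * of_bool (R ^ (k + m) < p))"
  using p(2)
proof (induction n)
  case 0
  have "1 \<le> R ^ k" using R by (intro one_le_power) auto
  then have "ln (1 + p) \<le> ln (2 * R ^ k)" using 0 p by (intro ln_mono) auto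
  then show ?case using R by (simp add: ln_mult ln_realpow)
next
  case (Suc n)
  show ?case
  proof (cases "p \<le> R ^ (k + n)")
    case True
    then show ?thesis using Suc.IH R by simp
  next
    case False
    have "R ^ (k + m) < p" if "m < Suc n" for m
    proof -
      have "R ^ (k + m) \<le> R ^ (k + n)" using that R by (intro power_increasing) auto
      then show ?thesis using False by linarith
    qed
    then have "(\<Sum>m<Suc n. ln R * of_bool (R ^ (k + m) < p)) = (\<Sum>m<Suc n. ln R)"
      by (intro sum.cong) auto
    moreover have "ln (1 + p) \<le> ln (2 * R ^ (k + Suc n))"
    proof -
      have "1 \<le> R ^ (k + Suc n)" using R by (intro one_le_power) auto
      then show ?thesis using Suc.prems p by (intro ln_mono) auto
    qed
    ultimately show ?thesis using R by (simp add: ln_mult ln_realpow algebra_simps)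
  qed
qed

text \<open>For a null set \<open>v\<close> may be made negligible, so only the second term matters,
  and it tends to 0. For integrability, \<open>ln (1 + p)\<close> is of the order of the number of
  levels exceeded; its expectation is a sum of probabilities of level sets, convergent because
  \<open>1 + a > 1\<close>.\<close>

lemma small_set_decay_imp_L_e_log:
  fixes \<mu> :: "'e::euclidean_space measure" and Q c a :: real and k :: nat
  assumes \<mu>: "prob_space \<mu>" "sets \<mu> = sets borel"
    and Q: "1 < Q" and c: "0 \<le> c" and a: "0 < a" and k: "1 \<le> k"
    and decay: "\<And>A v m. A \<in> sets borel \<Longrightarrow> 0 < v \<Longrightarrow> emeasure lborel A \<le> ennreal v \<Longrightarrow> k \<le> m \<Longrightarrow>
      measure \<mu> A \<le> c * (Q ^ m * v + real m powr - (1 + a))"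
  shows "absolutely_continuous lborel \<mu> \<and> (\<lambda>x. enn2real (RN_deriv lborel \<mu> x)) \<in> L_e_log"
proof -
  interpret prob_space \<mu> by fact
  have [measurable_cong]: "sets \<mu> = sets borel" by fact
  have sum0: "summable (\<lambda>m. real m powr - (1 + a))"
    using a by (subst summable_real_powr_iff) auto
  have ac: "absolutely_continuous lborel \<mu>"
    unfolding absolutely_continuous_def
  proof
    fix A assume "A \<in> null_sets (lborel :: 'e measure)"
    then have A: "A \<in> sets borel" "emeasure lborel A = 0" by auto
    \<comment> \<open>Any positive \<open>v\<close> is admissible for a null set; this choice makes
      the two terms equal.\<close>
    have "measure \<mu> A \<le> c * (2 * real m powr - (1 + a))" if m: "k \<le> m" for m
      using decay [OF A(1), of "real m powr - (1 + a) / Q ^ m" m] A m k Q by simp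
    moreover have "(\<lambda>m. c * (2 * real m powr - (1 + a))) \<longlonglongrightarrow> c * (2 * 0)"
      by (intro tendsto_intros summable_LIMSEQ_zero [OF sum0])
    ultimately have "measure \<mu> A \<le> c * (2 * 0)"
      by (intro LIMSEQ_le_const) auto
    then have "measure \<mu> A = 0" by (simp add: measure_le_0_iff)
    then show "A \<in> null_sets \<mu>" using A by (auto simp: null_sets_def emeasure_eq_measure)
  qed
  define p where "p x = enn2real (RN_deriv lborel \<mu> x)" for x
  have p0: "0 \<le> p x" for x by (simp add: p_def)
  have pm [measurable]: "p \<in> borel_measurable borel" unfolding p_def [abs_def] by measurable
  have \<mu>p: "\<mu> = density lborel (\<lambda>x. ennreal (p x))"
  proof -
    have "density lborel (RN_deriv lborel \<mu>) = \<mu>"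
      using ac \<mu> by (intro sigma_finite_measure.density_RN_deriv [OF sigma_finite_lborel]) auto
    moreover have "AE x in lborel. RN_deriv lborel \<mu> x \<noteq> \<infinity>"
      using ac \<mu> by (intro sigma_finite_measure.RN_deriv_finite [OF sigma_finite_lborel] sigma_finite_measure_axioms) auto
    then have "density lborel (RN_deriv lborel \<mu>) = density lborel (\<lambda>x. ennreal (p x))"
      by (intro density_cong) (auto simp: p_def less_top)
    ultimately show ?thesis by simp
  qed
  \<comment> \<open>By Markov's inequality the \<open>m\<close>-th level set has volume at most
    \<open>R^-m\<close>; squaring \<open>Q\<close> leaves \<open>Q^m R^-m = Q^-m\<close>, which is
    summable.\<close>
  define R where "R = Q\<^sup>2"
  have R: "1 < R" using Q by (simp add: R_def one_less_power)
  define A where "A m = {x. R ^ m < p x}" for m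
  have Am [measurable]: "A m \<in> sets borel" for m unfolding A_def by measurable
  have lA: "emeasure lborel (A m) \<le> ennreal (1 / R ^ m)" for m
  proof -
    have "ennreal (R ^ m) * emeasure lborel (A m) = (\<integral>\<^sup>+x. ennreal (R ^ m) * indicator (A m) x \<partial>lborel)"
      by (rule nn_integral_cmult_indicator [symmetric]) simp
    also have "\<dots> \<le> (\<integral>\<^sup>+x. ennreal (p x) \<partial>lborel)"
      by (intro nn_integral_mono) (auto simp: A_def indicator_def intro!: ennreal_leI)
    also have "\<dots> = emeasure (density lborel (\<lambda>x. ennreal (p x))) UNIV"
      by (subst emeasure_density) auto
    also have "\<dots> = 1" using emeasure_space_1 \<mu>p sets_eq_imp_space_eq [OF \<mu>(2)] by simp
    finally have le: "ennreal (R ^ m) * emeasure lborel (A m) \<le> 1" .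
    have "emeasure lborel (A m) = ennreal (1 / R ^ m) * (ennreal (R ^ m) * emeasure lborel (A m))"
      using R by (simp add: mult.assoc [symmetric] ennreal_mult' [symmetric])
    also have "\<dots> \<le> ennreal (1 / R ^ m) * 1" by (intro mult_left_mono le) auto
    finally show ?thesis by simp
  qed
  have \<mu>A: "measure \<mu> (A m) \<le> c * ((1 / Q) ^ m + real m powr - (1 + a))" if "k \<le> m" for m
  proof -
    have "Q ^ m * (1 / R ^ m) = (1 / Q) ^ m"
      using Q by (simp add: R_def power_mult [symmetric] power_divide power2_eq_square power_mult_distrib)
    then show ?thesis using decay [OF Am [of m], of "1 / R ^ m" m] lA [of m] that R by simp
  qed
  have sumA: "summable (\<lambda>m. ln R * measure \<mu> (A (k + m)))"
  proof (rule summable_mult, rule summable_comparison_test')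
    have "summable (\<lambda>m. c * ((1 / Q) ^ m + real m powr - (1 + a)))"
      using Q by (intro summable_mult summable_add sum0 summable_geometric) auto
    then have "summable (\<lambda>m. c * ((1 / Q) ^ (m + k) + real (m + k) powr - (1 + a)))"
      by (subst summable_iff_shift)
    then show "summable (\<lambda>m. c * ((1 / Q) ^ (k + m) + real (k + m) powr - (1 + a)))"
      by (simp add: add.commute)
    show "norm (measure \<mu> (A (k + m))) \<le> c * ((1 / Q) ^ (k + m) + real (k + m) powr - (1 + a))" if "0 \<le> m" for m
      using \<mu>A [of "k + m"] by simp
  qed
  define I where "I = (\<integral>\<^sup>+x. ennreal (p x * (1 + ln (1 + p x))) \<partial>lborel)"
  have "I = (\<integral>\<^sup>+x. ennreal (p x) * ennreal (1 + ln (1 + p x)) \<partial>lborel)"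
    unfolding I_def using p0 by (simp add: ennreal_mult')
  also have "\<dots> = (\<integral>\<^sup>+x. ennreal (1 + ln (1 + p x)) \<partial>\<mu>)"
    by (subst \<mu>p, subst nn_integral_density) auto
  also have "\<dots> \<le> (\<integral>\<^sup>+x. ennreal (1 + (ln 2 + real k * ln R)) + (\<Sum>m. ennreal (ln R) * indicator (A (k + m)) x) \<partial>\<mu>)"
  proof (rule nn_integral_mono)
    fix x
    \<comment> \<open>\<open>p x\<close> is finite, so at each point finitely many levels are
      enough; the infinite sum makes the bound uniform in \<open>x\<close>.\<close>
    obtain n where "p x < R ^ n" using real_arch_pow [OF R] by blast
    also have "R ^ n \<le> R ^ (k + n)" using R by (intro power_increasing) auto
    finally have n: "p x \<le> R ^ (k + n)" by simp
    have lR: "0 \<le> ln R" using R by simp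
    have "1 + ln (1 + p x) \<le> (1 + (ln 2 + real k * ln R)) + (\<Sum>m<n. ln R * of_bool (R ^ (k + m) < p x))"
      using ln_le_level_sum [OF R p0 n] by simp
    then have "ennreal (1 + ln (1 + p x))
        \<le> ennreal ((1 + (ln 2 + real k * ln R)) + (\<Sum>m<n. ln R * of_bool (R ^ (k + m) < p x)))"
      by (rule ennreal_leI)
    also have "\<dots> = ennreal (1 + (ln 2 + real k * ln R)) + ennreal (\<Sum>m<n. ln R * of_bool (R ^ (k + m) < p x))"
      using lR by (intro ennreal_plus sum_nonneg add_nonneg_nonneg mult_nonneg_nonneg) auto
    also have "ennreal (\<Sum>m<n. ln R * of_bool (R ^ (k + m) < p x)) = (\<Sum>m<n. ennreal (ln R) * indicator (A (k + m)) x)"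
    proof -
      have "ennreal (\<Sum>m<n. ln R * of_bool (R ^ (k + m) < p x)) = (\<Sum>m<n. ennreal (ln R * of_bool (R ^ (k + m) < p x)))"
        using lR by (intro sum_ennreal [symmetric]) auto
      also have "\<dots> = (\<Sum>m<n. ennreal (ln R) * indicator (A (k + m)) x)"
        by (intro sum.cong) (auto simp: A_def indicator_def)
      finally show ?thesis .
    qed
    also have "\<dots> \<le> (\<Sum>m. ennreal (ln R) * indicator (A (k + m)) x)"
      by (intro sum_le_suminf) auto
    finally show "ennreal (1 + ln (1 + p x))
        \<le> ennreal (1 + (ln 2 + real k * ln R)) + (\<Sum>m. ennreal (ln R) * indicator (A (k + m)) x)"
      by (simp add: add_left_mono)
  qed
  also have "\<dots> = ennreal (1 + (ln 2 + real k * ln R)) * emeasure \<mu> (space \<mu>)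
      + (\<integral>\<^sup>+x. (\<Sum>m. ennreal (ln R) * indicator (A (k + m)) x) \<partial>\<mu>)"
    by (subst nn_integral_add) auto
  also have "(\<integral>\<^sup>+x. (\<Sum>m. ennreal (ln R) * indicator (A (k + m)) x) \<partial>\<mu>)
      = (\<Sum>m. \<integral>\<^sup>+x. ennreal (ln R) * indicator (A (k + m)) x \<partial>\<mu>)"
    by (rule nn_integral_suminf) auto
  also have "\<dots> = (\<Sum>m. ennreal (ln R * measure \<mu> (A (k + m))))"
    using R by (subst nn_integral_cmult_indicator) (auto simp: emeasure_eq_measure ennreal_mult')
  also have "\<dots> = ennreal (\<Sum>m. ln R * measure \<mu> (A (k + m)))"
    using R by (intro suminf_ennreal2 sumA) auto
  finally have I_fin: "I < \<infinity>" by (simp add: emeasure_space_1 order.strict_trans1 ennreal_less_top)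
  \<comment> \<open>The lower bound 1 is the condition of \<open>e_log_scaled_le\<close>, and it
    covers the case of a small \<open>I\<close>.\<close>
  define c1 where "c1 = max 1 (enn2real I)"
  have c1: "1 \<le> c1" "I \<le> ennreal c1"
    using I_fin by (auto simp: c1_def ennreal_enn2real_if le_max_iff_disj
        intro: order.trans [OF _ ennreal_leI [of "enn2real I"]])
  have "(\<integral>\<^sup>+x. ennreal (e_log (p x / c1)) \<partial>lborel) \<le> (\<integral>\<^sup>+x. ennreal (1 / c1) * ennreal (p x * (1 + ln (1 + p x))) \<partial>lborel)"
  proof (rule nn_integral_mono)
    fix x
    have "ennreal (e_log (p x / c1)) \<le> ennreal (1 / c1 * (p x * (1 + ln (1 + p x))))"
      by (intro ennreal_leI e_log_scaled_le p0 c1)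
    also have "\<dots> = ennreal (1 / c1) * ennreal (p x * (1 + ln (1 + p x)))"
      using c1 by (intro ennreal_mult') auto
    finally show "ennreal (e_log (p x / c1)) \<le> ennreal (1 / c1) * ennreal (p x * (1 + ln (1 + p x)))" .
  qed
  also have "\<dots> = ennreal (1 / c1) * I"
    unfolding I_def by (rule nn_integral_cmult) measurable
  also have "\<dots> \<le> ennreal (1 / c1) * ennreal c1" by (intro mult_left_mono c1) auto
  also have "\<dots> = 1" using c1 by (simp add: ennreal_mult' [symmetric])
  finally have "(\<integral>\<^sup>+x. ennreal (e_log (p x / c1)) \<partial>lborel) \<le> 1" .
  then have "e_log_norm p \<le> ennreal c1"
    unfolding e_log_norm_def using c1 by (intro Inf_lower) (auto intro!: exI [of _ c1])
  then have "e_log_norm p < \<infinity>" by (rule order.strict_trans1) simp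
  then show ?thesis using ac pm unfolding L_e_log_def p_def [abs_def] by simp
qed

section \<open>Rates at dyadic time scales\<close>

context log_sde
begin

text \<open>For the interval length \<open>4^-m\<close> the threshold is chosen with
  \<open>(2 \<eta>)^2 = 2^-m\<close>. Then \<open>ln (1 / (2 \<eta>))\<close> is still proportional
  to \<open>m\<close>, while the probability of a large oscillation is of order \<open>2^-m\<close>
  and disappears in any power of \<open>m\<close>.\<close>

lemma frozen_error_rate:
  assumes T: "0 < T"
  obtains e m0 where "0 \<le> e" "1 \<le> m0" "\<And>m. m0 \<le> m \<Longrightarrow> (1 / 4) ^ m \<le> T"
    "\<And>m. m0 \<le> m \<Longrightarrow> (\<integral>\<^sup>+\<omega>. ennreal ((norm (X \<omega> T - frozen (T - (1 / 4) ^ m) T \<omega>))\<^sup>2) \<partial>M)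
      \<le> ennreal ((e * (1 / 2) ^ m * real m powr - (2 + \<epsilon>))\<^sup>2)"
proof -
  \<comment> \<open>Twice the exponent \<open>2 + \<epsilon>\<close>, because squared errors are
    compared.\<close>
  obtain c where c: "0 < c" "\<And>m. 1 \<le> m \<Longrightarrow> (1 / 2) ^ m \<le> c * real m powr - (2 * (2 + \<epsilon>))"
    using half_power_le_powr [of "2 * (2 + \<epsilon>)"] \<epsilon>_pos by auto
  obtain m1 where m1: "(1 / 4 :: real) ^ m1 < T" using real_arch_pow_inv [OF T, of "1 / 4"] by auto
  define N where "N = (real CARD('n))\<^sup>2"
  define oc where "oc = osc_const CARD('n) K"
  have oc: "0 < oc" unfolding oc_def by (rule osc_const_pos)
  define c2 where "c2 = (C * (ln 2 / 2) powr - (2 + \<epsilon>))\<^sup>2"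
  define E where "E = 8 * N * (c2 + 32 * K\<^sup>2 * oc * c) + 2 * K\<^sup>2 * c"
  have E0: "0 \<le> E" unfolding E_def N_def c2_def using oc c by (intro add_nonneg_nonneg mult_nonneg_nonneg) auto
  show thesis
  proof (rule that [of "sqrt E" "max 1 m1"])
    show "0 \<le> sqrt E" using E0 by simp
    show "1 \<le> max 1 m1" by simp
    fix m assume m: "max 1 m1 \<le> m"
    have "(1 / 4 :: real) ^ m \<le> (1 / 4) ^ m1" using m by (intro power_decreasing) auto
    then show d: "(1 / 4) ^ m \<le> T" using m1 by linarith
    define \<eta> where "\<eta> = sqrt ((1 / 2) ^ m) / 2"
    have "(1 / 2 :: real) ^ m \<le> (1 / 2) ^ 1" using m by (intro power_decreasing) auto
    then have h1: "(1 / 2 :: real) ^ m < 1" by simp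
    have \<eta>: "0 < \<eta>" "2 * \<eta> < 1" using h1 by (auto simp: \<eta>_def)
    have \<eta>2: "\<eta>\<^sup>2 = (1 / 2) ^ m / 4" by (simp add: \<eta>_def power_divide)
    have quarter: "(1 / 4 :: real) ^ m = (1 / 2) ^ m * (1 / 2) ^ m"
      by (simp add: power_mult_distrib [symmetric])
    define p where "p = real m powr - (2 + \<epsilon>)"
    have p2: "real m powr - (2 * (2 + \<epsilon>)) = p\<^sup>2"
      by (simp add: p_def power2_eq_square powr_add [symmetric])
    have lm: "log_modulus \<epsilon> (2 * \<eta>) = p * (ln 2 / 2) powr - (2 + \<epsilon>)"
    proof -
      have "ln (1 / (2 * \<eta>)) = real m * (ln 2 / 2)"
        by (simp add: \<eta>_def ln_div ln_sqrt ln_realpow)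
      then have "log_modulus \<epsilon> (2 * \<eta>) = (real m * (ln 2 / 2)) powr - (2 + \<epsilon>)"
        using \<eta> by (simp only: log_modulus_def) simp
      also have "\<dots> = p * (ln 2 / 2) powr - (2 + \<epsilon>)"
        unfolding p_def by (rule powr_mult)
      finally show ?thesis .
    qed
    have S: "0 \<le> T - (1 / 4) ^ m" "T - (1 / 4) ^ m < T" "T \<le> T - (1 / 4) ^ m + 1"
      using d by (auto intro: power_le_one)
    have "(\<integral>\<^sup>+\<omega>. ennreal ((norm (X \<omega> T - frozen (T - (1 / 4) ^ m) T \<omega>))\<^sup>2) \<partial>M)
      \<le> ennreal ((1 / 4) ^ m * (8 * N * ((C * log_modulus \<epsilon> (2 * \<eta>))\<^sup>2
         + 8 * K\<^sup>2 * (oc * (1 / 4) ^ m / \<eta>\<^sup>2)) + 2 * K\<^sup>2 * (1 / 4) ^ m))"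
      using frozen_error_square [OF S \<eta>] by (simp add: N_def oc_def)
    also have "\<dots> \<le> ennreal ((sqrt E * (1 / 2) ^ m * real m powr - (2 + \<epsilon>))\<^sup>2)"
    proof (rule ennreal_leI)
      have half: "(1 / 2) ^ m \<le> c * p\<^sup>2" using c(2) [of m] m p2 by simp
      have "oc * (1 / 4) ^ m / \<eta>\<^sup>2 = 4 * oc * (1 / 2) ^ m" unfolding \<eta>2 quarter by simp
      also have "\<dots> \<le> 4 * oc * (c * p\<^sup>2)" using half oc by (intro mult_left_mono) auto
      finally have 1: "8 * K\<^sup>2 * (oc * (1 / 4) ^ m / \<eta>\<^sup>2) \<le> 8 * K\<^sup>2 * (4 * oc * (c * p\<^sup>2))"
        by (intro mult_left_mono) auto
      have 2: "2 * K\<^sup>2 * (1 / 4) ^ m \<le> 2 * K\<^sup>2 * (c * p\<^sup>2)"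
      proof (intro mult_left_mono)
        have "(1 / 4 :: real) ^ m \<le> (1 / 2) ^ m" by (intro power_mono) auto
        then show "(1 / 4) ^ m \<le> c * p\<^sup>2" using half by simp
      qed auto
      have 3: "(C * log_modulus \<epsilon> (2 * \<eta>))\<^sup>2 = c2 * p\<^sup>2"
        unfolding lm c2_def by (simp add: power_mult_distrib ac_simps)
      have "(1 / 4) ^ m * (8 * N * ((C * log_modulus \<epsilon> (2 * \<eta>))\<^sup>2
         + 8 * K\<^sup>2 * (oc * (1 / 4) ^ m / \<eta>\<^sup>2)) + 2 * K\<^sup>2 * (1 / 4) ^ m)
        \<le> (1 / 4) ^ m * (8 * N * (c2 * p\<^sup>2 + 8 * K\<^sup>2 * (4 * oc * (c * p\<^sup>2))) + 2 * K\<^sup>2 * (c * p\<^sup>2))"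
        unfolding 3 by (intro mult_left_mono add_mono 1 2 order.refl) (auto simp: N_def)
      also have "\<dots> = (1 / 4) ^ m * (E * p\<^sup>2)" by (simp add: E_def algebra_simps)
      also have "\<dots> = (sqrt E * (1 / 2) ^ m * p)\<^sup>2"
        using E0 unfolding quarter by (simp add: power_mult_distrib power2_eq_square ac_simps)
      finally show "(1 / 4) ^ m * (8 * N * ((C * log_modulus \<epsilon> (2 * \<eta>))\<^sup>2
         + 8 * K\<^sup>2 * (oc * (1 / 4) ^ m / \<eta>\<^sup>2)) + 2 * K\<^sup>2 * (1 / 4) ^ m)
         \<le> (sqrt E * (1 / 2) ^ m * real m powr - (2 + \<epsilon>))\<^sup>2"
        unfolding p_def .
    qed
    finally show "(\<integral>\<^sup>+\<omega>. ennreal ((norm (X \<omega> T - frozen (T - (1 / 4) ^ m) T \<omega>))\<^sup>2) \<partial>M)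
      \<le> ennreal ((sqrt E * (1 / 2) ^ m * real m powr - (2 + \<epsilon>))\<^sup>2)" .
  qed
qed

text \<open>The smoothing scale is logarithmically smaller than the standard deviation \<open>2^-m\<close> of the
  Gaussian increment over a time interval of length \<open>4^-m\<close>.\<close>

definition scale :: "nat \<Rightarrow> real" where
  "scale m = (1 / 2) ^ m * real m powr - (\<epsilon> / 2)"

lemma scale_pos: "1 \<le> m \<Longrightarrow> 0 < scale m"
  by (simp add: scale_def)

lemma scale_tendsto: "scale \<longlonglongrightarrow> 0"
proof -
  have "(\<lambda>m. real m powr - (\<epsilon> / 2)) \<longlonglongrightarrow> 0"
    using \<epsilon>_pos by (intro tendsto_neg_powr filterlim_real_sequentially) auto
  then have "(\<lambda>m. (1 / 2) ^ m * real m powr - (\<epsilon> / 2)) \<longlonglongrightarrow> 0 * 0"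
    by (intro tendsto_mult LIMSEQ_realpow_zero) auto
  then show ?thesis by (simp add: scale_def [abs_def])
qed

text \<open>Consecutive scales are comparable up to a fixed factor, so the finer smoothing has a
  Lipschitz constant of the same order as the coarser one.\<close>

lemma scale_Suc:
  assumes m: "1 \<le> m"
  shows "scale (Suc m) \<le> scale m" "scale m \<le> 2 * 2 powr (\<epsilon> / 2) * scale (Suc m)"
proof -
  have "real (Suc m) powr - (\<epsilon> / 2) \<le> real m powr - (\<epsilon> / 2)"
    using \<epsilon>_pos m by (intro powr_mono2') auto
  then show "scale (Suc m) \<le> scale m" unfolding scale_def
    by (intro mult_mono power_decreasing) auto
  have "(2 * real m) powr - (\<epsilon> / 2) \<le> real (Suc m) powr - (\<epsilon> / 2)"
    using \<epsilon>_pos m by (intro powr_mono2') auto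
  then have "2 powr (\<epsilon> / 2) * (2 powr - (\<epsilon> / 2) * real m powr - (\<epsilon> / 2)) \<le> 2 powr (\<epsilon> / 2) * real (Suc m) powr - (\<epsilon> / 2)"
    by (intro mult_left_mono) (auto simp: powr_mult)
  also have "2 powr (\<epsilon> / 2) * (2 powr - (\<epsilon> / 2) * real m powr - (\<epsilon> / 2)) = real m powr - (\<epsilon> / 2)"
    by (simp only: mult.assoc [symmetric] powr_add [symmetric]) simp
  finally have "real m powr - (\<epsilon> / 2) \<le> 2 powr (\<epsilon> / 2) * real (Suc m) powr - (\<epsilon> / 2)" .
  then have "(1 / 2) ^ m * real m powr - (\<epsilon> / 2) \<le> (1 / 2) ^ m * (2 powr (\<epsilon> / 2) * real (Suc m) powr - (\<epsilon> / 2))"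
    by (intro mult_left_mono) auto
  then show "scale m \<le> 2 * 2 powr (\<epsilon> / 2) * scale (Suc m)"
    by (simp add: scale_def)
qed

lemma smooth_increment_bound:
  assumes T: "0 < T" and k: "2 + \<epsilon> / 2 \<le> real k * (\<epsilon> / 2)"
  obtains c m0 where "0 \<le> c" "1 \<le> m0"
    "\<And>f m. bmf f \<Longrightarrow> (\<And>x. \<bar>f x\<bar> \<le> 1) \<Longrightarrow> m0 \<le> m \<Longrightarrow>
      \<bar>expectation (\<lambda>\<omega>. smooth (scale (Suc m)) k f (X \<omega> T)) - expectation (\<lambda>\<omega>. smooth (scale m) k f (X \<omega> T))\<bar>
      \<le> c * real m powr - (2 + \<epsilon> / 2)"
proof -
  obtain e m0 where e: "0 \<le> e" and m0: "1 \<le> m0" "\<And>m. m0 \<le> m \<Longrightarrow> (1 / 4) ^ m \<le> T"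
    and err: "\<And>m. m0 \<le> m \<Longrightarrow> (\<integral>\<^sup>+\<omega>. ennreal ((norm (X \<omega> T - frozen (T - (1 / 4) ^ m) T \<omega>))\<^sup>2) \<partial>M)
      \<le> ennreal ((e * (1 / 2) ^ m * real m powr - (2 + \<epsilon>))\<^sup>2)"
    using frozen_error_rate [OF T] by blast
  have k0: "0 < k" using k \<epsilon>_pos by (cases k) auto
  define g where "g = 2 * gauss_mean_norm TYPE(real^'d) / sqrt (l / real k)"
  have g0: "0 \<le> g" unfolding g_def using gauss_mean_norm_nonneg [where 'e = "real^'d"] l_pos by auto
  define r where "r = 2 * 2 powr (\<epsilon> / 2)"
  have r0: "0 < r" by (simp add: r_def)
  define c where "c = 2 * g ^ k + 2 ^ k * 4 * r * e"
  show thesis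
  proof (rule that [of c m0])
    show "0 \<le> c" using g0 r0 e by (simp add: c_def)
    show "1 \<le> m0" by (rule m0)
    fix f :: "real^'d \<Rightarrow> real" and m
    assume f: "bmf f" and f1: "\<And>x. \<bar>f x\<bar> \<le> 1" and m: "m0 \<le> m"
    have m1: "1 \<le> m" using m m0 by simp
    let ?S = "T - (1 / 4) ^ m"
    have S: "0 \<le> ?S" "?S < T" using m0(2) [OF m] by auto
    define \<phi> where "\<phi> x = smooth (scale (Suc m)) k f x - smooth (scale m) k f x" for x
    have b\<phi>: "bmf \<phi>" unfolding \<phi>_def [abs_def] by (intro bmf_diff bmf_smooth f)
    have h: "0 < scale m" "0 < scale (Suc m)" using m1 by (auto intro: scale_pos)
    have inv: "1 / scale m \<le> r / scale m" "1 / scale (Suc m) \<le> r / scale m"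
    proof -
      have "1 \<le> 2 powr (\<epsilon> / 2)" using \<epsilon>_pos by (intro ge_one_powr_ge_zero) auto
      then show "1 / scale m \<le> r / scale m" using h by (intro divide_right_mono) (auto simp: r_def)
      show "1 / scale (Suc m) \<le> r / scale m"
        using scale_Suc(2) [OF m1] h by (simp add: r_def field_simps)
    qed
    have Lip: "\<bar>\<phi> x - \<phi> y\<bar> \<le> (2 ^ k * 4 * r / scale m) * norm (x - y)" for x y
    proof -
      have "\<bar>\<phi> x - \<phi> y\<bar> \<le> \<bar>smooth (scale (Suc m)) k f x - smooth (scale (Suc m)) k f y\<bar>
          + \<bar>smooth (scale m) k f x - smooth (scale m) k f y\<bar>"
        unfolding \<phi>_def by linarith
      also have "\<dots> \<le> 2 ^ k * (2 * 1 / scale (Suc m) * norm (x - y)) + 2 ^ k * (2 * 1 / scale m * norm (x - y))"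
        by (intro add_mono smooth_lipschitz f f1 h)
      also have "\<dots> = (2 ^ k * 2 * (1 / scale (Suc m) + 1 / scale m)) * norm (x - y)"
        by (simp add: algebra_simps)
      also have "\<dots> \<le> (2 ^ k * 2 * (r / scale m + r / scale m)) * norm (x - y)"
        by (intro mult_right_mono mult_left_mono add_mono inv) auto
      also have "2 ^ k * 2 * (r / scale m + r / scale m) = 2 ^ k * 4 * r / scale m"
        by (simp add: field_simps)
      finally show ?thesis .
    qed
    have "\<bar>expectation (\<lambda>\<omega>. \<phi> (X \<omega> T)) - expectation (\<lambda>\<omega>. \<phi> (frozen ?S T \<omega>))\<bar>
        \<le> (2 ^ k * 4 * r / scale m) * (e * (1 / 2) ^ m * real m powr - (2 + \<epsilon>))"
      using r0 h e by (intro frozen_lipschitz_error [OF S err [OF m]] b\<phi> Lip) auto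
    \<comment> \<open>The powers of 2 cancel, and dividing by \<open>scale m\<close> gives up
      \<epsilon>/2 of the exponent \<open>2 + \<epsilon>\<close>.\<close>
    also have "\<dots> = 2 ^ k * 4 * r * e * real m powr - (2 + \<epsilon> / 2)"
    proof -
      have "(1 / 2) ^ m * real m powr - (2 + \<epsilon>) / scale m = real m powr (- (2 + \<epsilon>) - (- (\<epsilon> / 2)))"
        unfolding scale_def powr_diff using m1 by simp
      also have "- (2 + \<epsilon>) - (- (\<epsilon> / 2)) = - (2 + \<epsilon> / 2)" by simp
      finally have *: "(1 / 2) ^ m * real m powr - (2 + \<epsilon>) / scale m = real m powr - (2 + \<epsilon> / 2)" .
      show ?thesis unfolding * [symmetric] by simp
    qed
    finally have 1: "\<bar>expectation (\<lambda>\<omega>. \<phi> (X \<omega> T)) - expectation (\<lambda>\<omega>. \<phi> (frozen ?S T \<omega>))\<bar>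
        \<le> 2 ^ k * 4 * r * e * real m powr - (2 + \<epsilon> / 2)" .
    \<comment> \<open>Stated for every \<open>h\<close> up to \<open>scale m\<close>, since the
      finer scale is measured against the same interval.\<close>
    have D: "\<bar>expectation (\<lambda>\<omega>. (davg (scaled_gauss h) ^^ k) f (frozen ?S T \<omega>))\<bar> \<le> g ^ k * real m powr - (2 + \<epsilon> / 2)"
      if h: "0 < h" "h \<le> scale m" for h
    proof -
      have sq: "sqrt (T - ?S) = (1 / 2) ^ m"
      proof -
        have "sqrt ((1 / 4) ^ m) = sqrt (1 / 4) ^ m" by (rule real_sqrt_power)
        also have "sqrt (1 / 4) = 1 / (2::real)" by (simp add: real_sqrt_divide)
        finally show ?thesis by simp
      qed
      have "\<bar>expectation (\<lambda>\<omega>. (davg (scaled_gauss h) ^^ k) f (frozen ?S T \<omega>))\<bar> \<le> (g * (h / (1 / 2) ^ m)) ^ k * 1"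
        using frozen_davg_bound [OF S h(1) f f1 k0] unfolding g_def sq .
      also have "\<dots> \<le> (g * real m powr - (\<epsilon> / 2)) ^ k * 1"
      proof (intro mult_right_mono power_mono mult_left_mono g0)
        have "h / (1 / 2) ^ m \<le> scale m / (1 / 2) ^ m" using h by (intro divide_right_mono) auto
        then show "h / (1 / 2) ^ m \<le> real m powr - (\<epsilon> / 2)" by (simp add: scale_def)
      qed (use h g0 in auto)
      also have "\<dots> = g ^ k * real m powr - (real k * (\<epsilon> / 2))"
        using m1 by (simp add: power_mult_distrib powr_power mult.commute)
      also have "\<dots> \<le> g ^ k * real m powr - (2 + \<epsilon> / 2)"
        using g0 k m1 by (intro mult_left_mono powr_mono) auto
      finally show ?thesis .
    qed
    have int: "integrable M (\<lambda>\<omega>. (davg (scaled_gauss h) ^^ k) f (frozen ?S T \<omega>))" for h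
    proof -
      have b: "bmf ((davg (scaled_gauss h) ^^ k) f)" by (intro bmf_funpow_davg prob_borel_scaled_gauss f)
      then obtain B where B: "\<And>x. \<bar>(davg (scaled_gauss h) ^^ k) f x\<bar> \<le> B" by (auto simp: bmf_def)
      show ?thesis
        using S by (intro integrable_bounded_prob [OF prob_space_axioms _ B]
            measurable_compose [OF frozen_measurable bmfD [OF b]]) auto
    qed
    have "expectation (\<lambda>\<omega>. \<phi> (frozen ?S T \<omega>))
        = expectation (\<lambda>\<omega>. (davg (scaled_gauss (scale m)) ^^ k) f (frozen ?S T \<omega>))
          - expectation (\<lambda>\<omega>. (davg (scaled_gauss (scale (Suc m))) ^^ k) f (frozen ?S T \<omega>))"
      unfolding \<phi>_def smooth_def by (simp add: int)
    then have 2: "\<bar>expectation (\<lambda>\<omega>. \<phi> (frozen ?S T \<omega>))\<bar> \<le> 2 * g ^ k * real m powr - (2 + \<epsilon> / 2)"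
      using D [OF h(1)] D [OF h(2) scale_Suc(1) [OF m1]] by linarith
    have iX: "integrable M (\<lambda>\<omega>. smooth h k f (X \<omega> T))" for h
    proof -
      have b: "bmf (smooth h k f)" by (intro bmf_smooth f)
      then obtain B where B: "\<And>x. \<bar>smooth h k f x\<bar> \<le> B" by (auto simp: bmf_def)
      show ?thesis
        using T by (intro integrable_bounded_prob [OF prob_space_axioms _ B]
            measurable_compose [OF X_measurable_M bmfD [OF b]]) auto
    qed
    have "expectation (\<lambda>\<omega>. smooth (scale (Suc m)) k f (X \<omega> T)) - expectation (\<lambda>\<omega>. smooth (scale m) k f (X \<omega> T))
        = expectation (\<lambda>\<omega>. \<phi> (X \<omega> T))"
      unfolding \<phi>_def by (simp add: iX)
    then show "\<bar>expectation (\<lambda>\<omega>. smooth (scale (Suc m)) k f (X \<omega> T)) - expectation (\<lambda>\<omega>. smooth (scale m) k f (X \<omega> T))\<bar>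
        \<le> c * real m powr - (2 + \<epsilon> / 2)"
      using 1 2 unfolding c_def distrib_right by linarith
  qed
qed

text \<open>Level \<open>m\<close> is handled by the density bound, all finer levels by summing the
  increments. The Lipschitz constant \<open>L\<close> only lets the smoothing error vanish in the
  limit and is absent from the result; this uniformity is what permits the passage to sets.\<close>

lemma expectation_small_mass:
  assumes T: "0 < T"
  obtains c Q m0 where "0 \<le> c" "1 < Q" "1 \<le> m0"
    "\<And>f L v m. bmf f \<Longrightarrow> (\<And>x. 0 \<le> f x) \<Longrightarrow> (\<And>x. f x \<le> 1) \<Longrightarrow>
      (\<And>x y. \<bar>f x - f y\<bar> \<le> L * norm (x - y)) \<Longrightarrow> 0 \<le> v \<Longrightarrow>
      (\<integral>\<^sup>+x. ennreal (f x) \<partial>lborel) \<le> ennreal v \<Longrightarrow> m0 \<le> m \<Longrightarrow>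
      expectation (\<lambda>\<omega>. f (X \<omega> T)) \<le> c * (Q ^ m * v + real m powr - (1 + \<epsilon> / 4))"
proof -
  obtain k where "(2 + \<epsilon> / 2) / (\<epsilon> / 2) \<le> real k" using real_arch_simple by blast
  then have k: "2 + \<epsilon> / 2 \<le> real k * (\<epsilon> / 2)"
    by (subst (asm) pos_divide_le_eq) (use \<epsilon>_pos in auto)
  obtain c m0 where c: "0 \<le> c" and m0: "1 \<le> m0" and inc: "\<And>f m. bmf f \<Longrightarrow> (\<And>x. \<bar>f x\<bar> \<le> 1) \<Longrightarrow> m0 \<le> m \<Longrightarrow>
      \<bar>expectation (\<lambda>\<omega>. smooth (scale (Suc m)) k f (X \<omega> T)) - expectation (\<lambda>\<omega>. smooth (scale m) k f (X \<omega> T))\<bar>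
      \<le> c * real m powr - (2 + \<epsilon> / 2)"
    using smooth_increment_bound [OF T k] by blast
  obtain Z where Z: "0 \<le> Z" and tail: "\<And>m n. 1 \<le> m \<Longrightarrow>
      (\<Sum>i\<in>{m..<n}. real i powr - (2 + \<epsilon> / 2)) \<le> Z * real m powr - (1 + \<epsilon> / 2 / 2)"
    using sum_powr_tail [OF half_gt_zero [OF \<epsilon>_pos]] by blast
  obtain k' where k': "k = Suc k'" using k \<epsilon>_pos by (cases k) auto
  \<comment> \<open>\<open>1 / scale m = 2^m m^(\<epsilon>/2)\<close>, and
    \<open>m \<le> exp m\<close> bounds this by the \<open>m\<close>-th power of
    \<open>2 exp (\<epsilon>/2)\<close>. The dimension enters through the power of the scale in the
    density bound.\<close>
  define Q where "Q = (2 * exp (\<epsilon> / 2)) ^ DIM(real^'d)"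
  have Q1: "1 < 2 * exp (\<epsilon> / 2)" 
  proof -
    have "1 < exp (\<epsilon> / 2)" using \<epsilon>_pos by simp
    then show ?thesis by linarith
  qed
  have Q: "1 < Q" unfolding Q_def using Q1 by (intro one_less_power) auto
  have scale_Q: "1 / scale m ^ DIM(real^'d) \<le> Q ^ m" if m: "1 \<le> m" for m
  proof -
    have "real m powr (\<epsilon> / 2) \<le> exp (real m) powr (\<epsilon> / 2)"
    proof (rule powr_mono2)
      show "real m \<le> exp (real m)" using exp_ge_add_one_self [of "real m"] by linarith
    qed (use \<epsilon>_pos in auto)
    also have "\<dots> = exp (\<epsilon> / 2) ^ m"
      by (simp only: powr_def ln_exp exp_of_nat_mult [symmetric]) (simp add: mult.commute)
    finally have "real m powr (\<epsilon> / 2) \<le> exp (\<epsilon> / 2) ^ m" .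
    then have "2 ^ m * real m powr (\<epsilon> / 2) \<le> (2 * exp (\<epsilon> / 2)) ^ m"
      unfolding power_mult_distrib by (rule mult_left_mono) simp
    moreover have "1 / scale m = 2 ^ m * real m powr (\<epsilon> / 2)"
      using m by (simp add: scale_def powr_minus power_divide field_simps)
    ultimately have "(1 / scale m) ^ DIM(real^'d) \<le> ((2 * exp (\<epsilon> / 2)) ^ m) ^ DIM(real^'d)"
      by (intro power_mono) auto
    also have "\<dots> = (2 * exp (\<epsilon> / 2)) ^ (DIM(real^'d) * m)"
      by (subst mult.commute) (rule power_mult [symmetric])
    also have "\<dots> = Q ^ m" unfolding Q_def by (rule power_mult)
    finally show ?thesis unfolding power_divide power_one .
  qed
  show thesis
  proof (rule that [of "2 ^ k + c * Z" Q m0])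
    show "0 \<le> 2 ^ k + c * Z" "1 < Q" "1 \<le> m0" using c Z Q m0 by auto
    fix f :: "real^'d \<Rightarrow> real" and L v :: real and m
    assume f: "bmf f" and f0: "\<And>x. 0 \<le> f x" and f1: "\<And>x. f x \<le> 1"
      and L: "\<And>x y. \<bar>f x - f y\<bar> \<le> L * norm (x - y)" and v: "0 \<le> v"
      and fv: "(\<integral>\<^sup>+x. ennreal (f x) \<partial>lborel) \<le> ennreal v" and m: "m0 \<le> m"
    have f1': "\<bar>f x\<bar> \<le> 1" for x using f0 [of x] f1 [of x] by simp
    have m1: "1 \<le> m" using m m0 by simp
    define E where "E n = expectation (\<lambda>\<omega>. smooth (scale n) k f (X \<omega> T))" for n
    have int: "integrable M (\<lambda>\<omega>. g (X \<omega> T))" if g: "bmf g" for g :: "real^'d \<Rightarrow> real"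
    proof -
      obtain B where B: "\<And>x. \<bar>g x\<bar> \<le> B" using g by (auto simp: bmf_def)
      show ?thesis
        using T by (intro integrable_bounded_prob [OF prob_space_axioms _ B]
            measurable_compose [OF X_measurable_M bmfD [OF g]]) auto
    qed
    have tele: "E n \<le> E m + c * Z * real m powr - (1 + \<epsilon> / 4)" if n: "m \<le> n" for n
    proof -
      have "E n - E m = (\<Sum>i\<in>{m..<n}. E (Suc i) - E i)"
        using n by (rule sum_Suc_diff' [symmetric])
      also have "\<dots> \<le> (\<Sum>i\<in>{m..<n}. c * real i powr - (2 + \<epsilon> / 2))"
      proof (rule sum_mono)
        fix i assume "i \<in> {m..<n}"
        then have "\<bar>E (Suc i) - E i\<bar> \<le> c * real i powr - (2 + \<epsilon> / 2)"
          unfolding E_def using m by (intro inc f f1') auto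
        then show "E (Suc i) - E i \<le> c * real i powr - (2 + \<epsilon> / 2)" by simp
      qed
      also have "\<dots> = c * (\<Sum>i\<in>{m..<n}. real i powr - (2 + \<epsilon> / 2))" by (simp add: sum_distrib_left)
      also have "\<dots> \<le> c * (Z * real m powr - (1 + \<epsilon> / 2 / 2))" by (intro mult_left_mono tail m1 c)
      finally show ?thesis by simp
    qed
    have approx: "expectation (\<lambda>\<omega>. f (X \<omega> T)) - E n \<le> 2 ^ k' * (L * scale n * gauss_mean_norm TYPE(real^'d))"
      if n: "m \<le> n" for n
    proof -
      have h: "0 < scale n" using n m1 by (intro scale_pos) simp
      have "expectation (\<lambda>\<omega>. f (X \<omega> T)) - E n = expectation (\<lambda>\<omega>. f (X \<omega> T) - smooth (scale n) k f (X \<omega> T))"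
        unfolding E_def using int [OF f] int [OF bmf_smooth [OF f]] by simp
      also have "\<dots> \<le> 2 ^ k' * (L * scale n * gauss_mean_norm TYPE(real^'d))"
        unfolding k' by (rule abs_le_D1 [OF abs_integral_le_prob [OF prob_space_axioms smooth_approx [OF f L h]]])
      finally show ?thesis .
    qed
    have Em: "E m \<le> 2 ^ k * (Q ^ m * v)"
    proof -
      have h: "0 < scale m" by (rule scale_pos [OF m1])
      have "E m \<le> 2 ^ k * (v / scale m ^ DIM(real^'d))"
        unfolding E_def
        by (rule abs_le_D1 [OF abs_integral_le_prob [OF prob_space_axioms smooth_density_bound [OF f f0 fv h v]]])
      also have "\<dots> \<le> 2 ^ k * (Q ^ m * v)"
        using mult_right_mono [OF scale_Q [OF m1] v] by (intro mult_left_mono) auto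
      finally show ?thesis .
    qed
    have bound: "expectation (\<lambda>\<omega>. f (X \<omega> T)) \<le> 2 ^ k * (Q ^ m * v) + c * Z * real m powr - (1 + \<epsilon> / 4)
        + 2 ^ k' * (L * scale n * gauss_mean_norm TYPE(real^'d))" if "m \<le> n" for n
      using tele [OF that] approx [OF that] Em by linarith
    have "(\<lambda>n. 2 ^ k * (Q ^ m * v) + c * Z * real m powr - (1 + \<epsilon> / 4)
        + 2 ^ k' * (L * scale n * gauss_mean_norm TYPE(real^'d)))
      \<longlonglongrightarrow> 2 ^ k * (Q ^ m * v) + c * Z * real m powr - (1 + \<epsilon> / 4)
        + 2 ^ k' * (L * 0 * gauss_mean_norm TYPE(real^'d))"
      by (intro tendsto_add tendsto_mult tendsto_const scale_tendsto)
    then have "expectation (\<lambda>\<omega>. f (X \<omega> T)) \<le> 2 ^ k * (Q ^ m * v) + c * Z * real m powr - (1 + \<epsilon> / 4)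
        + 2 ^ k' * (L * 0 * gauss_mean_norm TYPE(real^'d))"
      by (rule LIMSEQ_le_const) (intro exI [of _ m] allI impI bound)
    also have "\<dots> \<le> (2 ^ k + c * Z) * (Q ^ m * v + real m powr - (1 + \<epsilon> / 4))"
      using c Z Q v by (simp add: distrib_left distrib_right)
    finally show "expectation (\<lambda>\<omega>. f (X \<omega> T)) \<le> (2 ^ k + c * Z) * (Q ^ m * v + real m powr - (1 + \<epsilon> / 4))" .
  qed
qed

text \<open>Truncated multiples of the distance to the complement increase to the indicator of an
  open set and vanish outside it, so their integrals are at most its volume. Their Lipschitz
  constants are unbounded, which is why the hypothesis must hold with one \<open>r\<close> for all
  \<open>L\<close>.\<close>

lemma open_small_mass:
  assumes T: "0 < T"
    and H: "\<And>f L. bmf f \<Longrightarrow> (\<And>x. 0 \<le> f x) \<Longrightarrow> (\<And>x. f x \<le> 1) \<Longrightarrow>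
      (\<And>x y. \<bar>f x - f y\<bar> \<le> L * norm (x - y)) \<Longrightarrow>
      (\<integral>\<^sup>+x. ennreal (f x) \<partial>lborel) \<le> ennreal v \<Longrightarrow> expectation (\<lambda>\<omega>. f (X \<omega> T)) \<le> r"
    and U: "open (U :: (real^'d) set)" and v: "emeasure lborel U \<le> ennreal v"
  shows "prob ((\<lambda>\<omega>. X \<omega> T) -` U \<inter> space M) \<le> r"
proof -
  have UM [measurable]: "U \<in> sets borel" using U by simp
  have XT [measurable]: "(\<lambda>\<omega>. X \<omega> T) \<in> borel_measurable M" using T by (intro X_measurable_M) simp
  \<comment> \<open>Finite volume excludes the whole space. With an empty complement
    \<open>infdist\<close> would be 0 and the functions below would not approximate the
    indicator.\<close>
  have "U \<noteq> UNIV" using v by (auto simp: top_unique)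
  then have ne: "- U \<noteq> {}" by auto
  define f where "f j x = min 1 (real j * infdist x (- U))" for j x
  have f0: "0 \<le> f j x" and f1: "f j x \<le> 1" for j x by (auto simp: f_def infdist_nonneg)
  have out: "f j x = 0" if "x \<notin> U" for j x using that by (simp add: f_def)
  have Lip: "\<bar>f j x - f j y\<bar> \<le> real j * norm (x - y)" for j x y
  proof -
    have "\<bar>f j x - f j y\<bar> \<le> \<bar>real j * infdist x (- U) - real j * infdist y (- U)\<bar>"
      unfolding f_def by linarith
    also have "\<dots> = real j * \<bar>infdist x (- U) - infdist y (- U)\<bar>"
      by (simp add: right_diff_distrib [symmetric] abs_mult)
    also have "\<dots> \<le> real j * norm (x - y)"
      using infdist_triangle_abs [of x "- U" y] by (intro mult_left_mono) (auto simp: dist_norm)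
    finally show ?thesis .
  qed
  have fm [measurable]: "f j \<in> borel_measurable borel" for j
    unfolding f_def [abs_def] by (intro borel_measurable_continuous_onI continuous_intros)
  have fb: "bmf (f j)" for j by (rule bmfI [of _ 1]) (use f0 f1 fm in \<open>auto simp: abs_le_iff intro: order.trans [of _ 0]\<close>)
  have fv: "(\<integral>\<^sup>+x. ennreal (f j x) \<partial>lborel) \<le> ennreal v" for j
  proof -
    have "(\<integral>\<^sup>+x. ennreal (f j x) \<partial>lborel) \<le> (\<integral>\<^sup>+x. indicator U x \<partial>lborel)"
    proof (rule nn_integral_mono)
      fix x show "ennreal (f j x) \<le> indicator U x"
        using out [of x j] f1 [of j x] by (cases "x \<in> U") auto
    qed
    also have "\<dots> \<le> ennreal v" using v by simp
    finally show ?thesis .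
  qed
  have lim: "(\<lambda>j. f j x) \<longlonglongrightarrow> indicator U x" for x
  proof (cases "x \<in> U")
    case True
    have "0 < infdist x (- U)"
      using True U ne infdist_pos_not_in_closed [of "- U" x] by auto
    then obtain n where n: "1 < real n * infdist x (- U)" using reals_Archimedean3 by blast
    have "f j x = 1" if "n \<le> j" for j
    proof -
      have "real n * infdist x (- U) \<le> real j * infdist x (- U)" using that by (intro mult_right_mono infdist_nonneg) auto
      then show ?thesis using n by (simp add: f_def)
    qed
    then have "\<forall>\<^sub>F j in sequentially. f j x = 1" by (auto simp: eventually_sequentially)
    then have "(\<lambda>j. f j x) \<longlonglongrightarrow> 1" by (rule tendsto_eventually)
    then show ?thesis using True by simp
  qed (simp add: out)
  have "(\<lambda>j. expectation (\<lambda>\<omega>. f j (X \<omega> T))) \<longlonglongrightarrow> expectation (\<lambda>\<omega>. indicator U (X \<omega> T))"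
  proof (rule integral_dominated_convergence [where w = "\<lambda>_. 1"])
    show "AE \<omega> in M. (\<lambda>j. f j (X \<omega> T)) \<longlonglongrightarrow> indicator U (X \<omega> T)" by (intro AE_I2 lim)
    show "AE \<omega> in M. norm (f j (X \<omega> T)) \<le> 1" for j using f0 f1 by simp
  qed auto
  then have "expectation (\<lambda>\<omega>. indicator U (X \<omega> T)) \<le> r"
    by (rule LIMSEQ_le_const2) (use H [OF fb f0 f1 Lip fv] in blast)
  also have "expectation (\<lambda>\<omega>. indicator U (X \<omega> T)) = expectation (indicator ((\<lambda>\<omega>. X \<omega> T) -` U \<inter> space M))"
    by (intro Bochner_Integration.integral_cong refl) (auto simp: indicator_def)
  finally show ?thesis by simp
qed

lemma law_absolutely_continuous_L_e_log:
  assumes T: "0 < T"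
  shows "absolutely_continuous lborel (distr M borel (\<lambda>\<omega>. X \<omega> T)) \<and>
         (\<lambda>x. enn2real (RN_deriv lborel (distr M borel (\<lambda>\<omega>. X \<omega> T)) x)) \<in> L_e_log"
proof -
  have XT [measurable]: "(\<lambda>\<omega>. X \<omega> T) \<in> borel_measurable M" using T by (intro X_measurable_M) simp
  obtain c Q m0 where c: "0 \<le> c" and Q: "1 < Q" and m0: "1 \<le> m0" and H:
    "\<And>f L v m. bmf f \<Longrightarrow> (\<And>x. 0 \<le> f x) \<Longrightarrow> (\<And>x. f x \<le> 1) \<Longrightarrow>
      (\<And>x y. \<bar>f x - f y\<bar> \<le> L * norm (x - y)) \<Longrightarrow> 0 \<le> v \<Longrightarrow>
      (\<integral>\<^sup>+x. ennreal (f x) \<partial>lborel) \<le> ennreal v \<Longrightarrow> m0 \<le> m \<Longrightarrow>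
      expectation (\<lambda>\<omega>. f (X \<omega> T)) \<le> c * (Q ^ m * v + real m powr - (1 + \<epsilon> / 4))"
    using expectation_small_mass [OF T] by blast
  show ?thesis
  proof (rule small_set_decay_imp_L_e_log [of _ Q "2 * c" "\<epsilon> / 4" m0])
    show "prob_space (distr M borel (\<lambda>\<omega>. X \<omega> T))" by (rule prob_space_distr) simp
    fix A :: "(real^'d) set" and v :: real and m
    assume A [measurable]: "A \<in> sets borel" and v: "0 < v" "emeasure lborel A \<le> ennreal v" and m: "m0 \<le> m"
    \<comment> \<open>Outer regularity replaces a Borel set by an open one of volume at most
      \<open>2 v\<close>; the constant \<open>2 * c\<close> absorbs this factor.\<close>
    obtain U where U: "open U" "A \<subseteq> U" "emeasure lborel (U - A) < ennreal v"
      using outer_regular_lborel [OF A v(1)] by blast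
    have [measurable]: "U \<in> sets borel" using U by simp
    have "emeasure lborel U \<le> emeasure lborel A + emeasure lborel (U - A)"
    proof -
      have "U = A \<union> (U - A)" using U by auto
      then show ?thesis using emeasure_subadditive [of A lborel "U - A"] by simp
    qed
    also have "\<dots> \<le> ennreal v + ennreal v" using v U by (intro add_mono) auto
    also have "\<dots> = ennreal (2 * v)" using v by (simp add: ennreal_plus [symmetric] del: ennreal_plus)
    finally have Uv: "emeasure lborel U \<le> ennreal (2 * v)" .
    have "measure (distr M borel (\<lambda>\<omega>. X \<omega> T)) A = prob ((\<lambda>\<omega>. X \<omega> T) -` A \<inter> space M)"
      by (rule measure_distr) auto
    also have "\<dots> \<le> prob ((\<lambda>\<omega>. X \<omega> T) -` U \<inter> space M)"
      using U by (intro finite_measure_mono) auto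
    also have "\<dots> \<le> c * (Q ^ m * (2 * v) + real m powr - (1 + \<epsilon> / 4))"
      by (rule open_small_mass [OF T _ U(1) Uv]) (rule H, use v m in auto)
    also have "\<dots> \<le> 2 * c * (Q ^ m * v + real m powr - (1 + \<epsilon> / 4))"
      using c by (simp add: distrib_left)
    finally show "measure (distr M borel (\<lambda>\<omega>. X \<omega> T)) A \<le> 2 * c * (Q ^ m * v + real m powr - (1 + \<epsilon> / 4))" .
  qed (use Q c m0 \<epsilon>_pos in auto)
qed

end

lemma sym_le_elliptic:
  fixes A :: "real^'n^'d"
  assumes "sym_le (l *\<^sub>R mat 1) (A ** transpose A)"
  shows "l * (norm x)\<^sup>2 \<le> x \<bullet> ((A ** transpose A) *v x)"
proof -
  have "0 \<le> x \<bullet> ((A ** transpose A - l *\<^sub>R mat 1) *v x)"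
    using assms by (simp add: sym_le_def pos_semidef_def)
  then show ?thesis
    by (simp add: matrix_vector_mult_diff_rdistrib inner_diff_right scaleR_matrix_vector_assoc [symmetric]
        power2_norm_eq_inner)
qed

theorem theorem3p1:
  fixes M :: "'a measure"
    and F :: "real \<Rightarrow> 'a measure"
    and W :: "'a \<Rightarrow> real \<Rightarrow> real^'n"
    and X :: "'a \<Rightarrow> real \<Rightarrow> real^'d"
    and \<sigma> :: "'n \<Rightarrow> (real \<Rightarrow> real^'d) \<Rightarrow> (real \<Rightarrow> real^'d)"
    and b :: "(real \<Rightarrow> real^'d) \<Rightarrow> (real \<Rightarrow> real^'d)"
    and \<epsilon> C lam_up lam_low T :: real
  assumes "prob_space M"
    and "filtration_nonneg M F"
    and "brownian_motion M F W"
    and "\<And>j. \<sigma> j \<in> cpaths \<rightarrow> cpaths"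
    and "b \<in> cpaths \<rightarrow> cpaths"
    and "X \<in> space M \<rightarrow> cpaths"
    and "adapted F X"
    and "\<And>j. adapted F (\<lambda>\<omega>. \<sigma> j (X \<omega>))"
    and "adapted F (\<lambda>\<omega>. b (X \<omega>))"
    and "satisfies_sde M F W \<sigma> b X"
    and "\<And>j. bounded {\<sigma> j w t | w t. w \<in> cpaths \<and> 0 \<le> t}"
    and "bounded {b w t | w t. w \<in> cpaths \<and> 0 \<le> t}"
    and "0 < \<epsilon>" and "0 < C"
    and "\<And>j s t w. 0 \<le> s \<Longrightarrow> s \<le> t \<Longrightarrow> w \<in> cpaths \<Longrightarrow> osc s t w < 1 \<Longrightarrow>
           norm (\<sigma> j w t - \<sigma> j w s) \<le> C * log_modulus \<epsilon> (osc s t w)"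
    and "0 < lam_low" and "lam_low \<le> lam_up"
    and "\<And>t w. 0 \<le> t \<Longrightarrow> w \<in> cpaths \<Longrightarrow>
           sym_le (lam_low *\<^sub>R mat 1) (coeff_matrix \<sigma> t w ** transpose (coeff_matrix \<sigma> t w)) \<and>
           sym_le (coeff_matrix \<sigma> t w ** transpose (coeff_matrix \<sigma> t w)) (lam_up *\<^sub>R mat 1)"
    and "0 < T"
  shows "absolutely_continuous lborel (distr M borel (\<lambda>\<omega>. X \<omega> T)) \<and>
         (\<lambda>x. enn2real (RN_deriv lborel (distr M borel (\<lambda>\<omega>. X \<omega> T)) x)) \<in> L_e_log"
proof -
  interpret prob_space M by fact
  obtain J where ito: "\<And>j. is_ito_integral M F (\<lambda>\<omega> t. W \<omega> t $ j) (\<lambda>\<omega>. \<sigma> j (X \<omega>)) (J j)"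
    and eqn: "AE \<omega> in M. \<forall>t\<ge>0. X \<omega> t = X \<omega> 0 + (\<Sum>j\<in>UNIV. J j \<omega> t) + integral {0..t} (b (X \<omega>))"
    using assms(10) unfolding satisfies_sde_def by blast
  have "\<exists>k. \<forall>w t. w \<in> cpaths \<and> 0 \<le> t \<longrightarrow> norm (\<sigma> j w t) \<le> k" for j
    using assms(11) [of j] unfolding bounded_iff by blast
  then obtain k where k: "\<And>j w t. w \<in> cpaths \<Longrightarrow> 0 \<le> t \<Longrightarrow> norm (\<sigma> j w t) \<le> k j" by metis
  obtain kb where kb: "\<And>w t. w \<in> cpaths \<Longrightarrow> 0 \<le> t \<Longrightarrow> norm (b w t) \<le> kb"
    using assms(12) unfolding bounded_iff by blast
  \<comment> \<open>One constant bounds all coefficients: the index type is finite, so the maximum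
    exists, and the 1 makes it positive.\<close>
  define K where "K = Max (insert (max 1 kb) (range k))"
  have K: "max 1 kb \<le> K" "k j \<le> K" for j unfolding K_def by (intro Max_ge; auto)+
  interpret log_sde M F W X \<sigma> b J K \<epsilon> C lam_low
  proof
    show "norm (\<sigma> j w t) \<le> K" if "w \<in> cpaths" "0 \<le> t" for j w t
      using k [OF that, of j] K(2) [of j] by linarith
    show "norm (b w t) \<le> K" if "w \<in> cpaths" "0 \<le> t" for w t
      using kb [OF that] K(1) by linarith
    show "0 < K" using K(1) by linarith
    show "lam_low * (norm x)\<^sup>2 \<le> x \<bullet> ((coeff_matrix \<sigma> t w ** transpose (coeff_matrix \<sigma> t w)) *v x)"
      if "0 \<le> t" "w \<in> cpaths" for t w x
      using assms(18) [OF that] by (intro sym_le_elliptic) blast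
  qed (fact assms ito eqn)+
  show ?thesis by (rule law_absolutely_continuous_L_e_log) fact
qed

end
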